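(* Let $\frac13<\gamma<1$, let $T>0$, and let $\Omega\subset\mathbb{R}^2$ be a smooth bounded domain. Let $u_0:\mathbb{R}^2\to\mathbb{R}$ be Lipschitz continuous with $u_0<0$ in $\Omega$, $u_0\ge 0$ in $\mathbb{R}^2\setminus\bar\Omega$ and $|u_0|\le 1$. Let $\alpha_1,\alpha_2$ be fixed real numbers with $$\frac{1-\gamma}{2\gamma}<\alpha_1<\min\left(1,\frac{1-\gamma}{\gamma}\right),\qquad 0<\alpha_2<\min\left(\alpha_1\frac{2\gamma}{1-\gamma}-1,\ \frac13\right),$$ and for $0<\epsilon<1$ let $u^\epsilon$ be the value functions defined in the context with these data. Then the lower half-relaxed limit $$\underline u(X)=\liminf_{Y\to X,\ \epsilon\to0}u^\epsilon(Y)$$ is a viscosity supersolution of $$u_t-|\nabla u|\,\varphi(\operatorname{curv}(u))=0 .$$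
   Context: Value functions. Set $f(s)=c_\gamma s^{\frac{2\gamma}{\gamma-1}}$ for $s>0$, where $c_\gamma=(1-\gamma)(2\gamma)^{\frac{\gamma}{1-\gamma}}$, and $I_\epsilon=[\epsilon^{\alpha_1},\epsilon^{-\alpha_2}]$. For $v\in\mathbb{R}^2$, $v^\perp$ denotes $v$ rotated by $\pi/2$. The function $u^\epsilon$ is defined on $\mathbb{R}^2\times\{T-k\epsilon^2:\ k=0,1,2,\dots,\ T-k\epsilon^2\ge0\}$ backwards in time by $u^\epsilon(\cdot,T)=u_0$ and $$u^\epsilon(x,t)=\min_{\|v\|=1,\ s\in I_\epsilon}\ \max_{b,\beta\in\{-1,1\}}u^\epsilon\big(x+b\,\epsilon s\,v+\beta\,\epsilon^2f(s)\,v^\perp,\ t+\epsilon^2\big)\quad\text{for } t<T.$$ In the half-relaxed limit, $Y$ ranges over points at which $u^\epsilon$ is defined. Equation. $\operatorname{curv}(u)=-\operatorname{div}(\nabla u/|\nabla u|)$ (spatial derivatives), and $\varphi(\kappa)=-|\kappa|^\gamma$ for $\kappa\le0$, $\varphi(\kappa)=0$ for $\kappa>0$. The equation is considered for $x\in\mathbb{R}^2$, $t\in(0,T)$. Viscosity supersolution. A lower semicontinuous function $u$ is a viscosity supersolution if whenever $\phi(x,t)$ is smooth and $u-\phi$ has a local minimum at $(x_0,t_0)$, then at $(x_0,t_0)$: $\phi_t-|\nabla\phi|\varphi(\operatorname{curv}(\phi))\le0$ if $\nabla\phi(x_0,t_0)\ne0$, and $\phi_t\le0$ if $\nabla\phi(x_0,t_0)=0$.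 (The inequality sign is this way because the equation is a backward, terminal-value problem. The definition does not involve the terminal condition.) *)

theory Defs
  imports "HOL-Analysis.Analysis"
begin

section \<open>Smooth functions and smooth domains\<close>

text \<open>Only meant for open \<open>S\<close>, since the derivatives are taken with respect to the whole space.\<close>

primrec Ck_on :: "nat \<Rightarrow> ('a::real_normed_vector) set \<Rightarrow> ('a \<Rightarrow> 'b::real_normed_vector) \<Rightarrow> bool" where
  "Ck_on 0 S g \<longleftrightarrow> continuous_on S g"
| "Ck_on (Suc k) S g \<longleftrightarrow> (\<forall>x\<in>S. g differentiable (at x)) \<and>
     (\<forall>h. Ck_on k S (\<lambda>x. frechet_derivative g (at x) h))"

definition smooth_on :: "('a::real_normed_vector) set \<Rightarrow> ('a \<Rightarrow> 'b::real_normed_vector) \<Rightarrow> bool" where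
  "smooth_on S g \<longleftrightarrow> (\<forall>k. Ck_on k S g)"

definition grad :: "(real^'n \<Rightarrow> real) \<Rightarrow> real^'n \<Rightarrow> real^'n" where
  "grad g x = (\<chi> i. frechet_derivative g (at x) (axis i 1))"

definition divergence :: "(real^'n \<Rightarrow> real^'n) \<Rightarrow> real^'n \<Rightarrow> real" where
  "divergence F x = (\<Sum>i\<in>UNIV. frechet_derivative F (at x) (axis i 1) $ i)"

text \<open>Smoothness of the boundary is expressed by local defining functions: near each boundary
  point, the domain is the strict sublevel set of a smooth function without critical points.\<close>

definition smooth_bounded_domain :: "(real^'n) set \<Rightarrow> bool" where
  "smooth_bounded_domain \<Omega> \<longleftrightarrow> open \<Omega> \<and> connected \<Omega> \<and> \<Omega> \<noteq> {} \<and> bounded \<Omega> \<and>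
     (\<forall>p\<in>frontier \<Omega>. \<exists>U \<rho>. open U \<and> p \<in> U \<and> smooth_on U \<rho> \<and> (\<forall>x\<in>U. grad \<rho> x \<noteq> 0) \<and>
        \<Omega> \<inter> U = {x\<in>U. \<rho> x < 0})"


section \<open>The value functions\<close>

definition perp :: "real^2 \<Rightarrow> real^2" where
  "perp v = vector [- (v $ 2), v $ 1]"

definition game_c :: "real \<Rightarrow> real" where
  "game_c \<gamma> = (1 - \<gamma>) * (2 * \<gamma>) powr (\<gamma> / (1 - \<gamma>))"

definition game_f :: "real \<Rightarrow> real \<Rightarrow> real" where
  "game_f \<gamma> s = game_c \<gamma> * s powr (2 * \<gamma> / (\<gamma> - 1))"

definition step_range :: "real \<Rightarrow> real \<Rightarrow> real \<Rightarrow> real set" where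
  "step_range \<alpha>1 \<alpha>2 \<epsilon> = {\<epsilon> powr \<alpha>1 .. \<epsilon> powr (- \<alpha>2)}"

definition worst_case :: "real \<Rightarrow> real \<Rightarrow> (real^2 \<Rightarrow> real) \<Rightarrow> real^2 \<Rightarrow> real^2 \<Rightarrow> real \<Rightarrow> real" where
  "worst_case \<gamma> \<epsilon> w x v s =
     (MAX (b, \<beta>)\<in>{-1, 1} \<times> {-1, 1}.
        w (x + (b * \<epsilon> * s) *\<^sub>R v + (\<beta> * \<epsilon>\<^sup>2 * game_f \<gamma> s) *\<^sub>R perp v))"

text \<open>\<open>value_iter \<gamma> \<alpha>1 \<alpha>2 u0 \<epsilon> k\<close> is \<open>u\<^sup>\<epsilon>(\<cdot>, T - k\<epsilon>\<^sup>2)\<close>. The infimum is a minimum for Lipschitz \<open>u0\<close>,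
  see \<open>value_fn_minimum\<close> below.\<close>

primrec value_iter ::
    "real \<Rightarrow> real \<Rightarrow> real \<Rightarrow> (real^2 \<Rightarrow> real) \<Rightarrow> real \<Rightarrow> nat \<Rightarrow> real^2 \<Rightarrow> real" where
  "value_iter \<gamma> \<alpha>1 \<alpha>2 u0 \<epsilon> 0 = u0"
| "value_iter \<gamma> \<alpha>1 \<alpha>2 u0 \<epsilon> (Suc k) = (\<lambda>x.
     (INF (v, s)\<in>{v. norm v = 1} \<times> step_range \<alpha>1 \<alpha>2 \<epsilon>.
        worst_case \<gamma> \<epsilon> (value_iter \<gamma> \<alpha>1 \<alpha>2 u0 \<epsilon> k) x v s))"

definition time_grid :: "real \<Rightarrow> real \<Rightarrow> real set" where
  "time_grid T \<epsilon> = {t. 0 \<le> t \<and> (\<exists>k::nat. t = T - real k * \<epsilon>\<^sup>2)}"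

text \<open>Only meaningful for \<open>t \<in> time_grid T \<epsilon>\<close>.\<close>

definition value_fn ::
    "real \<Rightarrow> real \<Rightarrow> real \<Rightarrow> real \<Rightarrow> (real^2 \<Rightarrow> real) \<Rightarrow> real \<Rightarrow> real^2 \<Rightarrow> real \<Rightarrow> real" where
  "value_fn \<gamma> \<alpha>1 \<alpha>2 T u0 \<epsilon> x t =
     value_iter \<gamma> \<alpha>1 \<alpha>2 u0 \<epsilon> (THE k. t = T - real k * \<epsilon>\<^sup>2) x"

text \<open>The filter \<open>Y \<rightarrow> X, \<epsilon> \<rightarrow> 0+\<close>; \<open>Y = X\<close> is allowed, and \<open>Y\<close> is restricted to the points at
  which \<open>u\<^sup>\<epsilon>\<close> is defined.\<close>

definition half_relaxed_filter :: "real \<Rightarrow> (real^2) \<times> real \<Rightarrow> (((real^2) \<times> real) \<times> real) filter" where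
  "half_relaxed_filter T X =
     inf (nhds X \<times>\<^sub>F at_right 0) (principal {((y, s), \<epsilon>). s \<in> time_grid T \<epsilon>})"

text \<open>The \<open>Liminf\<close> is formed in the complete lattice \<open>ereal\<close>; it is finite on \<open>\<real>\<^sup>2 \<times> (0,T)\<close> when
  \<open>\<bar>u0\<bar> \<le> 1\<close>, see \<open>lower_half_relaxed_finite\<close> below.\<close>

definition lower_half_relaxed ::
    "real \<Rightarrow> real \<Rightarrow> real \<Rightarrow> real \<Rightarrow> (real^2 \<Rightarrow> real) \<Rightarrow> (real^2) \<times> real \<Rightarrow> real" where
  "lower_half_relaxed \<gamma> \<alpha>1 \<alpha>2 T u0 X = real_of_ereal
     (Liminf (half_relaxed_filter T X)
        (\<lambda>((y, s), \<epsilon>). ereal (value_fn \<gamma> \<alpha>1 \<alpha>2 T u0 \<epsilon> y s)))"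


section \<open>The equation\<close>

definition space_grad :: "((real^2) \<times> real \<Rightarrow> real) \<Rightarrow> (real^2) \<times> real \<Rightarrow> real^2" where
  "space_grad \<phi> X = grad (\<lambda>y. \<phi> (y, snd X)) (fst X)"

definition time_deriv :: "((real^2) \<times> real \<Rightarrow> real) \<Rightarrow> (real^2) \<times> real \<Rightarrow> real" where
  "time_deriv \<phi> X = deriv (\<lambda>s. \<phi> (fst X, s)) (snd X)"

definition curv :: "((real^2) \<times> real \<Rightarrow> real) \<Rightarrow> (real^2) \<times> real \<Rightarrow> real" where
  "curv \<phi> X = - divergence
     (\<lambda>y. space_grad \<phi> (y, snd X) /\<^sub>R norm (space_grad \<phi> (y, snd X))) (fst X)"

definition speed :: "real \<Rightarrow> real \<Rightarrow> real" where
  "speed \<gamma> \<kappa> = (if \<kappa> \<le> 0 then - (\<bar>\<kappa>\<bar> powr \<gamma>) else 0)"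

definition lower_semicontinuous_on ::
    "('a::topological_space) set \<Rightarrow> ('a \<Rightarrow> real) \<Rightarrow> bool" where
  "lower_semicontinuous_on D u \<longleftrightarrow> (\<forall>X\<in>D. \<forall>a<u X. \<forall>\<^sub>F Y in at X within D. a < u Y)"

definition viscosity_supersolution :: "real \<Rightarrow> real \<Rightarrow> ((real^2) \<times> real \<Rightarrow> real) \<Rightarrow> bool" where
  "viscosity_supersolution \<gamma> T u \<longleftrightarrow>
     lower_semicontinuous_on (UNIV \<times> {0<..<T}) u \<and>
     (\<forall>\<phi>. \<forall>X0\<in>UNIV \<times> {0<..<T}.
        smooth_on (UNIV \<times> {0<..<T}) \<phi> \<and> (\<forall>\<^sub>F X in nhds X0. u X0 - \<phi> X0 \<le> u X - \<phi> X) \<longrightarrow>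
        (if space_grad \<phi> X0 \<noteq> 0
         then time_deriv \<phi> X0 - norm (space_grad \<phi> X0) * speed \<gamma> (curv \<phi> X0) \<le> 0
         else time_deriv \<phi> X0 \<le> 0))"


section \<open>Well-definedness of the value functions and of their half-relaxed limit\<close>

lemma worst_case_ge:
  assumes "b \<in> {-1, 1}" "\<beta> \<in> {-1, 1}"
  shows "w (x + (b * \<epsilon> * s) *\<^sub>R v + (\<beta> * \<epsilon>\<^sup>2 * game_f \<gamma> s) *\<^sub>R perp v) \<le> worst_case \<gamma> \<epsilon> w x v s"
  unfolding worst_case_def by (rule Max_ge) (use assms in auto)

lemma worst_case_leI:
  assumes "\<And>b \<beta>. b \<in> {-1, 1} \<Longrightarrow> \<beta> \<in> {-1, 1} \<Longrightarrow>
     w (x + (b * \<epsilon> * s) *\<^sub>R v + (\<beta> * \<epsilon>\<^sup>2 * game_f \<gamma> s) *\<^sub>R perp v) \<le> B"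
  shows "worst_case \<gamma> \<epsilon> w x v s \<le> B"
proof -
  have "(\<lambda>(b, \<beta>). w (x + (b * \<epsilon> * s) *\<^sub>R v + (\<beta> * \<epsilon>\<^sup>2 * game_f \<gamma> s) *\<^sub>R perp v)) p \<le> B"
    if "p \<in> {-1, 1} \<times> {-1, 1}" for p
  proof -
    have "fst p \<in> {-1, 1}" "snd p \<in> {-1, 1}" using that by auto
    from assms[OF this] show ?thesis by (simp add: case_prod_unfold)
  qed
  then show ?thesis
    unfolding worst_case_def by (intro Max.boundedI) (simp, simp, blast)
qed

lemma worst_case_lipschitz:
  assumes "L-lipschitz_on UNIV w"
  shows "worst_case \<gamma> \<epsilon> w x v s \<le> worst_case \<gamma> \<epsilon> w y v s + L * dist x y"
proof (rule worst_case_leI)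
  fix b \<beta> :: real assume b: "b \<in> {-1, 1}" "\<beta> \<in> {-1, 1}"
  let ?h = "(b * \<epsilon> * s) *\<^sub>R v + (\<beta> * \<epsilon>\<^sup>2 * game_f \<gamma> s) *\<^sub>R perp v"
  have "\<bar>w (x + ?h) - w (y + ?h)\<bar> \<le> L * dist (x + ?h) (y + ?h)"
    using lipschitz_onD[OF assms, of "x + ?h" "y + ?h"] by (simp add: dist_real_def)
  then have "w (x + ?h) \<le> w (y + ?h) + L * dist x y" by simp
  moreover have "w (y + ?h) \<le> worst_case \<gamma> \<epsilon> w y v s"
    using worst_case_ge[OF b, of w y] by (simp add: add.assoc)
  ultimately show "w (x + (b * \<epsilon> * s) *\<^sub>R v + (\<beta> * \<epsilon>\<^sup>2 * game_f \<gamma> s) *\<^sub>R perp v)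
      \<le> worst_case \<gamma> \<epsilon> w y v s + L * dist x y"
    by (simp add: add.assoc)
qed

lemma worst_case_eq_max:
  "worst_case \<gamma> \<epsilon> w x v s =
     (let p = (\<lambda>b \<beta>. w (x + (b * \<epsilon> * s) *\<^sub>R v + (\<beta> * \<epsilon>\<^sup>2 * game_f \<gamma> s) *\<^sub>R perp v))
      in max (max (p (-1) (-1)) (p (-1) 1)) (max (p 1 (-1)) (p 1 1)))"
  by (simp add: worst_case_def Let_def max.assoc)

lemma continuous_on_worst_case:
  assumes "continuous_on UNIV w" "0 < \<epsilon>"
  shows "continuous_on ({v. norm v = 1} \<times> step_range \<alpha>1 \<alpha>2 \<epsilon>) (\<lambda>(v, s). worst_case \<gamma> \<epsilon> w x v s)"
proof -
  let ?S = "{v::real^2. norm v = 1} \<times> step_range \<alpha>1 \<alpha>2 \<epsilon>"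
  have pos: "0 < snd p" if "p \<in> ?S" for p
    using that assms(2) by (auto simp: step_range_def intro: less_le_trans[where y = "\<epsilon> powr \<alpha>1"])
  have "continuous_on ?S (\<lambda>p. game_f \<gamma> (snd p))"
    unfolding game_f_def by (intro continuous_intros) (use pos in force)
  moreover have "continuous_on ?S (\<lambda>p. perp (fst p))"
  proof -
    have "perp v = (\<chi> i. if i = 1 then - (v $ 2) else v $ 1)" for v
      by (simp add: perp_def vec_eq_iff forall_2)
    moreover have "continuous_on ?S (\<lambda>p. if i = 1 then - (fst p $ 2) else fst p $ 1)" for i :: 2
      by (cases "i = 1") (auto intro!: continuous_intros)
    ultimately show ?thesis by (simp add: continuous_on_vec_lambda)
  qed
  ultimately have "continuous_on ?S
      (\<lambda>p. w (x + (b * \<epsilon> * snd p) *\<^sub>R fst p + (\<beta> * \<epsilon>\<^sup>2 * game_f \<gamma> (snd p)) *\<^sub>R perp (fst p)))"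
    for b \<beta>
    by (intro continuous_on_compose2[OF assms(1)] continuous_intros) auto
  then show ?thesis
    unfolding worst_case_eq_max Let_def case_prod_unfold by (intro continuous_on_max)
qed

lemma worst_case_minimum:
  assumes "continuous_on UNIV w" "0 < \<epsilon>" "\<epsilon> < 1" "0 < \<alpha>1" "0 < \<alpha>2"
  obtains v s where "norm v = 1" "s \<in> step_range \<alpha>1 \<alpha>2 \<epsilon>"
    "\<And>v' s'. norm v' = 1 \<Longrightarrow> s' \<in> step_range \<alpha>1 \<alpha>2 \<epsilon> \<Longrightarrow>
       worst_case \<gamma> \<epsilon> w x v s \<le> worst_case \<gamma> \<epsilon> w x v' s'"
    "(INF (v, s)\<in>{v. norm v = 1} \<times> step_range \<alpha>1 \<alpha>2 \<epsilon>. worst_case \<gamma> \<epsilon> w x v s) =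
       worst_case \<gamma> \<epsilon> w x v s"
proof -
  let ?S = "{v::real^2. norm v = 1} \<times> step_range \<alpha>1 \<alpha>2 \<epsilon>"
  have "compact {v::real^2. norm v = 1}"
    using compact_sphere[of "0::real^2" 1] by (simp add: sphere_def)
  then have "compact ?S" by (auto simp: step_range_def intro: compact_Times)
  moreover have "1 \<in> step_range \<alpha>1 \<alpha>2 \<epsilon>"
    using assms powr_le1[of \<alpha>1 \<epsilon>] powr_mono'[of "- \<alpha>2" 0 \<epsilon>] by (simp add: step_range_def)
  then have "(axis 1 1, 1) \<in> ?S" by simp
  then have "?S \<noteq> {}" by blast
  ultimately obtain p where p: "p \<in> ?S"
    "\<forall>q\<in>?S. (\<lambda>(v, s). worst_case \<gamma> \<epsilon> w x v s) p \<le> (\<lambda>(v, s). worst_case \<gamma> \<epsilon> w x v s) q"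
    using continuous_attains_inf[OF _ _ continuous_on_worst_case[OF assms(1,2)]] by metis
  then have "(INF q\<in>?S. (\<lambda>(v, s). worst_case \<gamma> \<epsilon> w x v s) q) = (\<lambda>(v, s). worst_case \<gamma> \<epsilon> w x v s) p"
    by (intro cInf_eq_minimum) auto
  with p show ?thesis by (intro that[of "fst p" "snd p"]) (auto simp: case_prod_beta)
qed

lemma value_iter_lipschitz:
  assumes "L-lipschitz_on UNIV u0" "0 < \<epsilon>" "\<epsilon> < 1" "0 < \<alpha>1" "0 < \<alpha>2"
  shows "L-lipschitz_on UNIV (value_iter \<gamma> \<alpha>1 \<alpha>2 u0 \<epsilon> k)"
proof (induction k)
  case (Suc k)
  let ?w = "value_iter \<gamma> \<alpha>1 \<alpha>2 u0 \<epsilon> k" and ?w' = "value_iter \<gamma> \<alpha>1 \<alpha>2 u0 \<epsilon> (Suc k)"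
  have c: "continuous_on UNIV ?w" by (rule lipschitz_on_continuous_on[OF Suc.IH])
  have le: "?w' x \<le> ?w' y + L * dist x y" for x y
  proof -
    obtain v s where vs: "norm v = 1" "s \<in> step_range \<alpha>1 \<alpha>2 \<epsilon>" "?w' y = worst_case \<gamma> \<epsilon> ?w y v s"
      by (rule worst_case_minimum[OF c assms(2-5), of \<gamma> y]) simp
    obtain v' s' where "?w' x = worst_case \<gamma> \<epsilon> ?w x v' s'"
      "worst_case \<gamma> \<epsilon> ?w x v' s' \<le> worst_case \<gamma> \<epsilon> ?w x v s"
      by (rule worst_case_minimum[OF c assms(2-5), of \<gamma> x]) (use vs in simp)
    then show ?thesis using vs worst_case_lipschitz[OF Suc.IH, of \<gamma> \<epsilon> x v s y] by simp
  qed
  show ?case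
  proof (rule lipschitz_onI)
    show "0 \<le> L" using lipschitz_on_nonneg[OF assms(1)] .
    show "dist (?w' x) (?w' y) \<le> L * dist x y" for x y
      using le[of x y] le[of y x] by (simp add: dist_real_def dist_commute abs_le_iff del: value_iter.simps)
  qed
qed (use assms in simp)

lemma value_fn_grid:
  assumes "0 < \<epsilon>"
  shows "value_fn \<gamma> \<alpha>1 \<alpha>2 T u0 \<epsilon> x (T - real k * \<epsilon>\<^sup>2) = value_iter \<gamma> \<alpha>1 \<alpha>2 u0 \<epsilon> k x"
  using assms by (simp add: value_fn_def)

lemma value_fn_terminal: "0 < \<epsilon> \<Longrightarrow> value_fn \<gamma> \<alpha>1 \<alpha>2 T u0 \<epsilon> x T = u0 x"
  using value_fn_grid[of \<epsilon> \<gamma> \<alpha>1 \<alpha>2 T u0 x 0] by simp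

lemma value_fn_minimum:
  assumes "L-lipschitz_on UNIV u0" "0 < \<epsilon>" "\<epsilon> < 1" "0 < \<alpha>1" "0 < \<alpha>2"
    and "t \<in> time_grid T \<epsilon>" "t < T"
  obtains v s where "norm v = 1" "s \<in> step_range \<alpha>1 \<alpha>2 \<epsilon>"
    "value_fn \<gamma> \<alpha>1 \<alpha>2 T u0 \<epsilon> x t =
       worst_case \<gamma> \<epsilon> (\<lambda>y. value_fn \<gamma> \<alpha>1 \<alpha>2 T u0 \<epsilon> y (t + \<epsilon>\<^sup>2)) x v s"
    "\<And>v' s'. norm v' = 1 \<Longrightarrow> s' \<in> step_range \<alpha>1 \<alpha>2 \<epsilon> \<Longrightarrow>
       value_fn \<gamma> \<alpha>1 \<alpha>2 T u0 \<epsilon> x t \<le>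
         worst_case \<gamma> \<epsilon> (\<lambda>y. value_fn \<gamma> \<alpha>1 \<alpha>2 T u0 \<epsilon> y (t + \<epsilon>\<^sup>2)) x v' s'"
proof -
  obtain m where "t = T - real m * \<epsilon>\<^sup>2" using assms(6) by (auto simp: time_grid_def)
  moreover from this have "m \<noteq> 0" using assms(7) by (cases m) auto
  ultimately obtain k where t: "t = T - real (Suc k) * \<epsilon>\<^sup>2" by (cases m) auto
  have t': "t + \<epsilon>\<^sup>2 = T - real k * \<epsilon>\<^sup>2" by (simp add: t algebra_simps)
  have c: "continuous_on UNIV (value_iter \<gamma> \<alpha>1 \<alpha>2 u0 \<epsilon> k)"
    by (rule lipschitz_on_continuous_on[OF value_iter_lipschitz[OF assms(1-5)]])
  have "value_fn \<gamma> \<alpha>1 \<alpha>2 T u0 \<epsilon> x t = value_iter \<gamma> \<alpha>1 \<alpha>2 u0 \<epsilon> (Suc k) x"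
    unfolding t by (rule value_fn_grid[OF assms(2)])
  moreover have "(\<lambda>y. value_fn \<gamma> \<alpha>1 \<alpha>2 T u0 \<epsilon> y (t + \<epsilon>\<^sup>2)) = value_iter \<gamma> \<alpha>1 \<alpha>2 u0 \<epsilon> k"
    unfolding t' by (rule ext) (rule value_fn_grid[OF assms(2)])
  moreover obtain v s where "norm v = 1" "s \<in> step_range \<alpha>1 \<alpha>2 \<epsilon>"
    "\<And>v' s'. norm v' = 1 \<Longrightarrow> s' \<in> step_range \<alpha>1 \<alpha>2 \<epsilon> \<Longrightarrow>
       worst_case \<gamma> \<epsilon> (value_iter \<gamma> \<alpha>1 \<alpha>2 u0 \<epsilon> k) x v s \<le>
       worst_case \<gamma> \<epsilon> (value_iter \<gamma> \<alpha>1 \<alpha>2 u0 \<epsilon> k) x v' s'"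
    "value_iter \<gamma> \<alpha>1 \<alpha>2 u0 \<epsilon> (Suc k) x =
       worst_case \<gamma> \<epsilon> (value_iter \<gamma> \<alpha>1 \<alpha>2 u0 \<epsilon> k) x v s"
    using worst_case_minimum[OF c assms(2-5), of \<gamma> x] unfolding value_iter.simps by blast
  ultimately show ?thesis by (intro that[of v s]) simp_all
qed

lemma value_iter_bounded:
  assumes "L-lipschitz_on UNIV u0" "0 < \<epsilon>" "\<epsilon> < 1" "0 < \<alpha>1" "0 < \<alpha>2" "\<And>x. \<bar>u0 x\<bar> \<le> 1"
  shows "\<bar>value_iter \<gamma> \<alpha>1 \<alpha>2 u0 \<epsilon> k x\<bar> \<le> 1"
proof (induction k arbitrary: x)
  case (Suc k)
  let ?w = "value_iter \<gamma> \<alpha>1 \<alpha>2 u0 \<epsilon> k"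
  have c: "continuous_on UNIV ?w"
    by (rule lipschitz_on_continuous_on[OF value_iter_lipschitz[OF assms(1-5)]])
  obtain v s where "value_iter \<gamma> \<alpha>1 \<alpha>2 u0 \<epsilon> (Suc k) x = worst_case \<gamma> \<epsilon> ?w x v s"
    by (rule worst_case_minimum[OF c assms(2-5), of \<gamma> x]) simp
  moreover have "worst_case \<gamma> \<epsilon> ?w x v s \<le> 1"
    by (rule worst_case_leI) (use Suc.IH abs_le_D1 in blast)
  moreover have "- 1 \<le> worst_case \<gamma> \<epsilon> ?w x v s"
    using Suc.IH[of "x + (1 * \<epsilon> * s) *\<^sub>R v + (1 * \<epsilon>\<^sup>2 * game_f \<gamma> s) *\<^sub>R perp v"]
      worst_case_ge[of 1 1 ?w x \<epsilon> s v \<gamma>] by force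
  ultimately show ?case by (simp add: abs_le_iff del: value_iter.simps)
qed (use assms in simp)

lemma half_relaxed_filter_nontrivial:
  assumes "0 < t" "t < T"
  shows "half_relaxed_filter T (x, t) \<noteq> bot"
proof
  assume "half_relaxed_filter T (x, t) = bot"
  then have "\<forall>\<^sub>F p in nhds (x, t) \<times>\<^sub>F at_right 0. p \<notin> {((y, s), \<epsilon>). s \<in> time_grid T \<epsilon>}"
    by (simp add: half_relaxed_filter_def trivial_limit_def eventually_inf_principal)
  then obtain P Q where PQ: "eventually P (nhds (x, t))" "eventually Q (at_right 0)"
      "\<And>X \<epsilon>. P X \<Longrightarrow> Q \<epsilon> \<Longrightarrow> snd X \<notin> time_grid T \<epsilon>"
    unfolding eventually_prod_filter by fastforce
  define \<epsilon> where "\<epsilon> n = sqrt ((T - t) / real (Suc n))" for n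
  have "\<epsilon> \<longlonglongrightarrow> sqrt 0" unfolding \<epsilon>_def
    by (intro tendsto_real_sqrt LIMSEQ_Suc lim_const_over_n)
  moreover have pos: "0 < \<epsilon> n" for n using assms by (simp add: \<epsilon>_def)
  ultimately have "filterlim \<epsilon> (at_right 0) sequentially"
    by (simp add: filterlim_at less_imp_neq[THEN not_sym])
  then obtain n where "Q (\<epsilon> n)"
    using PQ(2) by (metis eventually_happens filterlim_iff sequentially_bot)
  moreover have "P (x, t)" using PQ(1) eventually_nhds_x_imp_x by blast
  moreover have "t \<in> time_grid T (\<epsilon> n)"
    unfolding time_grid_def using assms by (auto simp: \<epsilon>_def intro!: exI[of _ "Suc n"])
  ultimately show False using PQ(3) by fastforce
qed

lemma lower_half_relaxed_finite:
  assumes "L-lipschitz_on UNIV u0" "0 < \<alpha>1" "0 < \<alpha>2" "\<And>x. \<bar>u0 x\<bar> \<le> 1" "0 < t" "t < T"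
  shows "ereal (lower_half_relaxed \<gamma> \<alpha>1 \<alpha>2 T u0 (x, t)) =
     Liminf (half_relaxed_filter T (x, t)) (\<lambda>((y, s), \<epsilon>). ereal (value_fn \<gamma> \<alpha>1 \<alpha>2 T u0 \<epsilon> y s))"
proof -
  let ?F = "half_relaxed_filter T (x, t)"
  let ?g = "\<lambda>((y, s), \<epsilon>). ereal (value_fn \<gamma> \<alpha>1 \<alpha>2 T u0 \<epsilon> y s)"
  have "\<forall>\<^sub>F \<epsilon> in at_right (0::real). 0 < \<epsilon> \<and> \<epsilon> < 1"
    unfolding eventually_at_right_field by (intro exI[of _ 1]) auto
  then have "\<forall>\<^sub>F (X, \<epsilon>) in nhds (x, t) \<times>\<^sub>F at_right (0::real). 0 < \<epsilon> \<and> \<epsilon> < 1"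
    by (simp add: eventually_prod2)
  then have "\<forall>\<^sub>F p in nhds (x, t) \<times>\<^sub>F at_right (0::real). 0 < snd p \<and> snd p < 1"
    by (simp add: case_prod_unfold)
  then have ev: "\<forall>\<^sub>F p in ?F. -1 \<le> ?g p \<and> ?g p \<le> 1"
    unfolding half_relaxed_filter_def eventually_inf_principal
  proof eventually_elim
    case (elim p)
    show ?case
    proof
      assume "p \<in> {((y, s), \<epsilon>). s \<in> time_grid T \<epsilon>}"
      then obtain y k \<epsilon> where p: "p = ((y, T - real k * \<epsilon>\<^sup>2), \<epsilon>)" by (auto simp: time_grid_def)
      then have "\<bar>value_fn \<gamma> \<alpha>1 \<alpha>2 T u0 \<epsilon> y (T - real k * \<epsilon>\<^sup>2)\<bar> \<le> 1"
        using elim value_iter_bounded[OF assms(1) _ _ assms(2-4)] by (simp add: value_fn_grid)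
      then show "-1 \<le> ?g p \<and> ?g p \<le> 1"
        by (simp add: p one_ereal_def abs_le_iff)
    qed
  qed
  have "-1 \<le> Liminf ?F ?g"
    by (rule Liminf_bounded) (use ev in \<open>auto elim: eventually_mono\<close>)
  moreover have "Liminf ?F ?g \<le> Limsup ?F ?g"
    by (rule Liminf_le_Limsup[OF half_relaxed_filter_nontrivial[OF assms(5,6)]])
  moreover have "Limsup ?F ?g \<le> 1"
    by (rule Limsup_bounded) (use ev in \<open>auto elim: eventually_mono\<close>)
  ultimately have "\<bar>Liminf ?F ?g\<bar> \<noteq> \<infinity>" by auto
  then show ?thesis unfolding lower_half_relaxed_def by (rule ereal_real')
qed

end

theory Submission
  imports Defs
begin

text \<open>
  Write \<open>U \<epsilon> k\<close> for the value with \<open>k\<close> steps left, \<open>low\<close> for the lower half-relaxed limit, and let \<open>\<phi>\<close> touch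
  \<open>low\<close> from below at \<open>(x0, t0)\<close> with time derivative \<open>a\<close>, gradient \<open>p\<close> and curvature \<open>\<kappa>\<close>. The equation asks
  for \<open>a + \<bar>p\<bar> \<bar>\<kappa>\<bar> powr \<gamma> \<le> 0\<close> when \<open>p \<noteq> 0\<close> and \<open>\<kappa> < 0\<close>, and for \<open>a \<le> 0\<close> in all other cases, because the
  speed then vanishes. So there are two things to prove.

  \<^bold>\<open>First, \<open>low\<close> is nonincreasing in time\<close> (\<open>low_antimono\<close>), hence \<open>a \<le> 0\<close> at every contact point. A short
  game is at most as expensive as a long one, up to an error that vanishes with \<open>\<epsilon>\<close>: the minimiser follows an
  optimal strategy of the long game, stops early, and uses a very short additional time to reach
  \<open>{u0 < \<mu>}\<close> (\<open>value_truncation\<close>). The last phase works because large steps \<open>s\<close> make the normal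
  displacement \<open>f s\<close> negligible while they move the position quickly out of any disc centred on the wrong side:
  nonconvex parts of the complement are filled in no time. The set \<open>fillable \<mu>\<close> of points from which
  \<open>{u0 < \<mu>}\<close> is reached in arbitrarily short time is open, and it contains \<open>p\<close> as soon as it contains a
  neighbourhood of \<open>p\<close> outside a disc with \<open>p\<close> on its boundary (\<open>ball_closed_fillable\<close>). In the plane this
  one-sided condition forces the visible region around each point to be convex
  (\<open>ball_closed_segment_trans\<close>). One consequence is that of two opposite jumps starting outside the fillable
  set at least one stays outside it, so that the value there is at least \<open>\<mu>\<close>, up to a small error (\<open>U_ge_off_fillable\<close>); therefore a
  trajectory with value below \<open>\<mu>\<close> never leaves the convex set visible from its starting point. The other
  consequence concerns large distances, where filling is not uniform: a convex set contains, far away,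
  segments of any prescribed length (\<open>convex_far_direction\<close>), around which the minimiser can wait inside a long
  thin ellipse for the rest of the game (\<open>ellipse_survival\<close>).

  \<^bold>\<open>Second, the strictly curved case.\<close> Replacing \<open>\<phi>\<close> by a slightly smaller quadratic and going to an exact
  minimum point of the discrete difference, the dynamic programming identity gives a control for which none of
  the four jumps increases the quadratic. But for every control some jump increases it
  (\<open>quadratic_game_step\<close>): if the direction is far from tangential, the first order term does it; otherwise the
  increase is about \<open>\<epsilon>\<^sup>2 (a + P f s + s\<^sup>2 k / 2)\<close>, where \<open>P = \<bar>p\<bar>\<close> and \<open>k = P \<bar>\<kappa>\<bar>\<close>, and Young's inequality bounds this
  from below by \<open>\<epsilon>\<^sup>2 (a + P \<bar>\<kappa>\<bar> powr \<gamma>)\<close> (\<open>game_f_Young\<close>).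
\<close>

section \<open>Ball-closed sets in the plane\<close>

text \<open>
  A weak, one-sided form of the statement that the complement of \<open>G\<close> is nowhere strictly convex: at none of its
  points does that complement lie, locally, in a closed disc with this point on the boundary circle.
\<close>

definition ball_closed :: "(real^2) set \<Rightarrow> bool" where
  "ball_closed G \<longleftrightarrow> (\<forall>c p r. 0 < r \<and> p \<noteq> c \<and> ball p r - cball c (dist p c) \<subseteq> G \<longrightarrow> p \<in> G)"

lemma norm_perp [simp]: "norm (perp v) = norm v"
  by (simp add: norm_eq_sqrt_inner perp_def inner_vec_def sum_2)

lemma inner_perp_self [simp]: "v \<bullet> perp v = 0" "perp v \<bullet> v = 0"
  by (simp_all add: perp_def inner_vec_def sum_2)

lemma perp_perp [simp]: "perp (perp v) = - v"
  by (simp add: perp_def vec_eq_iff forall_2)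

lemma segment_in_open_extend:
  fixes y z :: "'a::euclidean_space"
  assumes "open G" "closed_segment y z \<subseteq> G"
  obtains \<tau>0 where "0 < \<tau>0" "\<And>\<tau>. 0 \<le> \<tau> \<Longrightarrow> \<tau> \<le> \<tau>0 \<Longrightarrow> closed_segment y (y + (1 + \<tau>) *\<^sub>R (z - y)) \<subseteq> G"
proof -
  have "z \<in> G" using assms(2) by auto
  then obtain r where r: "0 < r" "ball z r \<subseteq> G" using assms(1) open_contains_ball by blast
  define \<tau>0 where "\<tau>0 = r / (2 * (norm (z - y) + 1))"
  have pos: "0 < \<tau>0" using r unfolding \<tau>0_def
    by (intro divide_pos_pos) (auto intro: add_nonneg_pos)
  show ?thesis
  proof (rule that[OF pos])
    fix \<tau> assume t: "0 \<le> \<tau>" "\<tau> \<le> \<tau>0"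
    let ?z = "y + (1 + \<tau>) *\<^sub>R (z - y)"
    have "norm (?z - z) = \<tau> * norm (z - y)"
      using t by (simp add: algebra_simps flip: scaleR_diff_right)
    also have "\<dots> \<le> \<tau>0 * (norm (z - y) + 1)"
      using t pos by (intro mult_mono) auto
    also have "\<dots> = r / 2"
    proof -
      have "norm (z - y) + 1 \<noteq> 0" using norm_ge_zero[of "z - y"] by linarith
      then show ?thesis unfolding \<tau>0_def by (simp add: divide_simps)
    qed
    finally have "?z \<in> ball z r" using r by (simp add: dist_norm norm_minus_commute)
    then have "closed_segment z ?z \<subseteq> G"
      using r closed_segment_subset[of z "ball z r" ?z] by auto
    moreover have "z \<in> closed_segment y ?z"
      unfolding in_segment using t
      by (intro exI[of _ "1 / (1 + \<tau>)"] conjI) (auto simp: algebra_simps simp flip: scaleR_add_left add_divide_distrib)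
    then have "closed_segment y ?z = closed_segment y z \<union> closed_segment z ?z"
      by (simp add: Un_closed_segment)
    ultimately show "closed_segment y ?z \<subseteq> G" using assms(2) by blast
  qed
qed

lemma norm_add_square:
  fixes a b :: "'a::real_inner"
  shows "(norm (a + b))\<^sup>2 = (norm a)\<^sup>2 + 2 * (a \<bullet> b) + (norm b)\<^sup>2"
  unfolding power2_norm_eq_inner by (simp add: inner_add_left inner_add_right inner_commute[of b a])

lemma orthonormal_expansion:
  assumes "norm e = 1"
  shows "z = (e \<bullet> z) *\<^sub>R e + (perp e \<bullet> z) *\<^sub>R perp e"
proof -
  have e: "e $ 1 * e $ 1 + e $ 2 * e $ 2 = 1"
    using assms by (simp add: norm_eq_sqrt_inner inner_vec_def sum_2)
  have "z $ 1 = (e $ 1 * e $ 1 + e $ 2 * e $ 2) * z $ 1" "z $ 2 = (e $ 1 * e $ 1 + e $ 2 * e $ 2) * z $ 2"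
    by (simp_all add: e)
  then show ?thesis
    by (simp add: vec_eq_iff forall_2 perp_def inner_vec_def sum_2 algebra_simps)
qed

lemma collinear_if_perp:
  assumes "perp (z - x) \<bullet> (y - x) = 0"
  shows "collinear {x, y, z}"
proof (cases "z = x")
  case False
  define e where "e = (z - x) /\<^sub>R norm (z - x)"
  have e: "norm e = 1" "z - x = norm (z - x) *\<^sub>R e" using False by (simp_all add: e_def)
  have "perp e = perp (z - x) /\<^sub>R norm (z - x)"
    by (simp add: e_def perp_def vec_eq_iff forall_2 algebra_simps)
  then have "perp e \<bullet> (y - x) = 0" using assms by simp
  then have "y - x = (e \<bullet> (y - x)) *\<^sub>R e" using orthonormal_expansion[OF e(1), of "y - x"] by simp
  then have "y - x = (e \<bullet> (y - x) / norm (z - x)) *\<^sub>R (z - x)"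
    using e False by (metis divide_inverse_commute e_def scaleR_scaleR mult.commute)
  then have "\<exists>u. y = u *\<^sub>R z + (1 - u) *\<^sub>R x"
    by (intro exI[of _ "e \<bullet> (y - x) / norm (z - x)"]) (simp add: algebra_simps add_diff_eq eq_diff_eq)
  then have "collinear {z, y, x}" by (simp add: collinear_3_expand)
  then show ?thesis by (simp add: insert_commute)
next
  case True
  then have "{x, y, z} = {x, y}" by auto
  then show ?thesis by simp
qed

text \<open>
  Suppose that the third side \<open>[x, z]\<close> of a triangle meets the complement of \<open>G\<close>. After prolonging the other two
  sides slightly, the part of the triangle outside \<open>G\<close> is compact, and a disc of very large radius that swallows
  it and moves towards \<open>y\<close> leaves it last at a point \<open>p\<close> in the interior of the triangle. Near \<open>p\<close> everything
  outside the disc lies in \<open>G\<close>, so that \<open>p\<close> has to be in \<open>G\<close>.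
\<close>

lemma ball_closed_segment_trans:
  assumes G: "open G" "ball_closed G"
    and xy: "closed_segment x y \<subseteq> G" and yz: "closed_segment y z \<subseteq> G"
  shows "closed_segment x z \<subseteq> G"
proof (cases "collinear {x, y, z}")
  case True
  then have "between (y, z) x \<or> between (z, x) y \<or> between (x, y) z"
    by (simp add: collinear_between_cases)
  then have "x \<in> closed_segment y z \<or> y \<in> closed_segment x z \<or> z \<in> closed_segment x y"
    by (auto simp: between_mem_segment closed_segment_commute)
  then have "closed_segment x z \<subseteq> closed_segment x y \<union> closed_segment y z"
  proof (elim disjE)
    assume "y \<in> closed_segment x z"
    from Un_closed_segment[OF this] show ?thesis by simp
  qed (auto simp: subset_closed_segment le_supI1 le_supI2)
  then show ?thesis using xy yz by blast
next
  case False
  obtain \<tau>1 where t1: "0 < \<tau>1"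
    "\<And>\<tau>. 0 \<le> \<tau> \<Longrightarrow> \<tau> \<le> \<tau>1 \<Longrightarrow> closed_segment y (y + (1 + \<tau>) *\<^sub>R (x - y)) \<subseteq> G"
    using segment_in_open_extend[OF G(1), of y x] xy by (auto simp: closed_segment_commute)
  obtain \<tau>2 where t2: "0 < \<tau>2"
    "\<And>\<tau>. 0 \<le> \<tau> \<Longrightarrow> \<tau> \<le> \<tau>2 \<Longrightarrow> closed_segment y (y + (1 + \<tau>) *\<^sub>R (z - y)) \<subseteq> G"
    using segment_in_open_extend[OF G(1) yz] by blast
  define \<tau> where "\<tau> = min \<tau>1 \<tau>2"
  have \<tau>: "0 < \<tau>" using t1 t2 by (simp add: \<tau>_def)
  define X where "X = y + (1 + \<tau>) *\<^sub>R (x - y)"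
  define Z where "Z = y + (1 + \<tau>) *\<^sub>R (z - y)"
  have yX: "closed_segment y X \<subseteq> G" and yZ: "closed_segment y Z \<subseteq> G"
    unfolding X_def Z_def using t1(2)[of \<tau>] t2(2)[of \<tau>] \<tau> by (auto simp: \<tau>_def)
  let ?\<Delta> = "convex hull {y, X, Z}"
  define B where "B = ?\<Delta> - G"
  have hull: "q \<in> ?\<Delta> \<longleftrightarrow> (\<exists>u v. 0 \<le> u \<and> 0 \<le> v \<and> u + v \<le> 1 \<and> q = y + u *\<^sub>R (X - y) + v *\<^sub>R (Z - y))" for q
    unfolding convex_hull_3_alt by blast
  obtain n where n: "n \<bullet> (z - x) = 0" "0 < n \<bullet> (y - x)"
  proof -
    have "perp (z - x) \<bullet> (y - x) \<noteq> 0" using False collinear_if_perp by blast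
    then show thesis
      using that[of "perp (z - x)"] that[of "- perp (z - x)"] by (cases "0 < perp (z - x) \<bullet> (y - x)") auto
  qed
  define H where "H = (1 + \<tau>) * (n \<bullet> (y - x))"
  have H: "0 < H" using n \<tau> by (simp add: H_def)
  have nX: "n \<bullet> (X - y) = - H" "n \<bullet> (Z - y) = - H"
    using n by (simp_all add: X_def Z_def H_def inner_diff_right algebra_simps)
  have height: "n \<bullet> (y + u *\<^sub>R (X - y) + v *\<^sub>R (Z - y) - y) = - (u + v) * H" for u v
    using nX by (simp add: inner_add_right del: inner_diff_right) (simp add: algebra_simps)
  have compB: "compact B" unfolding B_def using G(1)
    by (intro compact_diff finite_imp_compact_convex_hull) auto
  show ?thesis
  proof (rule ccontr)
    assume "\<not> closed_segment x z \<subseteq> G"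
    then obtain w where w: "w \<in> closed_segment x z" "w \<notin> G" by blast
    then obtain t where t: "0 \<le> t" "t \<le> 1" "w = (1 - t) *\<^sub>R x + t *\<^sub>R z"
      by (auto simp: in_segment)
    have weq: "w = y + ((1 - t) / (1 + \<tau>)) *\<^sub>R (X - y) + (t / (1 + \<tau>)) *\<^sub>R (Z - y)"
    proof -
      have "((1 - t) / (1 + \<tau>)) *\<^sub>R (X - y) = (1 - t) *\<^sub>R (x - y)"
        "(t / (1 + \<tau>)) *\<^sub>R (Z - y) = t *\<^sub>R (z - y)"
        using \<tau> by (simp_all add: X_def Z_def)
      then show ?thesis by (simp only: t(3)) (simp add: algebra_simps)
    qed
    have "(1 - t) / (1 + \<tau>) + t / (1 + \<tau>) = 1 / (1 + \<tau>)"
      by (simp flip: add_divide_distrib)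
    then have wh: "n \<bullet> (w - y) = - H / (1 + \<tau>)" unfolding weq height by simp
    have "(1 - t) / (1 + \<tau>) + t / (1 + \<tau>) \<le> 1"
      using \<tau> by (simp flip: add_divide_distrib)
    moreover have "0 \<le> (1 - t) / (1 + \<tau>)" "0 \<le> t / (1 + \<tau>)" using t \<tau> by auto
    ultimately have "w \<in> ?\<Delta>" unfolding hull using weq by blast
    then have wB: "w \<in> B" unfolding B_def using w(2) by blast
    \<comment> \<open>a bad point closest to \<open>y\<close> in the direction \<open>n\<close>\<close>
    have "\<exists>p0\<in>B. \<forall>q\<in>B. n \<bullet> q \<le> n \<bullet> p0"
      by (rule continuous_attains_sup[OF compB]) (use wB in \<open>auto intro!: continuous_intros\<close>)
    then obtain p0 where p0: "p0 \<in> B" "\<And>q. q \<in> B \<Longrightarrow> n \<bullet> q \<le> n \<bullet> p0" by blast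
    have p0h: "- H / (1 + \<tau>) \<le> n \<bullet> (p0 - y)"
      using p0(2)[OF wB] wh by (simp add: inner_diff_right)
    obtain D where D: "0 < D" "\<And>q q'. q \<in> B \<Longrightarrow> q' \<in> B \<Longrightarrow> dist q q' \<le> D"
    proof -
      obtain e where "\<forall>q\<in>B. \<forall>q'\<in>B. dist q q' \<le> e"
        using compact_imp_bounded[OF compB] bounded_two_points by blast
      then show thesis by (intro that[of "max e 1"]) (auto simp: le_max_iff_disj)
    qed
    \<comment> \<open>the room between the line through \<open>x\<close> and \<open>z\<close> and the side \<open>[X, Z]\<close>; it keeps \<open>p\<close> off that side\<close>
    define \<kappa> where "\<kappa> = H - H / (1 + \<tau>)"
    have \<kappa>: "0 < \<kappa>" using H \<tau> by (simp add: \<kappa>_def field_simps)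
    \<comment> \<open>large enough for the farthest point from \<open>c\<close> to be at most \<open>\<kappa> / 2\<close> below \<open>p0\<close>\<close>
    define R where "R = D\<^sup>2 / \<kappa>"
    have R: "0 < R" using D \<kappa> by (simp add: R_def)
    define c where "c = p0 - R *\<^sub>R n"
    have "\<exists>p\<in>B. \<forall>q\<in>B. dist q c \<le> dist p c"
      by (rule continuous_attains_sup[OF compB]) (use wB in \<open>auto intro!: continuous_intros\<close>)
    then obtain p where p: "p \<in> B" "\<And>q. q \<in> B \<Longrightarrow> dist q c \<le> dist p c" by blast
    have expand: "(dist q c)\<^sup>2 = (dist q p0)\<^sup>2 + 2 * R * (n \<bullet> (q - p0)) + (dist p0 c)\<^sup>2" for q
    proof -
      have "dist q c = norm ((q - p0) + R *\<^sub>R n)" "dist p0 c = norm (R *\<^sub>R n)"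
        by (simp_all add: c_def dist_norm algebra_simps)
      moreover have "(q - p0) \<bullet> R *\<^sub>R n = R * (n \<bullet> (q - p0))"
        by (simp only: inner_scaleR_right inner_commute[of "q - p0"])
      ultimately show ?thesis
        by (simp only: norm_add_square dist_norm mult.assoc)
    qed
    have "(dist p0 c)\<^sup>2 \<le> (dist p c)\<^sup>2" by (rule power_mono[OF p(2)[OF p0(1)] zero_le_dist])
    then have "0 \<le> (dist p p0)\<^sup>2 + 2 * R * (n \<bullet> (p - p0))" unfolding expand[of p] by linarith
    moreover have "(dist p p0)\<^sup>2 \<le> D\<^sup>2" by (rule power_mono[OF D(2)[OF p(1) p0(1)] zero_le_dist])
    moreover have "D\<^sup>2 = R * \<kappa>" using \<kappa> by (simp add: R_def)
    ultimately have "0 \<le> R * (\<kappa> + 2 * (n \<bullet> (p - p0)))" by (simp add: algebra_simps)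
    then have "0 \<le> \<kappa> + 2 * (n \<bullet> (p - p0))" using R by (simp add: zero_le_mult_iff)
    then have "- \<kappa> < n \<bullet> (p - p0)" using \<kappa> by linarith
    then have ph: "- H < n \<bullet> (p - y)"
    proof -
      have "n \<bullet> (p - y) = n \<bullet> (p - p0) + n \<bullet> (p0 - y)" by (simp add: inner_diff_right)
      with p0h \<open>- \<kappa> < _\<close> show ?thesis unfolding \<kappa>_def by simp
    qed
    have "p \<in> ?\<Delta>" using p(1) unfolding B_def by (rule DiffD1)
    then obtain u v where uv: "0 \<le> u" "0 \<le> v" "u + v \<le> 1" "p = y + u *\<^sub>R (X - y) + v *\<^sub>R (Z - y)"
      unfolding hull by (elim exE conjE)
    have pG: "p \<notin> G" using p(1) by (simp add: B_def)
    have "u + v < 1" proof -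
      have "n \<bullet> (p - y) = - ((u + v) * H)"
        using height[of u v] by (simp only: uv(4)[symmetric] mult_minus_left)
      then have "(u + v) * H < 1 * H" using ph by linarith
      then show ?thesis by (rule mult_right_less_imp_less) (use H in simp)
    qed
    moreover have "u \<noteq> 0"
    proof
      assume "u = 0"
      then have "p = (1 - v) *\<^sub>R y + v *\<^sub>R Z" unfolding uv(4) by (simp add: algebra_simps)
      then have "p \<in> closed_segment y Z" unfolding in_segment
        using uv(1-3) \<open>u = 0\<close> by (intro exI[of _ v]) simp
      then show False using yZ pG by blast
    qed
    moreover have "v \<noteq> 0"
    proof
      assume "v = 0"
      then have "p = (1 - u) *\<^sub>R y + u *\<^sub>R X" unfolding uv(4) by (simp add: algebra_simps)
      then have "p \<in> closed_segment y X" unfolding in_segment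
        using uv(1-3) \<open>v = 0\<close> by (intro exI[of _ u]) simp
      then show False using yX pG by blast
    qed
    ultimately have uvp: "0 < u" "0 < v" "u + v < 1" using uv by auto
    have "\<not> collinear {y, X, Z}"
    proof
      assume "collinear {y, X, Z}"
      moreover have "{y, X, Z} = {X, Z, y}" by auto
      ultimately have "X = y \<or> (\<exists>u. Z = u *\<^sub>R X + (1 - u) *\<^sub>R y)"
        using collinear_3_expand[of X Z y] by simp
      then have "x = y \<or> (\<exists>u. z = u *\<^sub>R x + (1 - u) *\<^sub>R y)"
      proof
        assume "X = y"
        then show ?thesis using \<tau> by (simp add: X_def)
      next
        assume "\<exists>u. Z = u *\<^sub>R X + (1 - u) *\<^sub>R y"
        then obtain u where "Z - y = u *\<^sub>R (X - y)" by (auto simp: algebra_simps)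
        then have "(1 + \<tau>) *\<^sub>R (z - y) = (1 + \<tau>) *\<^sub>R (u *\<^sub>R (x - y))"
          by (simp add: X_def Z_def mult.commute)
        then have "z - y = u *\<^sub>R (x - y)" unfolding scaleR_cancel_left using \<tau> by simp
        then have "z = u *\<^sub>R x + (1 - u) *\<^sub>R y" by (simp add: algebra_simps)
        then show ?thesis by blast
      qed
      then have "collinear {x, z, y}" using collinear_3_expand[of x z y] by simp
      moreover have "{x, z, y} = {x, y, z}" by auto
      ultimately have "collinear {x, y, z}" by simp
      then show False using False by simp
    qed
    then have "interior ?\<Delta> = {v. \<exists>x y' z. 0 < x \<and> 0 < y' \<and> 0 < z \<and> x + y' + z = 1 \<and>
        x *\<^sub>R y + y' *\<^sub>R X + z *\<^sub>R Z = v}"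
      by (rule interior_convex_hull_3_minimal) simp
    moreover have "(1 - u - v) *\<^sub>R y + u *\<^sub>R X + v *\<^sub>R Z = p"
      unfolding uv(4) by (simp add: algebra_simps)
    moreover have "0 < 1 - u - v" "(1 - u - v) + u + v = 1" using uvp by auto
    ultimately have "p \<in> interior ?\<Delta>" using uvp by blast
    then obtain r where r: "0 < r" "ball p r \<subseteq> ?\<Delta>"
      by (meson mem_interior)
    have "ball p r - cball c (dist p c) \<subseteq> G"
    proof
      fix q assume q: "q \<in> ball p r - cball c (dist p c)"
      then have "\<not> dist q c \<le> dist p c" by (simp add: dist_commute)
      then have "q \<notin> B" using p(2) by blast
      then show "q \<in> G" using q r by (auto simp: B_def)
    qed
    moreover have "p \<noteq> c"
    proof
      assume "p = c"
      then have "dist p0 c \<le> 0" using p(2)[OF p0(1)] by simp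
      then have "p0 = c" by simp
      then have "R *\<^sub>R n = 0" by (simp add: c_def)
      then show False using R n by simp
    qed
    ultimately have "p \<in> G" using G(2) r(1) unfolding ball_closed_def by blast
    then show False using pG by simp
  qed
qed

text \<open>
  The contrapositive is what the maximising player uses: if the disc around \<open>x\<close> leaves \<open>G\<close>, then so does one of
  the discs around \<open>x + d\<close> and \<open>x - d\<close>. The segment from \<open>x + d + e\<close> to \<open>x - d + e\<close>, whose midpoint is \<open>x + e\<close>, is the
  third side of a triangle with apex \<open>x\<close>, and each of the other sides lies in one of the two discs.
\<close>

lemma ball_closed_cball_midpoint:
  assumes G: "open G" "ball_closed G" and d: "norm d \<le> h"
    and sub: "cball (x + d) h \<subseteq> G" "cball (x - d) h \<subseteq> G"
  shows "cball x h \<subseteq> G"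
proof
  fix y assume "y \<in> cball x h"
  define e where "e = y - x"
  have y: "y = x + e" and e: "norm e \<le> h"
    using \<open>y \<in> cball x h\<close> by (simp_all add: e_def dist_norm norm_minus_commute)
  have "closed_segment (x + d + e) x \<subseteq> cball (x + d) h"
    using d e by (intro closed_segment_subset) (auto simp: dist_norm)
  moreover have "closed_segment x (x - d + e) \<subseteq> cball (x - d) h"
    using d e by (intro closed_segment_subset) (auto simp: dist_norm)
  ultimately have "closed_segment (x + d + e) (x - d + e) \<subseteq> G"
    using ball_closed_segment_trans[OF G, of "x + d + e" x "x - d + e"] sub by blast
  moreover have "y = (1 - 1/2) *\<^sub>R (x + d + e) + (1/2) *\<^sub>R (x - d + e)"
    by (simp add: y vec_eq_iff field_simps)
  then have "y \<in> closed_segment (x + d + e) (x - d + e)"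
    unfolding in_segment by (intro exI[of _ "1/2"]) auto
  ultimately show "y \<in> G" by blast
qed

text \<open>
  The region visible from \<open>x\<close> inside \<open>G\<close>.
\<close>

definition star_of :: "(real^2) set \<Rightarrow> real^2 \<Rightarrow> (real^2) set" where
  "star_of G x = {y. closed_segment x y \<subseteq> G}"

lemma convex_star_of:
  assumes "open G" "ball_closed G"
  shows "convex (star_of G x)"
  unfolding convex_contains_segment
proof (intro ballI subsetI)
  fix y z w assume yz: "y \<in> star_of G x" "z \<in> star_of G x" and w: "w \<in> closed_segment y z"
  have "closed_segment y z \<subseteq> G"
    using yz ball_closed_segment_trans[OF assms, of y x z]
    by (simp add: star_of_def closed_segment_commute)
  then have "closed_segment y w \<subseteq> G"
    using w by (meson ends_in_segment(1) subset_closed_segment subset_trans)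
  then show "w \<in> star_of G x"
    using yz(1) ball_closed_segment_trans[OF assms, of x y w] by (simp add: star_of_def)
qed

section \<open>The game\<close>

lemma game_c_pos: "0 < \<gamma> \<Longrightarrow> \<gamma> < 1 \<Longrightarrow> 0 < game_c \<gamma>"
  unfolding game_c_def by simp

lemma game_f_nonneg: "0 < \<gamma> \<Longrightarrow> \<gamma> < 1 \<Longrightarrow> 0 \<le> game_f \<gamma> s"
  unfolding game_f_def using game_c_pos[of \<gamma>] by simp

lemma game_f_antimono:
  assumes "0 < \<gamma>" "\<gamma> < 1" "0 < s" "s \<le> s'"
  shows "game_f \<gamma> s' \<le> game_f \<gamma> s"
  unfolding game_f_def
  using assms game_c_pos[of \<gamma>] by (intro mult_left_mono powr_mono2') (auto simp: divide_nonneg_neg)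

lemma game_f_tendsto_0:
  assumes "0 < \<gamma>" "\<gamma> < 1"
  shows "(game_f \<gamma> \<longlongrightarrow> 0) at_top"
proof -
  have "((\<lambda>s. game_c \<gamma> * s powr (2 * \<gamma> / (\<gamma> - 1))) \<longlongrightarrow> game_c \<gamma> * 0) at_top"
    using assms by (intro tendsto_mult tendsto_const tendsto_neg_powr filterlim_ident) (simp add: divide_pos_neg)
  then show ?thesis by (simp add: game_f_def[abs_def])
qed

locale curvature_game =
  fixes \<gamma> \<alpha>1 \<alpha>2 L :: real and u0 :: "real^2 \<Rightarrow> real"
  assumes \<gamma>: "0 < \<gamma>" "\<gamma> < 1"
    and \<alpha>1: "0 < \<alpha>1" "\<alpha>1 < 1" "\<alpha>1 * (2 * \<gamma> / (1 - \<gamma>)) < 2"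
    and \<alpha>2: "0 < \<alpha>2" "\<alpha>2 < 1"
    and lip: "L-lipschitz_on UNIV u0" and L: "0 < L"
begin

abbreviation U :: "real \<Rightarrow> nat \<Rightarrow> real^2 \<Rightarrow> real" where
  "U \<equiv> value_iter \<gamma> \<alpha>1 \<alpha>2 u0"

definition jump :: "real \<Rightarrow> real^2 \<Rightarrow> real \<Rightarrow> real \<Rightarrow> real \<Rightarrow> real^2" where
  "jump \<epsilon> v s b \<beta> = (b * \<epsilon> * s) *\<^sub>R v + (\<beta> * \<epsilon>\<^sup>2 * game_f \<gamma> s) *\<^sub>R perp v"

definition admissible :: "real \<Rightarrow> real^2 \<Rightarrow> real \<Rightarrow> bool" where
  "admissible \<epsilon> v s \<longleftrightarrow> norm v = 1 \<and> s \<in> step_range \<alpha>1 \<alpha>2 \<epsilon>"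

text \<open>
  The sum of the bounds on the two components of a jump that come from the two ends of the range of \<open>s\<close>.
\<close>

definition max_jump :: "real \<Rightarrow> real" where
  "max_jump \<epsilon> = \<epsilon> powr (1 - \<alpha>2) + game_c \<gamma> * \<epsilon> powr (2 - \<alpha>1 * (2 * \<gamma> / (1 - \<gamma>)))"

lemma U_dist:
  assumes "0 < \<epsilon>" "\<epsilon> < 1"
  shows "\<bar>U \<epsilon> k x - U \<epsilon> k y\<bar> \<le> L * dist x y"
  using lipschitz_onD[OF value_iter_lipschitz[OF lip assms \<alpha>1(1) \<alpha>2(1)], of x y]
  by (simp add: dist_real_def)

lemma U_continuous:
  assumes "0 < \<epsilon>" "\<epsilon> < 1"
  shows "continuous_on UNIV (U \<epsilon> k)"
  by (rule lipschitz_on_continuous_on[OF value_iter_lipschitz[OF lip assms \<alpha>1(1) \<alpha>2(1)]])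

lemma U_Suc_le:
  assumes \<epsilon>: "0 < \<epsilon>" "\<epsilon> < 1" and adm: "admissible \<epsilon> v s"
    and le: "\<And>b \<beta>. b \<in> {-1, 1} \<Longrightarrow> \<beta> \<in> {-1, 1} \<Longrightarrow> U \<epsilon> k (x + jump \<epsilon> v s b \<beta>) \<le> a"
  shows "U \<epsilon> (Suc k) x \<le> a"
proof -
  obtain v' s' where "U \<epsilon> (Suc k) x = worst_case \<gamma> \<epsilon> (U \<epsilon> k) x v' s'"
    "worst_case \<gamma> \<epsilon> (U \<epsilon> k) x v' s' \<le> worst_case \<gamma> \<epsilon> (U \<epsilon> k) x v s"
    by (rule worst_case_minimum[OF U_continuous[OF \<epsilon>, of k] \<epsilon> \<alpha>1(1) \<alpha>2(1), of \<gamma> x])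
      (use adm in \<open>simp add: admissible_def\<close>)
  moreover have "worst_case \<gamma> \<epsilon> (U \<epsilon> k) x v s \<le> a"
    by (rule worst_case_leI) (use le in \<open>simp add: jump_def add.assoc\<close>)
  ultimately show ?thesis by linarith
qed

lemma U_Suc_attained:
  assumes \<epsilon>: "0 < \<epsilon>" "\<epsilon> < 1"
  obtains v s where "admissible \<epsilon> v s"
    "\<And>b \<beta>. b \<in> {-1, 1} \<Longrightarrow> \<beta> \<in> {-1, 1} \<Longrightarrow> U \<epsilon> k (x + jump \<epsilon> v s b \<beta>) \<le> U \<epsilon> (Suc k) x"
proof -
  obtain v s where vs: "norm v = 1" "s \<in> step_range \<alpha>1 \<alpha>2 \<epsilon>"
    "U \<epsilon> (Suc k) x = worst_case \<gamma> \<epsilon> (U \<epsilon> k) x v s"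
    by (rule worst_case_minimum[OF U_continuous[OF \<epsilon>, of k] \<epsilon> \<alpha>1(1) \<alpha>2(1), of \<gamma> x]) simp
  show thesis
  proof (rule that[of v s])
    show "admissible \<epsilon> v s" using vs by (simp add: admissible_def)
    fix b \<beta> :: real assume "b \<in> {-1, 1}" "\<beta> \<in> {-1, 1}"
    from worst_case_ge[OF this, of "U \<epsilon> k" x \<epsilon> s v \<gamma>]
    show "U \<epsilon> k (x + jump \<epsilon> v s b \<beta>) \<le> U \<epsilon> (Suc k) x"
      unfolding vs(3) by (simp add: jump_def add.assoc)
  qed
qed

lemma step_bounds:
  assumes "0 < \<epsilon>" "s \<in> step_range \<alpha>1 \<alpha>2 \<epsilon>"
  shows "0 < s" "\<epsilon> * s \<le> \<epsilon> powr (1 - \<alpha>2)"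
    "\<epsilon>\<^sup>2 * game_f \<gamma> s \<le> game_c \<gamma> * \<epsilon> powr (2 - \<alpha>1 * (2 * \<gamma> / (1 - \<gamma>)))"
proof -
  have s: "\<epsilon> powr \<alpha>1 \<le> s" "s \<le> \<epsilon> powr (- \<alpha>2)" using assms(2) by (auto simp: step_range_def)
  have e: "0 < \<epsilon> powr \<alpha>1" using assms(1) by simp
  show "0 < s" using s(1) e by linarith
  have "\<epsilon> * s \<le> \<epsilon> powr 1 * \<epsilon> powr (- \<alpha>2)" using assms(1) s(2) by simp
  also have "\<dots> = \<epsilon> powr (1 - \<alpha>2)" by (simp only: powr_add[symmetric]) simp
  finally show "\<epsilon> * s \<le> \<epsilon> powr (1 - \<alpha>2)" .
  have "\<epsilon>\<^sup>2 * game_f \<gamma> s \<le> \<epsilon>\<^sup>2 * game_f \<gamma> (\<epsilon> powr \<alpha>1)"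
    using game_f_antimono[OF \<gamma> e s(1)] by (intro mult_left_mono) auto
  also have "\<dots> = game_c \<gamma> * (\<epsilon> powr 2 * \<epsilon> powr (\<alpha>1 * (2 * \<gamma> / (\<gamma> - 1))))"
    using assms(1) by (simp add: game_f_def powr_powr)
  also have "\<alpha>1 * (2 * \<gamma> / (\<gamma> - 1)) = - (\<alpha>1 * (2 * \<gamma> / (1 - \<gamma>)))"
    using \<gamma> by (simp add: divide_simps algebra_simps)
  also have "\<epsilon> powr 2 * \<epsilon> powr (- (\<alpha>1 * (2 * \<gamma> / (1 - \<gamma>)))) = \<epsilon> powr (2 - \<alpha>1 * (2 * \<gamma> / (1 - \<gamma>)))"
    by (simp flip: powr_add)
  finally show "\<epsilon>\<^sup>2 * game_f \<gamma> s \<le> game_c \<gamma> * \<epsilon> powr (2 - \<alpha>1 * (2 * \<gamma> / (1 - \<gamma>)))" .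
qed

lemma norm_jump_le:
  assumes "0 < \<epsilon>" "admissible \<epsilon> v s" "b \<in> {-1, 1}" "\<beta> \<in> {-1, 1}"
  shows "norm (jump \<epsilon> v s b \<beta>) \<le> max_jump \<epsilon>"
proof -
  have v: "norm v = 1" and s: "s \<in> step_range \<alpha>1 \<alpha>2 \<epsilon>" using assms(2) by (auto simp: admissible_def)
  note sb = step_bounds[OF assms(1) s]
  have ab: "\<bar>b\<bar> = 1" "\<bar>\<beta>\<bar> = 1" using assms by auto
  have "norm (jump \<epsilon> v s b \<beta>) \<le> norm ((b * \<epsilon> * s) *\<^sub>R v) + norm ((\<beta> * \<epsilon>\<^sup>2 * game_f \<gamma> s) *\<^sub>R perp v)"
    unfolding jump_def by (rule norm_triangle_ineq)
  also have "\<dots> = \<epsilon> * s + \<epsilon>\<^sup>2 * game_f \<gamma> s"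
    using assms(1) sb(1) game_f_nonneg[OF \<gamma>, of s] v ab by (simp add: abs_mult)
  also have "\<dots> \<le> max_jump \<epsilon>" unfolding max_jump_def using sb by linarith
  finally show ?thesis .
qed

lemma powr_tendsto_0_at_right:
  fixes a :: real assumes "0 < a" shows "((\<lambda>x. x powr a) \<longlongrightarrow> 0) (at_right 0)"
proof -
  have "((\<lambda>x::real. x powr a) \<longlongrightarrow> 0 powr a) (at_right 0)"
    using assms by (intro tendsto_powr2 tendsto_intros) (auto simp: eventually_at_right_less eventually_at_filter)
  then show ?thesis using assms by simp
qed

lemma max_jump_tendsto_0: "(max_jump \<longlongrightarrow> 0) (at_right 0)"
proof -
  have "((\<lambda>\<epsilon>. \<epsilon> powr (1 - \<alpha>2) + game_c \<gamma> * \<epsilon> powr (2 - \<alpha>1 * (2 * \<gamma> / (1 - \<gamma>)))) \<longlongrightarrow> 0 + game_c \<gamma> * 0) (at_right 0)"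
    using \<alpha>1 \<alpha>2 by (intro tendsto_intros powr_tendsto_0_at_right) auto
  then show ?thesis by (simp add: max_jump_def[abs_def])
qed

lemma max_jump_small: "0 < r \<Longrightarrow> \<forall>\<^sub>F \<epsilon> in at_right 0. max_jump \<epsilon> < r"
  using order_tendstoD(2)[OF max_jump_tendsto_0] by blast

lemma max_jump_nonneg: "0 \<le> max_jump \<epsilon>"
  unfolding max_jump_def using game_c_pos[OF \<gamma>] by (simp add: add_nonneg_nonneg)

lemma eps_small: "0 < r \<Longrightarrow> \<forall>\<^sub>F \<epsilon> in at_right (0::real). 0 < \<epsilon> \<and> \<epsilon> < r"
  unfolding eventually_at_right_field by auto

lemma step_range_eventually:
  assumes "0 < s"
  shows "\<forall>\<^sub>F \<epsilon> in at_right 0. s \<in> step_range \<alpha>1 \<alpha>2 \<epsilon>"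
proof -
  have "\<forall>\<^sub>F \<epsilon> in at_right 0. \<epsilon> powr \<alpha>1 < s" "\<forall>\<^sub>F \<epsilon> in at_right 0. \<epsilon> powr \<alpha>2 < 1 / s"
    using order_tendstoD(2)[OF powr_tendsto_0_at_right] \<alpha>1(1) \<alpha>2(1) assms by auto
  then show ?thesis using eps_small[OF zero_less_one]
  proof eventually_elim
    case (elim \<epsilon>)
    have "s < 1 / \<epsilon> powr \<alpha>2" using elim assms by (simp add: field_simps)
    then show ?case using elim by (simp add: step_range_def powr_minus_divide)
  qed
qed


section \<open>Forcing and fillable sets\<close>

definition controls :: "real \<Rightarrow> (real^2) set \<Rightarrow> (real^2) set" where
  "controls \<epsilon> B = {x. \<exists>v s. admissible \<epsilon> v s \<and>
     (\<forall>b\<in>{-1, 1}. \<forall>\<beta>\<in>{-1, 1}. x + jump \<epsilon> v s b \<beta> \<in> B)}"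

lemma controls_mono: "B \<subseteq> C \<Longrightarrow> controls \<epsilon> B \<subseteq> controls \<epsilon> C"
  unfolding controls_def by blast

text \<open>
  The minimiser can bring the position into \<open>A\<close> at some moment within \<open>n\<close> steps, whatever the opponent does.
  Reaching \<open>A\<close> earlier is allowed, since waiting near a point for a short time costs little.
\<close>

primrec forces :: "real \<Rightarrow> (real^2) set \<Rightarrow> nat \<Rightarrow> (real^2) set" where
  "forces \<epsilon> A 0 = A"
| "forces \<epsilon> A (Suc n) = A \<union> controls \<epsilon> (forces \<epsilon> A n)"

lemma forces_base: "A \<subseteq> forces \<epsilon> A n"
  by (cases n) auto

lemma forces_Suc_mono: "forces \<epsilon> A n \<subseteq> forces \<epsilon> A (Suc n)"
proof (induction n)
  case (Suc n)
  show ?case using controls_mono[OF Suc] by auto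
qed auto

lemma forces_mono: "m \<le> n \<Longrightarrow> forces \<epsilon> A m \<subseteq> forces \<epsilon> A n"
  by (rule lift_Suc_mono_le[of "forces \<epsilon> A"]) (rule forces_Suc_mono)

lemma forces_forces: "B \<subseteq> forces \<epsilon> A m \<Longrightarrow> forces \<epsilon> B n \<subseteq> forces \<epsilon> A (n + m)"
proof (induction n)
  case (Suc n)
  have "B \<subseteq> forces \<epsilon> A (Suc n + m)" using Suc.prems forces_mono[of m "Suc n + m" \<epsilon> A] by auto
  moreover have "controls \<epsilon> (forces \<epsilon> B n) \<subseteq> forces \<epsilon> A (Suc n + m)"
    using controls_mono[OF Suc.IH[OF Suc.prems], of \<epsilon>] by auto
  ultimately show ?case by simp
qed auto

lemma U_le_on_forces:
  assumes \<epsilon>: "0 < \<epsilon>" "\<epsilon> < 1" and A: "\<And>a j. a \<in> A \<Longrightarrow> j \<le> N \<Longrightarrow> U \<epsilon> j a \<le> c"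
  shows "x \<in> forces \<epsilon> A n \<Longrightarrow> n \<le> j \<Longrightarrow> j \<le> N \<Longrightarrow> U \<epsilon> j x \<le> c"
proof (induction n arbitrary: x j)
  case (Suc n)
  show ?case
  proof (cases "x \<in> A")
    case False
    then have "x \<in> controls \<epsilon> (forces \<epsilon> A n)" using Suc.prems(1) by simp
    then obtain v s where vs: "admissible \<epsilon> v s"
      "\<And>b \<beta>. b \<in> {-1, 1} \<Longrightarrow> \<beta> \<in> {-1, 1} \<Longrightarrow> x + jump \<epsilon> v s b \<beta> \<in> forces \<epsilon> A n"
      unfolding controls_def by blast
    obtain j' where j: "j = Suc j'" using Suc.prems(2) by (cases j) auto
    show ?thesis unfolding j
    proof (rule U_Suc_le[OF \<epsilon> vs(1)])
      fix b \<beta> :: real assume "b \<in> {-1, 1}" "\<beta> \<in> {-1, 1}"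
      from Suc.IH[OF vs(2)[OF this], of j'] show "U \<epsilon> j' (x + jump \<epsilon> v s b \<beta>) \<le> c"
        using Suc.prems j by simp
    qed
  qed (use A Suc.prems in blast)
qed (use A in auto)

definition steps :: "real \<Rightarrow> real \<Rightarrow> nat" where
  "steps \<sigma> \<epsilon> = nat \<lfloor>\<sigma> / \<epsilon>\<^sup>2\<rfloor>"

lemma le_steps_iff: "0 < \<epsilon> \<Longrightarrow> 0 \<le> \<sigma> \<Longrightarrow> n \<le> steps \<sigma> \<epsilon> \<longleftrightarrow> real n * \<epsilon>\<^sup>2 \<le> \<sigma>"
  unfolding steps_def by (simp add: le_nat_iff le_floor_iff pos_le_divide_eq)

lemma steps_le: "0 < \<epsilon> \<Longrightarrow> 0 \<le> \<sigma> \<Longrightarrow> real (steps \<sigma> \<epsilon>) * \<epsilon>\<^sup>2 \<le> \<sigma>"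
  using le_steps_iff[of \<epsilon> \<sigma> "steps \<sigma> \<epsilon>"] by simp

lemma steps_gt: "0 < \<epsilon> \<Longrightarrow> 0 \<le> \<sigma> \<Longrightarrow> \<sigma> < (real (steps \<sigma> \<epsilon>) + 1) * \<epsilon>\<^sup>2"
  using le_steps_iff[of \<epsilon> \<sigma> "Suc (steps \<sigma> \<epsilon>)"] by (simp add: add.commute)

text \<open>
  The points that are swallowed instantaneously by \<open>{u0 < \<mu>}\<close> in the limit \<open>\<epsilon> \<rightarrow> 0\<close>. The neighbourhood in the
  definition does not depend on the time \<open>\<sigma>\<close>, which makes the set open by construction and gives
  uniformity on compact subsets for every \<open>\<sigma>\<close>.
\<close>

definition fillable :: "real \<Rightarrow> (real^2) set" where
  "fillable \<mu> = {z. \<exists>r>0. \<forall>\<sigma>>0. \<forall>\<^sub>F \<epsilon> in at_right 0. ball z r \<subseteq> forces \<epsilon> {x. u0 x < \<mu>} (steps \<sigma> \<epsilon>)}"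

lemma open_fillable: "open (fillable \<mu>)"
  unfolding open_contains_ball
proof
  fix z assume "z \<in> fillable \<mu>"
  then obtain r where r: "0 < r"
    "\<And>\<sigma>. 0 < \<sigma> \<Longrightarrow> \<forall>\<^sub>F \<epsilon> in at_right 0. ball z r \<subseteq> forces \<epsilon> {x. u0 x < \<mu>} (steps \<sigma> \<epsilon>)"
    by (auto simp: fillable_def)
  have "ball z r \<subseteq> fillable \<mu>"
  proof
    fix y assume y: "y \<in> ball z r"
    have "ball y (r - dist z y) \<subseteq> ball z r" by (simp add: subset_ball ball_subset_ball_iff dist_commute)
    then have "\<forall>\<^sub>F \<epsilon> in at_right 0. ball y (r - dist z y) \<subseteq> forces \<epsilon> {x. u0 x < \<mu>} (steps \<sigma> \<epsilon>)"
      if "0 < \<sigma>" for \<sigma>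
      using r(2)[OF that] by (auto elim!: eventually_mono)
    then show "y \<in> fillable \<mu>" using y unfolding fillable_def
      by (intro CollectI exI[of _ "r - dist z y"]) auto
  qed
  then show "\<exists>e>0. ball z e \<subseteq> fillable \<mu>" using r(1) by blast
qed

lemma less_in_fillable:
  assumes "u0 x < \<mu>" shows "x \<in> fillable \<mu>"
proof -
  have "open {x. u0 x < \<mu>}"
    using lipschitz_on_continuous_on[OF lip]
    by (intro open_Collect_less) (auto intro: continuous_intros)
  then obtain r where "0 < r" "ball x r \<subseteq> {x. u0 x < \<mu>}"
    using assms open_contains_ball by blast
  then show ?thesis unfolding fillable_def
    using forces_base by (intro CollectI exI[of _ r]) (blast intro: always_eventually)
qed

lemma compact_fillable_uniform:
  assumes "compact K" "K \<subseteq> fillable \<mu>" "0 < \<sigma>"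
  shows "\<forall>\<^sub>F \<epsilon> in at_right 0. K \<subseteq> forces \<epsilon> {x. u0 x < \<mu>} (steps \<sigma> \<epsilon>)"
proof -
  have "\<forall>z\<in>K. \<exists>r>0. \<forall>\<^sub>F \<epsilon> in at_right 0. ball z r \<subseteq> forces \<epsilon> {x. u0 x < \<mu>} (steps \<sigma> \<epsilon>)"
    using assms(2,3) unfolding fillable_def by blast
  then obtain r where r: "\<And>z. z \<in> K \<Longrightarrow> 0 < r z"
    "\<And>z. z \<in> K \<Longrightarrow> \<forall>\<^sub>F \<epsilon> in at_right 0. ball z (r z) \<subseteq> forces \<epsilon> {x. u0 x < \<mu>} (steps \<sigma> \<epsilon>)"
    by metis
  have "K \<subseteq> (\<Union>z\<in>K. ball z (r z))" using r(1) by force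
  then obtain D where D: "D \<subseteq> K" "finite D" "K \<subseteq> (\<Union>z\<in>D. ball z (r z))"
    using compactE_image[OF assms(1), of K "\<lambda>z. ball z (r z)"] by auto
  have "\<forall>\<^sub>F \<epsilon> in at_right 0. \<forall>z\<in>D. ball z (r z) \<subseteq> forces \<epsilon> {x. u0 x < \<mu>} (steps \<sigma> \<epsilon>)"
    using D r(2) by (intro eventually_ball_finite) auto
  then show ?thesis by eventually_elim (use D(3) in blast)
qed

text \<open>
  Pythagoras: for a jump along the tangent of a circle around \<open>c\<close> the tangential part always increases the
  distance to \<open>c\<close>, for both signs that the opponent can choose.
\<close>

lemma dist_after_tangent_jump:
  assumes "q \<noteq> c" "v = perp ((q - c) /\<^sub>R norm (q - c))"
  shows "(norm (q + jump \<epsilon> v s b \<beta> - c))\<^sup>2 = (norm (q - c) - \<beta> * \<epsilon>\<^sup>2 * game_f \<gamma> s)\<^sup>2 + (b * \<epsilon> * s)\<^sup>2"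
proof -
  define n where "n = (q - c) /\<^sub>R norm (q - c)"
  have n: "norm n = 1" "q - c = norm (q - c) *\<^sub>R n" using assms(1) by (simp_all add: n_def)
  have "q + jump \<epsilon> v s b \<beta> - c = (q - c) + jump \<epsilon> v s b \<beta>" by simp
  also have "\<dots> = (norm (q - c) - \<beta> * \<epsilon>\<^sup>2 * game_f \<gamma> s) *\<^sub>R n + (b * \<epsilon> * s) *\<^sub>R perp n"
    by (subst n(2)) (simp add: jump_def assms(2) n_def[symmetric] scaleR_diff_left)
  finally have eq: "q + jump \<epsilon> v s b \<beta> - c =
    (norm (q - c) - \<beta> * \<epsilon>\<^sup>2 * game_f \<gamma> s) *\<^sub>R n + (b * \<epsilon> * s) *\<^sub>R perp n" .
  show ?thesis unfolding eq norm_add_square using n(1) by (simp add: power_mult_distrib)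
qed

text \<open>
  Let \<open>c'\<close> be the centre of the circle of doubled radius that is tangent at \<open>p\<close> to the given circle. Points near
  the doubled circle but away from \<open>p\<close> are strictly outside the given disc, and hence fillable. Moving along
  tangents of circles around \<open>c'\<close> with a large step \<open>S\<close>, the minimiser increases the squared distance to \<open>c'\<close> by at
  least \<open>\<epsilon>\<^sup>2 S\<^sup>2 / 2\<close> in every step, so a neighbourhood of \<open>p\<close> is driven into a compact set \<open>K\<close> of fillable points in time
  \<open>4 \<kappa> / S\<^sup>2\<close>, which is as small as one likes.
\<close>

lemma ball_closed_fillable: "ball_closed (fillable \<mu>)"
  unfolding ball_closed_def
proof (intro allI impI, elim conjE)
  fix c p :: "real^2" and r :: real
  assume r: "0 < r" and pc: "p \<noteq> c" and sub: "ball p r - cball c (dist p c) \<subseteq> fillable \<mu>"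
  define R where "R = norm (p - c)"
  have R: "0 < R" using pc by (simp add: R_def)
  \<comment> \<open>the reflection of \<open>p\<close> in \<open>c\<close>, centre of the tangent circle of doubled radius\<close>
  define c' where "c' = 2 *\<^sub>R c - p"
  define \<kappa> where "\<kappa> = min (r\<^sup>2 / 16) (R\<^sup>2)"
  have \<kappa>: "0 < \<kappa>" "\<kappa> \<le> r\<^sup>2 / 16" "\<kappa> \<le> R\<^sup>2" using r R by (auto simp: \<kappa>_def)
  have pc': "norm (p - c') = 2 * R"
  proof -
    have "p - c' = 2 *\<^sub>R (p - c)" by (simp add: c'_def vec_eq_iff)
    then show ?thesis by (simp add: R_def)
  qed
  have identity: "2 * (norm (q - c))\<^sup>2 = 2 * R\<^sup>2 + (norm (q - p))\<^sup>2 + ((norm (q - c'))\<^sup>2 - 4 * R\<^sup>2)" for q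
  proof -
    have "q - c = (q - p) + (p - c)" "q - c' = (q - p) + 2 *\<^sub>R (p - c)"
      by (simp_all add: c'_def vec_eq_iff)
    then have "(norm (q - c))\<^sup>2 = (norm (q - p))\<^sup>2 + 2 * ((q - p) \<bullet> (p - c)) + R\<^sup>2"
      "(norm (q - c'))\<^sup>2 = (norm (q - p))\<^sup>2 + 4 * ((q - p) \<bullet> (p - c)) + 4 * R\<^sup>2"
      by (simp_all only: norm_add_square) (simp_all add: R_def power_mult_distrib)
    then show ?thesis by linarith
  qed
  define K where "K = {q. norm (q - p) \<le> 3 / 4 * r \<and> 4 * R\<^sup>2 - \<kappa> \<le> (norm (q - c'))\<^sup>2 \<and>
    (r / 2 \<le> norm (q - p) \<or> 4 * R\<^sup>2 + \<kappa> \<le> (norm (q - c'))\<^sup>2)}"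
  have "K = cball p (3 / 4 * r) \<inter> ({q. 4 * R\<^sup>2 - \<kappa> \<le> (norm (q - c'))\<^sup>2} \<inter>
    ({q. r / 2 \<le> norm (q - p)} \<union> {q. 4 * R\<^sup>2 + \<kappa> \<le> (norm (q - c'))\<^sup>2}))"
    by (auto simp: K_def dist_norm norm_minus_commute)
  moreover have "closed {q. 4 * R\<^sup>2 - \<kappa> \<le> (norm (q - c'))\<^sup>2}" "closed {q. r / 2 \<le> norm (q - p)}"
    "closed {q. 4 * R\<^sup>2 + \<kappa> \<le> (norm (q - c'))\<^sup>2}"
    by (intro closed_Collect_le continuous_intros)+
  ultimately have compK: "compact K"
    by (simp only:) (intro compact_Int_closed compact_cball closed_Int closed_Un)
  have KG: "K \<subseteq> fillable \<mu>"
  proof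
    fix q assume "q \<in> K"
    then have q: "norm (q - p) \<le> 3 / 4 * r" "4 * R\<^sup>2 - \<kappa> \<le> (norm (q - c'))\<^sup>2"
      "r / 2 \<le> norm (q - p) \<or> 4 * R\<^sup>2 + \<kappa> \<le> (norm (q - c'))\<^sup>2" by (auto simp: K_def)
    have "0 < (norm (q - p))\<^sup>2 + ((norm (q - c'))\<^sup>2 - 4 * R\<^sup>2)"
    proof (cases "r / 2 \<le> norm (q - p)")
      case True
      then have "(r / 2)\<^sup>2 \<le> (norm (q - p))\<^sup>2" using r by (intro power_mono) auto
      then have "r\<^sup>2 / 4 \<le> (norm (q - p))\<^sup>2" by (simp add: power_divide)
      moreover have "0 < r\<^sup>2" using r by simp
      ultimately show ?thesis using q(2) \<kappa>(2) by linarith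
    next
      case False
      then have "4 * R\<^sup>2 + \<kappa> \<le> (norm (q - c'))\<^sup>2" using q(3) by blast
      then show ?thesis using \<kappa>(1) zero_le_power2[of "norm (q - p)"] by linarith
    qed
    then have "R\<^sup>2 < (norm (q - c))\<^sup>2" using identity[of q] by linarith
    then have "R < norm (q - c)" by (rule power_less_imp_less_base) simp
    then have "q \<in> ball p r - cball c (dist p c)"
      using q(1) r by (simp add: dist_norm R_def norm_minus_commute)
    then show "q \<in> fillable \<mu>" using sub by blast
  qed
  define r' where "r' = min (r / 4) (min (\<kappa> / (4 * R)) R)"
  have r': "0 < r'" "r' \<le> r / 4" "4 * R * r' \<le> \<kappa>" "r' \<le> R"
  proof -
    have "r' \<le> \<kappa> / (4 * R)" by (simp add: r'_def)
    then show "4 * R * r' \<le> \<kappa>" using R by (simp add: field_simps)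
  qed (use r \<kappa> R in \<open>auto simp: r'_def\<close>)
  define M where "M = 2 * R + r"
  have M: "0 < M" using R r by (simp add: M_def)
  have "\<forall>\<^sub>F \<epsilon> in at_right 0. ball p r' \<subseteq> forces \<epsilon> {x. u0 x < \<mu>} (steps \<sigma> \<epsilon>)" if \<sigma>: "0 < \<sigma>" for \<sigma>
  proof -
    have "\<forall>\<^sub>F S in at_top. game_f \<gamma> S < 1 / (4 * M)"
      using order_tendstoD(2)[OF game_f_tendsto_0[OF \<gamma>]] M by simp
    moreover have "\<forall>\<^sub>F S in at_top. 1 + 16 * \<kappa> / \<sigma> \<le> (S::real)" by (rule eventually_ge_at_top)
    ultimately have "\<forall>\<^sub>F S in at_top. game_f \<gamma> S < 1 / (4 * M) \<and> 1 + 16 * \<kappa> / \<sigma> \<le> S"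
      by eventually_elim simp
    then obtain S where S: "game_f \<gamma> S < 1 / (4 * M)" "1 + 16 * \<kappa> / \<sigma> \<le> S"
      using eventually_happens by fastforce
    have "0 \<le> 16 * \<kappa> / \<sigma>" using \<kappa> \<sigma> by simp
    then have S1: "1 \<le> S" "S \<le> S\<^sup>2" using S(2) by (auto simp: power2_eq_square)
    have fM: "game_f \<gamma> S * M \<le> S\<^sup>2 / 4"
    proof -
      have "game_f \<gamma> S * M \<le> 1 / 4" using S(1) M by (simp add: field_simps)
      then show ?thesis using S1 by linarith
    qed
    have S\<kappa>: "4 * \<kappa> / S\<^sup>2 \<le> \<sigma> / 4"
    proof -
      have "16 * \<kappa> / \<sigma> \<le> S\<^sup>2" using S(2) S1 by linarith
      then show ?thesis using \<sigma> S1 by (simp add: field_simps)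
    qed
    have "\<forall>\<^sub>F \<epsilon> in at_right 0. K \<subseteq> forces \<epsilon> {x. u0 x < \<mu>} (steps (\<sigma> / 2) \<epsilon>)"
      using compact_fillable_uniform[OF compK KG] \<sigma> by simp
    moreover have "\<forall>\<^sub>F \<epsilon> in at_right 0. S \<in> step_range \<alpha>1 \<alpha>2 \<epsilon>" using step_range_eventually S1 by simp
    moreover have "\<forall>\<^sub>F \<epsilon> in at_right 0. max_jump \<epsilon> < r / 4" by (rule max_jump_small) (use r in simp)
    moreover have "\<forall>\<^sub>F \<epsilon> in at_right 0. 0 < \<epsilon> \<and> \<epsilon> < min 1 (\<sigma> / 4)" by (rule eps_small) (use \<sigma> in simp)
    ultimately show ?thesis
    proof eventually_elim
      case (elim \<epsilon>)
      then have \<epsilon>: "0 < \<epsilon>" "\<epsilon> < 1" "\<epsilon> < \<sigma> / 4" by auto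
      have climb: "q \<in> forces \<epsilon> K n"
        if "norm (q - p) < r / 2" "4 * R\<^sup>2 - \<kappa> \<le> (norm (q - c'))\<^sup>2"
          "4 * R\<^sup>2 + \<kappa> \<le> (norm (q - c'))\<^sup>2 + real n * (\<epsilon>\<^sup>2 * S\<^sup>2 / 2)" for q n
        using that
      proof (induction n arbitrary: q)
        case 0
        then have "q \<in> K" using r by (auto simp: K_def)
        then show ?case by simp
      next
        case (Suc n)
        have "0 < R\<^sup>2" using R by simp
        then have "(norm (q - c'))\<^sup>2 \<noteq> 0" using Suc.prems(2) \<kappa>(3) by linarith
        then have qc': "q \<noteq> c'" by auto
        define v where "v = perp ((q - c') /\<^sub>R norm (q - c'))"
        have adm: "admissible \<epsilon> v S" using elim qc' by (simp add: admissible_def v_def)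
        have "q + jump \<epsilon> v S b \<beta> \<in> forces \<epsilon> K n" if b: "b \<in> {-1, 1}" "\<beta> \<in> {-1, 1}" for b \<beta>
        proof -
          let ?q = "q + jump \<epsilon> v S b \<beta>"
          have "norm (jump \<epsilon> v S b \<beta>) < r / 4"
            using norm_jump_le[OF \<epsilon>(1) adm b] elim by linarith
          moreover have "norm (?q - p) \<le> norm (q - p) + norm (jump \<epsilon> v S b \<beta>)"
            using norm_triangle_ineq[of "q - p" "jump \<epsilon> v S b \<beta>"] by (simp add: algebra_simps)
          ultimately have qp: "norm (?q - p) \<le> 3 / 4 * r" using Suc.prems(1) by linarith
          have "norm (q - c') \<le> norm (q - p) + norm (p - c')"
            using norm_triangle_ineq[of "q - p" "p - c'"] by simp
          then have qM: "norm (q - c') \<le> M" using Suc.prems(1) pc' r by (simp add: M_def)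
          have b2: "b\<^sup>2 = 1" using b by auto
          have "(norm (?q - c'))\<^sup>2 = (norm (q - c') - \<beta> * \<epsilon>\<^sup>2 * game_f \<gamma> S)\<^sup>2 + \<epsilon>\<^sup>2 * S\<^sup>2"
            using dist_after_tangent_jump[OF qc' v_def, of \<epsilon> S b \<beta>] b2 by (simp add: power_mult_distrib)
          also have "\<dots> \<ge> (norm (q - c'))\<^sup>2 - 2 * \<epsilon>\<^sup>2 * (game_f \<gamma> S * M) + \<epsilon>\<^sup>2 * S\<^sup>2"
          proof -
            have "0 \<le> norm (q - c') * game_f \<gamma> S" "norm (q - c') * game_f \<gamma> S \<le> M * game_f \<gamma> S"
              using qM game_f_nonneg[OF \<gamma>, of S] by (auto intro: mult_right_mono)
            then have "\<beta> * (norm (q - c') * game_f \<gamma> S) \<le> M * game_f \<gamma> S"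
              using b(2) by (elim insertE emptyE) simp_all
            then have "2 * \<epsilon>\<^sup>2 * (\<beta> * (norm (q - c') * game_f \<gamma> S)) \<le> 2 * \<epsilon>\<^sup>2 * (game_f \<gamma> S * M)"
              by (intro mult_left_mono) (auto simp: mult.commute)
            then have "2 * norm (q - c') * (\<beta> * \<epsilon>\<^sup>2 * game_f \<gamma> S) \<le> 2 * \<epsilon>\<^sup>2 * (game_f \<gamma> S * M)"
              by (simp add: mult.assoc mult.commute mult.left_commute)
            then show ?thesis
              unfolding power2_diff using zero_le_power2[of "\<beta> * \<epsilon>\<^sup>2 * game_f \<gamma> S"] by linarith
          qed
          finally have "(norm (q - c'))\<^sup>2 - 2 * \<epsilon>\<^sup>2 * (game_f \<gamma> S * M) + \<epsilon>\<^sup>2 * S\<^sup>2 \<le> (norm (?q - c'))\<^sup>2" .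
          moreover have "\<epsilon>\<^sup>2 * (game_f \<gamma> S * M) \<le> \<epsilon>\<^sup>2 * (S\<^sup>2 / 4)"
            using fM by (intro mult_left_mono) auto
          ultimately have gain: "(norm (q - c'))\<^sup>2 + \<epsilon>\<^sup>2 * S\<^sup>2 / 2 \<le> (norm (?q - c'))\<^sup>2" by simp
          have "0 \<le> \<epsilon>\<^sup>2 * S\<^sup>2 / 2" by simp
          then have low: "4 * R\<^sup>2 - \<kappa> \<le> (norm (?q - c'))\<^sup>2" using gain Suc.prems(2) by linarith
          show ?thesis
          proof (cases "norm (?q - p) < r / 2")
            case True
            have "real (Suc n) * (\<epsilon>\<^sup>2 * S\<^sup>2 / 2) = \<epsilon>\<^sup>2 * S\<^sup>2 / 2 + real n * (\<epsilon>\<^sup>2 * S\<^sup>2 / 2)"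
              unfolding of_nat_Suc distrib_right by simp
            then have "4 * R\<^sup>2 + \<kappa> \<le> (norm (?q - c'))\<^sup>2 + real n * (\<epsilon>\<^sup>2 * S\<^sup>2 / 2)"
              using gain Suc.prems(3) by linarith
            with True low show ?thesis by (rule Suc.IH)
          next
            case False
            then have "?q \<in> K" using low qp by (simp add: K_def)
            then show ?thesis using forces_base by blast
          qed
        qed
        then have "q \<in> controls \<epsilon> (forces \<epsilon> K n)" using adm unfolding controls_def by blast
        then show ?case by simp
      qed
      define N where "N = nat \<lceil>4 * \<kappa> / (\<epsilon>\<^sup>2 * S\<^sup>2)\<rceil>"
      have pos: "0 < \<epsilon>\<^sup>2 * S\<^sup>2" using \<epsilon> S1 by simp
      have N: "4 * \<kappa> / (\<epsilon>\<^sup>2 * S\<^sup>2) \<le> real N" "real N \<le> 4 * \<kappa> / (\<epsilon>\<^sup>2 * S\<^sup>2) + 1"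
        using \<kappa> pos unfolding N_def
        by (auto intro: real_nat_ceiling_ge intro!: less_imp_le[OF of_nat_ceiling[THEN le_less_trans]])
      have "2 * \<kappa> \<le> real N * (\<epsilon>\<^sup>2 * S\<^sup>2 / 2)" using N(1) pos by (simp add: field_simps)
      have "real N * \<epsilon>\<^sup>2 \<le> (4 * \<kappa> / (\<epsilon>\<^sup>2 * S\<^sup>2) + 1) * \<epsilon>\<^sup>2" by (rule mult_right_mono[OF N(2)]) simp
      also have "\<dots> = 4 * \<kappa> / S\<^sup>2 + \<epsilon>\<^sup>2" using \<epsilon> by (simp add: algebra_simps)
      also have "\<dots> \<le> \<sigma> / 2"
      proof -
        have "\<epsilon>\<^sup>2 \<le> \<epsilon>" using \<epsilon> by (simp add: power2_eq_square mult_le_cancel_left1)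
        then show ?thesis using S\<kappa> \<epsilon> by linarith
      qed
      finally have "real N * \<epsilon>\<^sup>2 \<le> \<sigma> / 2" .
      moreover have "real (steps (\<sigma> / 2) \<epsilon>) * \<epsilon>\<^sup>2 \<le> \<sigma> / 2" by (rule steps_le) (use \<epsilon> \<sigma> in auto)
      ultimately have "N + steps (\<sigma> / 2) \<epsilon> \<le> steps \<sigma> \<epsilon>"
        using le_steps_iff[of \<epsilon> \<sigma>] \<epsilon> \<sigma> by (simp add: algebra_simps)
      then have "forces \<epsilon> K N \<subseteq> forces \<epsilon> {x. u0 x < \<mu>} (steps \<sigma> \<epsilon>)"
        using forces_forces[OF elim(1), of N] forces_mono by blast
      moreover have "ball p r' \<subseteq> forces \<epsilon> K N"
      proof
        fix y assume "y \<in> ball p r'"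
        then have y: "norm (y - p) < r'" by (simp add: dist_norm norm_minus_commute)
        have "2 * R \<le> norm (y - p) + norm (y - c')"
          using norm_triangle_ineq[of "p - y" "y - c'"] pc' by (simp add: norm_minus_commute)
        then have "2 * R - r' \<le> norm (y - c')" using y by linarith
        then have "(2 * R - r')\<^sup>2 \<le> (norm (y - c'))\<^sup>2" using r' by (intro power_mono) auto
        moreover have "(2 * R - r')\<^sup>2 = 4 * R\<^sup>2 - 4 * R * r' + r'\<^sup>2" by (simp add: power2_eq_square algebra_simps)
        ultimately have "4 * R\<^sup>2 - \<kappa> \<le> (norm (y - c'))\<^sup>2" using r'(3) zero_le_power2[of r'] by linarith
        then show "y \<in> forces \<epsilon> K N"
          using y r' r \<open>2 * \<kappa> \<le> _\<close> by (intro climb) auto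
      qed
      ultimately show ?case by blast
    qed
  qed
  then show "p \<in> fillable \<mu>" using r'(1) unfolding fillable_def by blast
qed

text \<open>
  The maximiser keeps the disc of radius \<open>max_jump \<epsilon>\<close> from being contained in the fillable set: the two jumps with
  \<open>b = \<beta> = 1\<close> and \<open>b = \<beta> = -1\<close> are opposite, and the midpoint property of ball-closed sets says that one of them is good.
\<close>

lemma U_ge_off_fillable:
  assumes \<epsilon>: "0 < \<epsilon>" "\<epsilon> < 1"
  shows "\<not> cball x (max_jump \<epsilon>) \<subseteq> fillable \<mu> \<Longrightarrow> \<mu> - L * max_jump \<epsilon> \<le> U \<epsilon> k x"
proof (induction k arbitrary: x)
  case 0
  then obtain y where "y \<in> cball x (max_jump \<epsilon>)" "y \<notin> fillable \<mu>" by blast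
  then have y: "dist x y \<le> max_jump \<epsilon>" "\<not> u0 y < \<mu>" using less_in_fillable[of y \<mu>] by auto
  have "L * dist x y \<le> L * max_jump \<epsilon>" using y L by simp
  then show ?case using U_dist[OF \<epsilon>, of 0 x y] y by simp
next
  case (Suc k)
  obtain v s where vs: "admissible \<epsilon> v s"
    "\<And>b \<beta>. b \<in> {-1, 1} \<Longrightarrow> \<beta> \<in> {-1, 1} \<Longrightarrow> U \<epsilon> k (x + jump \<epsilon> v s b \<beta>) \<le> U \<epsilon> (Suc k) x"
    using U_Suc_attained[OF \<epsilon>] by blast
  let ?d = "jump \<epsilon> v s 1 1"
  have "norm ?d \<le> max_jump \<epsilon>" using norm_jump_le[OF \<epsilon>(1) vs(1)] by simp
  from ball_closed_cball_midpoint[OF open_fillable ball_closed_fillable this, of x \<mu>] Suc.prems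
  have "\<not> cball (x + ?d) (max_jump \<epsilon>) \<subseteq> fillable \<mu> \<or> \<not> cball (x - ?d) (max_jump \<epsilon>) \<subseteq> fillable \<mu>"
    by argo
  then show ?case
  proof
    assume "\<not> cball (x + ?d) (max_jump \<epsilon>) \<subseteq> fillable \<mu>"
    from Suc.IH[OF this] vs(2)[of 1 1] show ?thesis by simp
  next
    assume "\<not> cball (x - ?d) (max_jump \<epsilon>) \<subseteq> fillable \<mu>"
    then have "\<not> cball (x + jump \<epsilon> v s (-1) (-1)) (max_jump \<epsilon>) \<subseteq> fillable \<mu>"
      by (simp add: jump_def diff_add_eq algebra_simps)
    from Suc.IH[OF this] vs(2)[of "-1" "-1"] show ?thesis by simp
  qed
qed

end

section \<open>Waiting inside ellipses\<close>

text \<open>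
  The quadratic form whose sublevel sets are ellipses with long axis \<open>e\<close>, the ratio of the axes being \<open>sqrt A\<close>.
\<close>

definition ell :: "real \<Rightarrow> real^2 \<Rightarrow> real^2 \<Rightarrow> real" where
  "ell A e z = A * (e \<bullet> z)\<^sup>2 + (perp e \<bullet> z)\<^sup>2"

lemma ell_zero [simp]: "ell A e 0 = 0"
  by (simp add: ell_def)

lemma norm_square_expansion:
  assumes "norm e = 1"
  shows "(norm z)\<^sup>2 = (e \<bullet> z)\<^sup>2 + (perp e \<bullet> z)\<^sup>2"
proof -
  have "(norm z)\<^sup>2 = (norm ((e \<bullet> z) *\<^sub>R e + (perp e \<bullet> z) *\<^sub>R perp e))\<^sup>2"
    by (rule arg_cong[OF orthonormal_expansion[OF assms, of z]])
  also have "\<dots> = (e \<bullet> z)\<^sup>2 + (perp e \<bullet> z)\<^sup>2"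
    unfolding norm_add_square using assms by simp
  finally show ?thesis .
qed

text \<open>
  The effect on \<open>A a\<^sup>2 + b\<^sup>2\<close> of moving by \<open>X\<close> along its level line and by \<open>Y\<close> along its normal; \<open>g\<close> is half the length of the
  gradient \<open>(2 A a, 2 b)\<close>, and the coefficient of \<open>X\<^sup>2\<close> is governed by the curvature of the level line.
\<close>

lemma ell_jump_bound:
  fixes A a b g X Y :: real
  assumes A: "0 \<le> A" "A \<le> 1" and g: "0 < g" "g\<^sup>2 = A\<^sup>2 * a\<^sup>2 + b\<^sup>2"
  shows "A * (a + X * (b / g) + Y * (A * a / g))\<^sup>2 + (b - X * (A * a / g) + Y * (b / g))\<^sup>2
    \<le> A * a\<^sup>2 + b\<^sup>2 + 2 * \<bar>Y\<bar> * g + X\<^sup>2 * (A * (A * a\<^sup>2 + b\<^sup>2) / g\<^sup>2) + Y\<^sup>2 + \<bar>X * Y\<bar>"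
proof -
  define p where "p = b / g"
  define q where "q = A * a / g"
  have pq: "b = g * p" "A * a = g * q" using g(1) by (simp_all add: p_def q_def)
  have one: "p\<^sup>2 + q\<^sup>2 = 1"
  proof -
    have "g\<^sup>2 * (p\<^sup>2 + q\<^sup>2) = (g * p)\<^sup>2 + (g * q)\<^sup>2" by (simp add: power_mult_distrib algebra_simps)
    also have "\<dots> = g\<^sup>2 * 1" unfolding pq[symmetric] using g(2) by (simp add: power_mult_distrib)
    finally show ?thesis using g(1) by (simp only: mult_cancel_left) simp
  qed
  have quad: "A * p\<^sup>2 + q\<^sup>2 = A * (A * a\<^sup>2 + b\<^sup>2) / g\<^sup>2"
    unfolding p_def q_def by (simp add: power_divide power_mult_distrib add_divide_distrib algebra_simps power2_eq_square)
  have Y: "Y\<^sup>2 * (A * q\<^sup>2 + p\<^sup>2) \<le> Y\<^sup>2"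
  proof -
    have "A * q\<^sup>2 \<le> 1 * q\<^sup>2" using A by (intro mult_right_mono) auto
    then have "A * q\<^sup>2 + p\<^sup>2 \<le> 1" using one by linarith
    then show ?thesis by (simp add: mult_left_le)
  qed
  have XY: "2 * (X * Y) * (p * q * (A - 1)) \<le> \<bar>X * Y\<bar>"
  proof -
    have "\<bar>2 * (p * q)\<bar> \<le> 1"
      using one zero_le_power2[of "p + q"] zero_le_power2[of "p - q"]
      by (simp add: power2_eq_square algebra_simps abs_le_iff)
    then have "\<bar>2 * (p * q)\<bar> * \<bar>A - 1\<bar> \<le> 1 * 1" using A by (intro mult_mono) auto
    then have "\<bar>X * Y\<bar> * (\<bar>2 * (p * q)\<bar> * \<bar>A - 1\<bar>) \<le> \<bar>X * Y\<bar> * 1" by (intro mult_left_mono) auto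
    moreover have "2 * (X * Y) * (p * q * (A - 1)) \<le> \<bar>X * Y\<bar> * (\<bar>2 * (p * q)\<bar> * \<bar>A - 1\<bar>)"
      by (rule order_trans[OF abs_ge_self]) (simp add: abs_mult)
    ultimately show ?thesis by linarith
  qed
  have "2 * (A * a) * (X * p + Y * q) + 2 * b * (Y * p - X * q) = 2 * Y * g * (p\<^sup>2 + q\<^sup>2)"
    unfolding pq by (simp add: power2_eq_square algebra_simps)
  then have lin: "2 * (A * a) * (X * p + Y * q) + 2 * b * (Y * p - X * q) = 2 * Y * g"
    by (simp add: one)
  have "A * (a + X * p + Y * q)\<^sup>2 + (b - X * q + Y * p)\<^sup>2 =
    A * a\<^sup>2 + b\<^sup>2 + (2 * (A * a) * (X * p + Y * q) + 2 * b * (Y * p - X * q))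
     + X\<^sup>2 * (A * p\<^sup>2 + q\<^sup>2) + Y\<^sup>2 * (A * q\<^sup>2 + p\<^sup>2) + 2 * (X * Y) * (p * q * (A - 1))"
    by (simp add: power2_eq_square algebra_simps)
  then have "A * (a + X * p + Y * q)\<^sup>2 + (b - X * q + Y * p)\<^sup>2 =
    A * a\<^sup>2 + b\<^sup>2 + 2 * Y * g + X\<^sup>2 * (A * p\<^sup>2 + q\<^sup>2) + Y\<^sup>2 * (A * q\<^sup>2 + p\<^sup>2)
     + 2 * (X * Y) * (p * q * (A - 1))"
    unfolding lin .
  moreover have "2 * Y * g \<le> 2 * \<bar>Y\<bar> * g" using g(1) by (intro mult_right_mono) auto
  ultimately have "A * (a + X * p + Y * q)\<^sup>2 + (b - X * q + Y * p)\<^sup>2 \<le>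
      A * a\<^sup>2 + b\<^sup>2 + 2 * \<bar>Y\<bar> * g + X\<^sup>2 * (A * p\<^sup>2 + q\<^sup>2) + Y\<^sup>2 + \<bar>X * Y\<bar>"
    using Y XY by linarith
  then show ?thesis unfolding quad unfolding p_def q_def .
qed

lemma ell_add_le:
  assumes "norm e = 1" "0 \<le> A" "A \<le> 1"
  shows "ell A e (z + d) \<le> 2 * ell A e z + 2 * (norm d)\<^sup>2"
proof -
  have sq: "(x + y)\<^sup>2 \<le> 2 * x\<^sup>2 + 2 * y\<^sup>2" for x y :: real
    using zero_le_power2[of "x - y"] by (simp add: power2_eq_square algebra_simps)
  have "A * (e \<bullet> z + e \<bullet> d)\<^sup>2 \<le> A * (2 * (e \<bullet> z)\<^sup>2 + 2 * (e \<bullet> d)\<^sup>2)"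
    using sq assms(2) by (intro mult_left_mono) auto
  moreover have "A * (e \<bullet> d)\<^sup>2 \<le> 1 * (e \<bullet> d)\<^sup>2" using assms(3) by (intro mult_right_mono) auto
  moreover have "(norm d)\<^sup>2 = (e \<bullet> d)\<^sup>2 + (perp e \<bullet> d)\<^sup>2"
    by (rule norm_square_expansion[OF assms(1)])
  ultimately show ?thesis
    using sq[of "perp e \<bullet> z" "perp e \<bullet> d"] by (simp add: ell_def inner_add_right algebra_simps)
qed

text \<open>
  Otherwise there are points of \<open>\<Gamma>\<close> going to infinity without the property, and their directions from \<open>x0\<close>
  converge, along a subsequence, to some \<open>e\<close>. Take one of them, \<open>x\<close>, for which \<open>x - x0\<close> is almost parallel to \<open>e\<close>. In
  the direction \<open>-e\<close> the segment from \<open>x\<close> back to \<open>x0\<close> runs near \<open>x + t e\<close>, and in the direction \<open>e\<close> the segment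
  from \<open>x\<close> to a much later point of the sequence does.
\<close>

lemma convex_far_direction:
  fixes \<Gamma> :: "(real^2) set"
  assumes conv: "convex \<Gamma>" and x0: "x0 \<in> \<Gamma>" and \<delta>: "0 < \<delta>" and M: "0 < M"
  obtains D where "0 < D" "\<And>x. x \<in> \<Gamma> \<Longrightarrow> D \<le> norm (x - x0) \<Longrightarrow>
    \<exists>e. norm e = 1 \<and> (\<forall>t. \<bar>t\<bar> \<le> M \<longrightarrow> (\<exists>y\<in>\<Gamma>. norm (x + t *\<^sub>R e - y) \<le> \<delta>))"
proof -
  define good where "good x \<longleftrightarrow>
    (\<exists>e. norm e = 1 \<and> (\<forall>t. \<bar>t\<bar> \<le> M \<longrightarrow> (\<exists>y\<in>\<Gamma>. norm (x + t *\<^sub>R e - y) \<le> \<delta>)))" for x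
  have "\<exists>D>0. \<forall>x\<in>\<Gamma>. D \<le> norm (x - x0) \<longrightarrow> good x"
  proof (rule ccontr)
    assume "\<not> ?thesis"
    then have "\<forall>n. \<exists>x. x \<in> \<Gamma> \<and> real (Suc n) \<le> norm (x - x0) \<and> \<not> good x"
      by (metis of_nat_0_less_iff zero_less_Suc)
    then obtain X where X: "\<And>n. X n \<in> \<Gamma>" "\<And>n. real (Suc n) \<le> norm (X n - x0)" "\<And>n. \<not> good (X n)"
      by metis
    define w where "w n = (X n - x0) /\<^sub>R norm (X n - x0)" for n
    have ne: "X n \<noteq> x0" for n using X(2)[of n] by auto
    have "\<forall>n. w n \<in> sphere 0 1" using ne by (simp add: w_def)
    then obtain e r where e: "e \<in> sphere 0 1" "strict_mono r" "(w \<circ> r) \<longlonglongrightarrow> e"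
      using compact_sphere[of "0::real^2" 1] unfolding compact_def by metis
    have e1: "norm e = 1" using e(1) by simp
    have "\<forall>\<^sub>F j in sequentially. dist ((w \<circ> r) j) e < \<delta> / M"
      using tendstoD[OF e(3)] \<delta> M by simp
    moreover have "\<forall>\<^sub>F j in sequentially. nat \<lceil>M\<rceil> \<le> j" by (rule eventually_ge_at_top)
    ultimately obtain j where j: "dist ((w \<circ> r) j) e < \<delta> / M" "nat \<lceil>M\<rceil> \<le> j"
      using eventually_happens[OF eventually_conj] by fastforce
    define x where "x = X (r j)"
    have xfar: "M \<le> norm (x - x0)"
    proof -
      have "M \<le> real j" using j(2) by linarith
      also have "\<dots> \<le> real (r j)" using seq_suble[OF e(2), of j] by simp
      also have "\<dots> \<le> norm (x - x0)" using X(2)[of "r j"] by (simp add: x_def)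
      finally show ?thesis .
    qed
    have "\<exists>y\<in>\<Gamma>. norm (x + t *\<^sub>R e - y) \<le> \<delta>" if t: "\<bar>t\<bar> \<le> M" for t
    proof (cases "t \<le> 0")
      case True
      define \<theta> where "\<theta> = - t / norm (x - x0)"
      have pos: "0 < norm (x - x0)" using xfar M by linarith
      have \<theta>: "0 \<le> \<theta>" "\<theta> \<le> 1" using True t xfar pos by (simp_all add: \<theta>_def field_simps)
      define y where "y = (1 - \<theta>) *\<^sub>R x + \<theta> *\<^sub>R x0"
      have yG: "y \<in> \<Gamma>" unfolding y_def x_def using conv X(1) x0 \<theta> by (simp add: convex_alt)
      have "y = x + t *\<^sub>R w (r j)"
      proof -
        have "t *\<^sub>R w (r j) = (- \<theta>) *\<^sub>R (x - x0)"
          by (simp add: w_def x_def[symmetric] \<theta>_def divide_inverse)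
        then show ?thesis by (simp add: y_def algebra_simps)
      qed
      then have "x + t *\<^sub>R e - y = t *\<^sub>R (e - w (r j))" by (simp add: algebra_simps)
      then have "norm (x + t *\<^sub>R e - y) = \<bar>t\<bar> * dist (w (r j)) e" by (simp add: dist_norm norm_minus_commute)
      also have "\<dots> \<le> M * (\<delta> / M)" using t j(1) M by (intro mult_mono) auto
      also have "\<dots> = \<delta>" using M by simp
      finally show ?thesis using yG by blast
    next
      case False
      have lim: "(\<lambda>i. (X (r i) - x) /\<^sub>R norm (X (r i) - x0)) \<longlonglongrightarrow> e - 0 *\<^sub>R (x - x0)"
      proof -
        have "filterlim (\<lambda>i. norm (X (r i) - x0)) at_top sequentially"
        proof (rule filterlim_at_top_mono[OF filterlim_real_sequentially])
          show "\<forall>\<^sub>F i in sequentially. real i \<le> norm (X (r i) - x0)"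
          proof (rule always_eventually, rule allI)
            fix i show "real i \<le> norm (X (r i) - x0)"
              using X(2)[of "r i"] seq_suble[OF e(2), of i] by (simp add: order_trans)
          qed
        qed
        then have "(\<lambda>i. inverse (norm (X (r i) - x0))) \<longlonglongrightarrow> 0"
          by (rule tendsto_inverse_0_at_top)
        then have "(\<lambda>i. (w \<circ> r) i - inverse (norm (X (r i) - x0)) *\<^sub>R (x - x0)) \<longlonglongrightarrow> e - 0 *\<^sub>R (x - x0)"
          by (intro tendsto_intros e(3))
        moreover have "(w \<circ> r) i - inverse (norm (X (r i) - x0)) *\<^sub>R (x - x0) =
            (X (r i) - x) /\<^sub>R norm (X (r i) - x0)" for i
          by (simp add: w_def flip: scaleR_diff_right)
        ultimately show ?thesis by simp
      qed
      have "\<forall>\<^sub>F i in sequentially. dist ((X (r i) - x) /\<^sub>R norm (X (r i) - x0)) e < \<delta> / M"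
        using tendstoD[OF lim] \<delta> M by simp
      moreover have "\<forall>\<^sub>F i in sequentially. nat \<lceil>M\<rceil> \<le> i" by (rule eventually_ge_at_top)
      ultimately obtain i where i: "dist ((X (r i) - x) /\<^sub>R norm (X (r i) - x0)) e < \<delta> / M" "nat \<lceil>M\<rceil> \<le> i"
        using eventually_happens[OF eventually_conj] by fastforce
      define m where "m = norm (X (r i) - x0)"
      have mM: "M \<le> m"
      proof -
        have "M \<le> real i" using i(2) by linarith
        also have "\<dots> \<le> real (r i)" using seq_suble[OF e(2), of i] by simp
        also have "\<dots> \<le> m" using X(2)[of "r i"] by (simp add: m_def)
        finally show ?thesis .
      qed
      define y where "y = (1 - t / m) *\<^sub>R x + (t / m) *\<^sub>R X (r i)"
      have "0 \<le> t / m" "t / m \<le> 1" using False t M mM by (simp_all add: field_simps)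
      then have "y \<in> \<Gamma>" unfolding y_def x_def using conv X(1) by (simp add: convex_alt)
      moreover have "x + t *\<^sub>R e - y = t *\<^sub>R (e - (X (r i) - x) /\<^sub>R m)"
        by (simp add: y_def algebra_simps divide_inverse)
      then have "norm (x + t *\<^sub>R e - y) = \<bar>t\<bar> * dist ((X (r i) - x) /\<^sub>R m) e"
        by (simp add: dist_norm norm_minus_commute)
      then have "norm (x + t *\<^sub>R e - y) \<le> M * (\<delta> / M)"
        using t i(1) M by (simp only: m_def) (intro mult_mono, auto)
      then have "norm (x + t *\<^sub>R e - y) \<le> \<delta>" using M by simp
      ultimately show ?thesis by blast
    qed
    then have "good x" unfolding good_def using e1 by blast
    then show False using X(3)[of "r j"] by (simp add: x_def)
  qed
  then show thesis using that unfolding good_def by blast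
qed

context curvature_game begin

text \<open>
  The minimiser moves along the level line of the elliptic form through \<open>z\<close>.
\<close>

lemma ell_step:
  assumes \<epsilon>: "0 < \<epsilon>" "\<epsilon> < 1" and e: "norm e = 1" and A: "0 < A" "A \<le> 1"
    and s: "s \<in> step_range \<alpha>1 \<alpha>2 \<epsilon>"
    and g: "0 < g" "g\<^sup>2 = A\<^sup>2 * (e \<bullet> z)\<^sup>2 + (perp e \<bullet> z)\<^sup>2"
    and cost: "2 * game_f \<gamma> s * g + s\<^sup>2 * (A * ell A e z / g\<^sup>2) + \<epsilon> * ((game_f \<gamma> s)\<^sup>2 + s * game_f \<gamma> s) \<le> \<mu>"
  shows "\<exists>v. admissible \<epsilon> v s \<and>
    (\<forall>b\<in>{-1, 1}. \<forall>\<beta>\<in>{-1, 1}. ell A e (z + jump \<epsilon> v s b \<beta>) \<le> ell A e z + \<epsilon>\<^sup>2 * \<mu>)"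
proof (intro exI conjI ballI)
  define a b where "a = e \<bullet> z" and "b = perp e \<bullet> z"
  define v where "v = (b / g) *\<^sub>R e - (A * a / g) *\<^sub>R perp e"
  have ee: "e \<bullet> e = 1" "perp e \<bullet> perp e = 1"
    using e norm_perp[of e] by (simp_all flip: power2_norm_eq_inner)
  have pv: "perp v = (b / g) *\<^sub>R perp e + (A * a / g) *\<^sub>R e"
    by (simp add: v_def perp_def vec_eq_iff forall_2)
  have "(norm v)\<^sup>2 = (b / g)\<^sup>2 + (A * a / g)\<^sup>2"
  proof -
    have "v = (b / g) *\<^sub>R e + (- (A * a / g)) *\<^sub>R perp e" by (simp add: v_def)
    then show ?thesis by (simp only: norm_add_square) (simp add: e power_mult_distrib power_divide)
  qed
  also have "\<dots> = (b\<^sup>2 + A\<^sup>2 * a\<^sup>2) / g\<^sup>2"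
    by (simp add: power_divide power_mult_distrib add_divide_distrib)
  also have "b\<^sup>2 + A\<^sup>2 * a\<^sup>2 = g\<^sup>2" using g(2) by (simp add: a_def b_def)
  finally have "(norm v)\<^sup>2 = 1\<^sup>2" using g(1) by simp
  then have "norm v = 1" by (rule power2_eq_imp_eq) simp_all
  then show "admissible \<epsilon> v s" using s by (simp add: admissible_def)
  fix b' \<beta> :: real assume sg: "b' \<in> {-1, 1}" "\<beta> \<in> {-1, 1}"
  define X where "X = b' * \<epsilon> * s"
  define Y where "Y = \<beta> * \<epsilon>\<^sup>2 * game_f \<gamma> s"
  have s0: "0 < s" using step_bounds[OF \<epsilon>(1) s] by simp
  have f0: "0 \<le> game_f \<gamma> s" by (rule game_f_nonneg[OF \<gamma>])
  have XY: "X\<^sup>2 = \<epsilon>\<^sup>2 * s\<^sup>2" "\<bar>Y\<bar> = \<epsilon>\<^sup>2 * game_f \<gamma> s" "Y\<^sup>2 = \<epsilon>\<^sup>2 * (\<epsilon>\<^sup>2 * (game_f \<gamma> s)\<^sup>2)"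
    "\<bar>X * Y\<bar> = \<epsilon>\<^sup>2 * (\<epsilon> * (s * game_f \<gamma> s))"
    using sg \<epsilon> s0 f0 by (auto simp: X_def Y_def power2_eq_square abs_mult)
  have ea: "e \<bullet> (z + jump \<epsilon> v s b' \<beta>) = a + X * (b / g) + Y * (A * a / g)"
    unfolding jump_def X_def[symmetric] Y_def[symmetric] pv
    by (simp add: v_def inner_add_right inner_diff_right ee a_def[symmetric])
  have eb: "perp e \<bullet> (z + jump \<epsilon> v s b' \<beta>) = b - X * (A * a / g) + Y * (b / g)"
    unfolding jump_def X_def[symmetric] Y_def[symmetric] pv
    by (simp add: v_def inner_add_right inner_diff_right ee b_def[symmetric])
  have "ell A e (z + jump \<epsilon> v s b' \<beta>) \<le> A * a\<^sup>2 + b\<^sup>2 + 2 * \<bar>Y\<bar> * g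
      + X\<^sup>2 * (A * (A * a\<^sup>2 + b\<^sup>2) / g\<^sup>2) + Y\<^sup>2 + \<bar>X * Y\<bar>"
    unfolding ell_def ea eb using A g by (intro ell_jump_bound) (auto simp: a_def b_def)
  also have "\<dots> = ell A e z + \<epsilon>\<^sup>2 * (2 * game_f \<gamma> s * g + s\<^sup>2 * (A * ell A e z / g\<^sup>2)
      + (\<epsilon>\<^sup>2 * (game_f \<gamma> s)\<^sup>2 + \<epsilon> * (s * game_f \<gamma> s)))"
    unfolding XY ell_def a_def[symmetric] b_def[symmetric] by (simp add: algebra_simps)
  also have "\<dots> \<le> ell A e z + \<epsilon>\<^sup>2 * \<mu>"
  proof -
    have "\<epsilon>\<^sup>2 * (game_f \<gamma> s)\<^sup>2 \<le> \<epsilon> * (game_f \<gamma> s)\<^sup>2"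
      using \<epsilon> by (intro mult_right_mono) (auto simp: power2_eq_square mult_le_cancel_left1)
    then have "2 * game_f \<gamma> s * g + s\<^sup>2 * (A * ell A e z / g\<^sup>2)
      + (\<epsilon>\<^sup>2 * (game_f \<gamma> s)\<^sup>2 + \<epsilon> * (s * game_f \<gamma> s)) \<le> \<mu>"
      using cost by (simp only: distrib_left)
    then show ?thesis by (simp add: mult_left_mono)
  qed
  finally show "ell A e (z + jump \<epsilon> v s b' \<beta>) \<le> ell A e z + \<epsilon>\<^sup>2 * \<mu>" .
qed

text \<open>
  The ellipse may shrink by \<open>\<epsilon>\<^sup>2 \<mu>\<close> per step as long as at least half of \<open>\<rho>\<^sup>2\<close> is left. Near the centre, where the gradient
  of the form degenerates, no care is needed, since no small jump leads close to the boundary.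
\<close>

lemma ell_survive:
  assumes \<epsilon>: "0 < \<epsilon>" "\<epsilon> < 1" and e: "norm e = 1" and A: "0 < A" "A \<le> 1" and \<mu>: "0 \<le> \<mu>"
    and small: "max_jump \<epsilon> \<le> \<rho> / 4" and rng: "1 \<in> step_range \<alpha>1 \<alpha>2 \<epsilon>"
    and step: "\<And>z. \<rho>\<^sup>2 / 8 \<le> ell A e z \<Longrightarrow> ell A e z \<le> \<rho>\<^sup>2 \<Longrightarrow> \<exists>v s. admissible \<epsilon> v s \<and>
      (\<forall>b\<in>{-1, 1}. \<forall>\<beta>\<in>{-1, 1}. ell A e (z + jump \<epsilon> v s b \<beta>) \<le> ell A e z + \<epsilon>\<^sup>2 * \<mu>)"
    and base: "\<And>z. ell A e z \<le> \<rho>\<^sup>2 \<Longrightarrow> U \<epsilon> m (x + z) \<le> c"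
  shows "2 * (real k * \<epsilon>\<^sup>2 * \<mu>) \<le> \<rho>\<^sup>2 \<Longrightarrow> ell A e z \<le> \<rho>\<^sup>2 - real k * \<epsilon>\<^sup>2 * \<mu> \<Longrightarrow> U \<epsilon> (k + m) (x + z) \<le> c"
proof (induction k arbitrary: z)
  case 0
  then show ?case using base by simp
next
  case (Suc k)
  have S: "real (Suc k) * \<epsilon>\<^sup>2 * \<mu> = real k * \<epsilon>\<^sup>2 * \<mu> + \<epsilon>\<^sup>2 * \<mu>"
    by (simp add: algebra_simps)
  have p: "0 \<le> \<epsilon>\<^sup>2 * \<mu>" "0 \<le> real k * \<epsilon>\<^sup>2 * \<mu>" using \<mu> by auto
  have "\<exists>v s. admissible \<epsilon> v s \<and>
    (\<forall>b\<in>{-1, 1}. \<forall>\<beta>\<in>{-1, 1}. ell A e (z + jump \<epsilon> v s b \<beta>) \<le> \<rho>\<^sup>2 - real k * \<epsilon>\<^sup>2 * \<mu>)"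
  proof (cases "\<rho>\<^sup>2 / 8 \<le> ell A e z")
    case True
    have "ell A e z \<le> \<rho>\<^sup>2" using Suc.prems(2) S p by linarith
    from step[OF True this] obtain v s where vs: "admissible \<epsilon> v s"
      "\<forall>b\<in>{-1, 1}. \<forall>\<beta>\<in>{-1, 1}. ell A e (z + jump \<epsilon> v s b \<beta>) \<le> ell A e z + \<epsilon>\<^sup>2 * \<mu>" by blast
    have "ell A e z + \<epsilon>\<^sup>2 * \<mu> \<le> \<rho>\<^sup>2 - real k * \<epsilon>\<^sup>2 * \<mu>" using Suc.prems(2) S by linarith
    then show ?thesis using vs order_trans by blast
  next
    case False
    have adm: "admissible \<epsilon> e 1" using e rng by (simp add: admissible_def)
    have "ell A e (z + jump \<epsilon> e 1 b \<beta>) \<le> \<rho>\<^sup>2 - real k * \<epsilon>\<^sup>2 * \<mu>" if b: "b \<in> {-1, 1}" "\<beta> \<in> {-1, 1}" for b \<beta>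
    proof -
      have "norm (jump \<epsilon> e 1 b \<beta>) \<le> \<rho> / 4" using norm_jump_le[OF \<epsilon>(1) adm b] small by linarith
      then have "(norm (jump \<epsilon> e 1 b \<beta>))\<^sup>2 \<le> (\<rho> / 4)\<^sup>2" by (intro power_mono) auto
      then have "(norm (jump \<epsilon> e 1 b \<beta>))\<^sup>2 \<le> \<rho>\<^sup>2 / 16" by (simp add: power_divide)
      moreover have "ell A e (z + jump \<epsilon> e 1 b \<beta>) \<le> 2 * ell A e z + 2 * (norm (jump \<epsilon> e 1 b \<beta>))\<^sup>2"
        using A e by (intro ell_add_le) auto
      moreover have "2 * (real k * \<epsilon>\<^sup>2 * \<mu>) \<le> \<rho>\<^sup>2" using Suc.prems(1) S p by linarith
      moreover have "0 \<le> \<rho>\<^sup>2" by simp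
      ultimately show ?thesis using False by linarith
    qed
    then show ?thesis using adm by blast
  qed
  then obtain v s where vs: "admissible \<epsilon> v s"
    "\<forall>b\<in>{-1, 1}. \<forall>\<beta>\<in>{-1, 1}. ell A e (z + jump \<epsilon> v s b \<beta>) \<le> \<rho>\<^sup>2 - real k * \<epsilon>\<^sup>2 * \<mu>" by blast
  have k2: "2 * (real k * \<epsilon>\<^sup>2 * \<mu>) \<le> \<rho>\<^sup>2" using Suc.prems(1) S p by linarith
  show ?case unfolding add_Suc
  proof (rule U_Suc_le[OF \<epsilon> vs(1)])
    fix b \<beta> :: real assume "b \<in> {-1, 1}" "\<beta> \<in> {-1, 1}"
    with vs(2) have "ell A e (z + jump \<epsilon> v s b \<beta>) \<le> \<rho>\<^sup>2 - real k * \<epsilon>\<^sup>2 * \<mu>" by blast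
    from Suc.IH[OF k2 this] show "U \<epsilon> (k + m) (x + z + jump \<epsilon> v s b \<beta>) \<le> c"
      by (simp only: add.assoc)
  qed
qed

text \<open>
  The budget \<open>\<mu>\<close> per unit of time is \<open>\<rho>\<^sup>2 / (2 H)\<close>. Where the gradient is not small, one uses a large \<open>s = S\<close> with \<open>f S\<close> tiny;
  the price \<open>S\<^sup>2\<close> times the curvature of the ellipse is made small by choosing \<open>A\<close> small, that is, the ellipse long.
  Where the gradient \<open>g\<close> is small, the normal displacement is harmless and a small \<open>s = s0\<close> suffices.
\<close>

lemma ellipse_survival:
  assumes \<rho>: "0 < \<rho>" and H: "0 < H"
  obtains A where "0 < A" "A \<le> 1"
    "\<forall>\<^sub>F \<epsilon> in at_right 0. \<forall>x e m c k. norm e = 1 \<longrightarrow> (\<forall>z. ell A e z \<le> \<rho>\<^sup>2 \<longrightarrow> U \<epsilon> m (x + z) \<le> c) \<longrightarrow>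
       real k * \<epsilon>\<^sup>2 \<le> H \<longrightarrow> U \<epsilon> (k + m) x \<le> c"
proof -
  define \<mu> where "\<mu> = \<rho>\<^sup>2 / (2 * H)"
  have \<mu>: "0 < \<mu>" "2 * (H * \<mu>) = \<rho>\<^sup>2" using \<rho> H by (simp_all add: \<mu>_def)
  have "\<forall>\<^sub>F S in at_top. game_f \<gamma> S < \<mu> / (8 * \<rho>)"
    using order_tendstoD(2)[OF game_f_tendsto_0[OF \<gamma>]] \<mu> \<rho> by simp
  then obtain S where "game_f \<gamma> S < \<mu> / (8 * \<rho>)" "0 < S"
    using eventually_happens[OF eventually_conj[OF _ eventually_gt_at_top[of "0::real"]]] by fastforce
  then have S: "2 * game_f \<gamma> S * \<rho> \<le> \<mu> / 4" "0 < S" using \<rho> by (simp_all add: field_simps)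
  define s0 where "s0 = sqrt (\<mu> / 4)"
  have s0: "0 < s0" "s0\<^sup>2 = \<mu> / 4" using \<mu> by (simp_all add: s0_def)
  define \<theta> where "\<theta> = \<mu> / (8 * (game_f \<gamma> s0 + 1))"
  have f0: "0 \<le> game_f \<gamma> s" for s by (rule game_f_nonneg[OF \<gamma>])
  have \<theta>: "0 < \<theta>" "2 * game_f \<gamma> s0 * \<theta> \<le> \<mu> / 4"
    using \<mu> f0[of s0] by (simp_all add: \<theta>_def field_simps add_nonneg_pos)
  define A where "A = min 1 (\<mu> / 4 * \<theta>\<^sup>2 / (S\<^sup>2 * \<rho>\<^sup>2))"
  have A: "0 < A" "A \<le> 1" using \<mu> \<theta> S \<rho> by (simp_all add: A_def)
  have AS: "S\<^sup>2 * (A * \<rho>\<^sup>2 / \<theta>\<^sup>2) \<le> \<mu> / 4"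
  proof -
    have "A \<le> \<mu> / 4 * \<theta>\<^sup>2 / (S\<^sup>2 * \<rho>\<^sup>2)" by (simp add: A_def)
    then show ?thesis using \<theta> S \<rho> by (simp add: field_simps)
  qed
  define C where "C = (game_f \<gamma> S)\<^sup>2 + S * game_f \<gamma> S + ((game_f \<gamma> s0)\<^sup>2 + s0 * game_f \<gamma> s0)"
  have C: "(game_f \<gamma> S)\<^sup>2 + S * game_f \<gamma> S \<le> C" "(game_f \<gamma> s0)\<^sup>2 + s0 * game_f \<gamma> s0 \<le> C" "0 \<le> C"
    using S s0 f0 by (simp_all add: C_def)
  have "\<forall>\<^sub>F \<epsilon> in at_right 0. 0 < \<epsilon> \<and> \<epsilon> < min 1 (\<mu> / (4 * (C + 1)))"
    by (rule eps_small) (use \<mu> C in simp)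
  moreover have "\<forall>\<^sub>F \<epsilon> in at_right 0. max_jump \<epsilon> < \<rho> / 4" by (rule max_jump_small) (use \<rho> in simp)
  moreover have "\<forall>\<^sub>F \<epsilon> in at_right 0. 1 \<in> step_range \<alpha>1 \<alpha>2 \<epsilon>" "\<forall>\<^sub>F \<epsilon> in at_right 0. S \<in> step_range \<alpha>1 \<alpha>2 \<epsilon>"
    "\<forall>\<^sub>F \<epsilon> in at_right 0. s0 \<in> step_range \<alpha>1 \<alpha>2 \<epsilon>"
    using step_range_eventually[of 1] step_range_eventually[OF S(2)] step_range_eventually[OF s0(1)] by simp_all
  ultimately have "\<forall>\<^sub>F \<epsilon> in at_right 0. \<forall>x e m c k. norm e = 1 \<longrightarrow> (\<forall>z. ell A e z \<le> \<rho>\<^sup>2 \<longrightarrow> U \<epsilon> m (x + z) \<le> c) \<longrightarrow>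
       real k * \<epsilon>\<^sup>2 \<le> H \<longrightarrow> U \<epsilon> (k + m) x \<le> c"
  proof eventually_elim
    case (elim \<epsilon>)
    have \<epsilon>: "0 < \<epsilon>" "\<epsilon> < 1" "\<epsilon> < \<mu> / (4 * (C + 1))" using elim by auto
    have \<epsilon>C: "\<epsilon> * C \<le> \<mu> / 4"
    proof -
      have "\<epsilon> * (C + 1) \<le> \<mu> / 4" using \<epsilon>(3) C(3) by (simp add: field_simps)
      then show ?thesis using \<epsilon>(1) by (simp add: algebra_simps)
    qed
    show ?case
    proof (intro allI impI)
      fix x e m c k
      assume e: "norm e = 1" and base: "\<forall>z. ell A e z \<le> \<rho>\<^sup>2 \<longrightarrow> U \<epsilon> m (x + z) \<le> c"
        and k: "real k * \<epsilon>\<^sup>2 \<le> H"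
      have step: "\<exists>v s. admissible \<epsilon> v s \<and>
        (\<forall>b\<in>{-1, 1}. \<forall>\<beta>\<in>{-1, 1}. ell A e (z + jump \<epsilon> v s b \<beta>) \<le> ell A e z + \<epsilon>\<^sup>2 * \<mu>)"
        if z: "\<rho>\<^sup>2 / 8 \<le> ell A e z" "ell A e z \<le> \<rho>\<^sup>2" for z
      proof -
        define g where "g = sqrt (A\<^sup>2 * (e \<bullet> z)\<^sup>2 + (perp e \<bullet> z)\<^sup>2)"
        have g2: "g\<^sup>2 = A\<^sup>2 * (e \<bullet> z)\<^sup>2 + (perp e \<bullet> z)\<^sup>2" by (simp add: g_def)
        have "A * (A * (e \<bullet> z)\<^sup>2) \<le> 1 * (A * (e \<bullet> z)\<^sup>2)" using A by (intro mult_right_mono) simp_all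
        moreover have "A * (perp e \<bullet> z)\<^sup>2 \<le> 1 * (perp e \<bullet> z)\<^sup>2" using A by (intro mult_right_mono) simp_all
        moreover have "g\<^sup>2 = A * (A * (e \<bullet> z)\<^sup>2) + (perp e \<bullet> z)\<^sup>2"
          unfolding g2 by (simp only: power2_eq_square[of A] mult.assoc)
        ultimately have low: "A * ell A e z \<le> g\<^sup>2" and up: "g\<^sup>2 \<le> ell A e z"
          unfolding ell_def distrib_left by linarith+
        have "0 < \<rho>\<^sup>2" using \<rho> by simp
        then have ell0: "0 < ell A e z" using z(1) by linarith
        have "0 < g\<^sup>2" by (rule less_le_trans[OF mult_pos_pos[OF A(1) ell0] low])
        moreover have "0 \<le> g" unfolding g_def by (intro real_sqrt_ge_zero add_nonneg_nonneg) auto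
        ultimately have g0: "0 < g" by (cases "g = 0") auto
        have g\<rho>: "g \<le> \<rho>" by (rule power2_le_imp_le[OF order_trans[OF up z(2)] less_imp_le[OF \<rho>]])
        show ?thesis
        proof (cases "\<theta> \<le> g")
          case True
          have "2 * game_f \<gamma> S * g \<le> 2 * game_f \<gamma> S * \<rho>" using g\<rho> f0[of S] by (intro mult_left_mono) auto
          moreover have "S\<^sup>2 * (A * ell A e z / g\<^sup>2) \<le> S\<^sup>2 * (A * \<rho>\<^sup>2 / \<theta>\<^sup>2)"
            using True A z(2) \<theta> ell0 by (intro mult_left_mono frac_le power_mono) auto
          moreover have "\<epsilon> * ((game_f \<gamma> S)\<^sup>2 + S * game_f \<gamma> S) \<le> \<epsilon> * C" using C \<epsilon> by (intro mult_left_mono) auto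
          ultimately have "2 * game_f \<gamma> S * g + S\<^sup>2 * (A * ell A e z / g\<^sup>2)
              + \<epsilon> * ((game_f \<gamma> S)\<^sup>2 + S * game_f \<gamma> S) \<le> \<mu>"
            using S(1) AS \<epsilon>C \<mu> by linarith
          from ell_step[OF \<epsilon>(1,2) e A elim(4) g0 g2 this] show ?thesis by blast
        next
          case False
          have "2 * game_f \<gamma> s0 * g \<le> 2 * game_f \<gamma> s0 * \<theta>" using False f0[of s0] by (intro mult_left_mono) auto
          moreover have "s0\<^sup>2 * (A * ell A e z / g\<^sup>2) \<le> s0\<^sup>2 * 1"
            using low \<open>0 < g\<^sup>2\<close> by (intro mult_left_mono) auto
          moreover have "\<epsilon> * ((game_f \<gamma> s0)\<^sup>2 + s0 * game_f \<gamma> s0) \<le> \<epsilon> * C" using C \<epsilon> by (intro mult_left_mono) auto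
          ultimately have "2 * game_f \<gamma> s0 * g + s0\<^sup>2 * (A * ell A e z / g\<^sup>2)
              + \<epsilon> * ((game_f \<gamma> s0)\<^sup>2 + s0 * game_f \<gamma> s0) \<le> \<mu>"
            using \<theta>(2) s0(2) \<epsilon>C \<mu> by linarith
          from ell_step[OF \<epsilon>(1,2) e A elim(5) g0 g2 this] show ?thesis by blast
        qed
      qed
      have "real k * \<epsilon>\<^sup>2 * \<mu> \<le> H * \<mu>" using k \<mu> by (intro mult_right_mono) auto
      then have k': "2 * (real k * \<epsilon>\<^sup>2 * \<mu>) \<le> \<rho>\<^sup>2" using \<mu> by linarith
      have "U \<epsilon> (k + m) (x + 0) \<le> c"
      proof (rule ell_survive[OF \<epsilon>(1,2) e A less_imp_le[OF \<mu>(1)] _ elim(3) step _ k'])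
        show "ell A e 0 \<le> \<rho>\<^sup>2 - real k * \<epsilon>\<^sup>2 * \<mu>"
          unfolding ell_zero using k' zero_le_power2[of \<rho>] by linarith
      qed (use elim(2) base in auto)
      then show "U \<epsilon> (k + m) x \<le> c" by simp
    qed
  qed
  then show thesis by (rule that[OF A])
qed

text \<open>
  The minimiser stays in a disc of radius \<open>\<rho>\<close> for some positive time that is independent of \<open>\<epsilon>\<close> and of the position,
  by moving along concentric circles with \<open>s = 1\<close>.
\<close>

lemma idle_cost:
  assumes \<rho>: "0 < \<rho>"
  obtains \<sigma> where "0 < \<sigma>" "\<forall>\<^sub>F \<epsilon> in at_right 0. \<forall>x k. real k * \<epsilon>\<^sup>2 \<le> \<sigma> \<longrightarrow> U \<epsilon> k x \<le> u0 x + L * \<rho>"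
proof -
  have f0: "0 \<le> game_f \<gamma> 1" by (rule game_f_nonneg[OF \<gamma>])
  \<comment> \<open>an upper bound for the growth rate of \<open>\<bar>z\<bar>\<^sup>2\<close> when \<open>s = 1\<close>\<close>
  define \<mu> where "\<mu> = 2 * game_f \<gamma> 1 * \<rho> + 1 + ((game_f \<gamma> 1)\<^sup>2 + game_f \<gamma> 1)"
  have \<mu>: "0 < \<mu>" using f0 \<rho> by (simp add: \<mu>_def add_nonneg_pos add_pos_nonneg)
  define \<sigma> where "\<sigma> = \<rho>\<^sup>2 / (2 * \<mu>)"
  have \<sigma>: "0 < \<sigma>" "2 * (\<sigma> * \<mu>) = \<rho>\<^sup>2" using \<mu> \<rho> by (simp_all add: \<sigma>_def)
  have "\<forall>\<^sub>F \<epsilon> in at_right (0::real). 0 < \<epsilon> \<and> \<epsilon> < 1" by (rule eps_small) simp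
  moreover have "\<forall>\<^sub>F \<epsilon> in at_right 0. max_jump \<epsilon> < \<rho> / 4" by (rule max_jump_small) (use \<rho> in simp)
  moreover have "\<forall>\<^sub>F \<epsilon> in at_right 0. 1 \<in> step_range \<alpha>1 \<alpha>2 \<epsilon>" using step_range_eventually[of 1] by simp
  ultimately have "\<forall>\<^sub>F \<epsilon> in at_right 0. \<forall>x k. real k * \<epsilon>\<^sup>2 \<le> \<sigma> \<longrightarrow> U \<epsilon> k x \<le> u0 x + L * \<rho>"
  proof eventually_elim
    case (elim \<epsilon>)
    have \<epsilon>: "0 < \<epsilon>" "\<epsilon> < 1" using elim by auto
    define e :: "real^2" where "e = axis 1 1"
    have e: "norm e = 1" by (simp add: e_def norm_axis_1)
    have ell1: "ell 1 e z = (norm z)\<^sup>2" for z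
      unfolding ell_def norm_square_expansion[OF e, of z] by simp
    show ?case
    proof (intro allI impI)
      fix x k assume k: "real k * \<epsilon>\<^sup>2 \<le> \<sigma>"
      have step: "\<exists>v s. admissible \<epsilon> v s \<and>
        (\<forall>b\<in>{-1, 1}. \<forall>\<beta>\<in>{-1, 1}. ell 1 e (z + jump \<epsilon> v s b \<beta>) \<le> ell 1 e z + \<epsilon>\<^sup>2 * \<mu>)"
        if z: "\<rho>\<^sup>2 / 8 \<le> ell 1 e z" "ell 1 e z \<le> \<rho>\<^sup>2" for z
      proof -
        have "0 < \<rho>\<^sup>2" using \<rho> by simp
        then have "0 < (norm z)\<^sup>2" using z(1) unfolding ell1 by linarith
        then have z0: "0 < norm z" by simp
        have z\<rho>: "norm z \<le> \<rho>" using power2_le_imp_le[OF _ less_imp_le[OF \<rho>], of "norm z"] z(2) by (simp only: ell1)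
        have g2: "(norm z)\<^sup>2 = 1\<^sup>2 * (e \<bullet> z)\<^sup>2 + (perp e \<bullet> z)\<^sup>2" using ell1[of z] by (simp add: ell_def)
        have "2 * game_f \<gamma> 1 * norm z \<le> 2 * game_f \<gamma> 1 * \<rho>" using z\<rho> f0 by (intro mult_left_mono) auto
        moreover have "1\<^sup>2 * (1 * ell 1 e z / (norm z)\<^sup>2) \<le> 1" using z0 by (simp add: ell1)
        moreover have "\<epsilon> * ((game_f \<gamma> 1)\<^sup>2 + 1 * game_f \<gamma> 1) \<le> (game_f \<gamma> 1)\<^sup>2 + game_f \<gamma> 1"
          using \<epsilon> f0 by (simp add: mult_left_le_one_le)
        ultimately have "2 * game_f \<gamma> 1 * norm z + 1\<^sup>2 * (1 * ell 1 e z / (norm z)\<^sup>2)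
            + \<epsilon> * ((game_f \<gamma> 1)\<^sup>2 + 1 * game_f \<gamma> 1) \<le> \<mu>" unfolding \<mu>_def by (intro add_mono)
        from ell_step[OF \<epsilon> e zero_less_one order_refl elim(3) z0 g2 this] show ?thesis by blast
      qed
      have base: "U \<epsilon> 0 (x + z) \<le> u0 x + L * \<rho>" if "ell 1 e z \<le> \<rho>\<^sup>2" for z
      proof -
        have "norm z \<le> \<rho>" using power2_le_imp_le[OF _ less_imp_le[OF \<rho>], of "norm z"] that by (simp only: ell1)
        then have "L * dist (x + z) x \<le> L * \<rho>" using L by (intro mult_left_mono) (auto simp: dist_norm)
        then show ?thesis using U_dist[OF \<epsilon>, of 0 "x + z" x] by simp
      qed
      have "real k * \<epsilon>\<^sup>2 * \<mu> \<le> \<sigma> * \<mu>" using k \<mu> by (intro mult_right_mono) auto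
      then have k': "2 * (real k * \<epsilon>\<^sup>2 * \<mu>) \<le> \<rho>\<^sup>2" using \<sigma> by linarith
      have "U \<epsilon> (k + 0) (x + 0) \<le> u0 x + L * \<rho>"
      proof (rule ell_survive[OF \<epsilon> e zero_less_one order_refl less_imp_le[OF \<mu>(1)] _ elim(3) step base k'])
        show "ell 1 e 0 \<le> \<rho>\<^sup>2 - real k * \<epsilon>\<^sup>2 * \<mu>"
          unfolding ell_zero using k' zero_le_power2[of \<rho>] by linarith
      qed (use elim(2) in auto)
      then show "U \<epsilon> k x \<le> u0 x + L * \<rho>" by simp
    qed
  qed
  then show thesis by (rule that[OF \<sigma>(1)])
qed

end

section \<open>Shortening a game\<close>

context curvature_game begin

text \<open>
  A finite \<open>\<delta>\<close>-net of \<open>B\<close> consists of fillable points, so that one time works for all of them; after reaching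
  \<open>{u0 < \<mu>}\<close> the minimiser idles, and the Lipschitz bound transfers the estimate to all points near \<open>B\<close>.
\<close>

lemma fill_bounded:
  assumes B: "bounded B" "B \<subseteq> fillable \<mu>" and \<delta>: "0 < \<delta>"
  obtains \<sigma>0 where "0 < \<sigma>0" "\<And>\<sigma>. 0 < \<sigma> \<Longrightarrow> \<sigma> \<le> \<sigma>0 \<Longrightarrow> \<forall>\<^sub>F \<epsilon> in at_right 0.
    \<forall>y. (\<exists>y'\<in>B. norm (y - y') \<le> 2 * \<delta>) \<longrightarrow> U \<epsilon> (steps \<sigma> \<epsilon>) y \<le> \<mu> + 4 * (L * \<delta>)"
proof -
  obtain \<sigma>0 where \<sigma>0: "0 < \<sigma>0"
    "\<forall>\<^sub>F \<epsilon> in at_right 0. \<forall>x k. real k * \<epsilon>\<^sup>2 \<le> \<sigma>0 \<longrightarrow> U \<epsilon> k x \<le> u0 x + L * \<delta>"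
    using idle_cost[OF \<delta>] by blast
  have "compact (closure B)" using B(1) by (simp add: compact_closure)
  moreover have "closure B \<subseteq> (\<Union>z\<in>B. ball z \<delta>)"
    using \<delta> by (auto simp: closure_approachable)
  ultimately obtain D where D: "D \<subseteq> B" "finite D" "closure B \<subseteq> (\<Union>z\<in>D. ball z \<delta>)"
    using compactE_image[of "closure B" B "\<lambda>z. ball z \<delta>"] by auto
  then have D: "finite D" "D \<subseteq> B" "B \<subseteq> (\<Union>z\<in>D. ball z \<delta>)" using closure_subset by blast+
  show thesis
  proof (rule that[OF \<sigma>0(1)])
    fix \<sigma> :: real assume \<sigma>: "0 < \<sigma>" "\<sigma> \<le> \<sigma>0"
    have "\<forall>\<^sub>F \<epsilon> in at_right 0. D \<subseteq> forces \<epsilon> {x. u0 x < \<mu>} (steps \<sigma> \<epsilon>)"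
      using D B(2) \<sigma>(1) by (intro compact_fillable_uniform finite_imp_compact) auto
    moreover have "\<forall>\<^sub>F \<epsilon> in at_right (0::real). 0 < \<epsilon> \<and> \<epsilon> < 1" by (rule eps_small) simp
    ultimately show "\<forall>\<^sub>F \<epsilon> in at_right 0.
      \<forall>y. (\<exists>y'\<in>B. norm (y - y') \<le> 2 * \<delta>) \<longrightarrow> U \<epsilon> (steps \<sigma> \<epsilon>) y \<le> \<mu> + 4 * (L * \<delta>)"
      using \<sigma>0(2)
    proof eventually_elim
      case (elim \<epsilon>)
      have \<epsilon>: "0 < \<epsilon>" "\<epsilon> < 1" using elim by auto
      show ?case
      proof (intro allI impI)
        fix y assume "\<exists>y'\<in>B. norm (y - y') \<le> 2 * \<delta>"
        then obtain y' where y': "y' \<in> B" "norm (y - y') \<le> 2 * \<delta>" by blast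
        then obtain z where z: "z \<in> D" "dist z y' < \<delta>" using D(3) by auto
        have "U \<epsilon> (steps \<sigma> \<epsilon>) z \<le> \<mu> + L * \<delta>"
        proof (rule U_le_on_forces[OF \<epsilon>])
          show "z \<in> forces \<epsilon> {x. u0 x < \<mu>} (steps \<sigma> \<epsilon>)" using z elim by blast
          show "steps \<sigma> \<epsilon> \<le> steps \<sigma> \<epsilon>" "steps \<sigma> \<epsilon> \<le> steps \<sigma> \<epsilon>" by auto
          fix a j assume aj: "a \<in> {x. u0 x < \<mu>}" "j \<le> steps \<sigma> \<epsilon>"
          have "real j * \<epsilon>\<^sup>2 \<le> \<sigma>" using aj(2) le_steps_iff[OF \<epsilon>(1), of \<sigma> j] \<sigma> by simp
          then have "U \<epsilon> j a \<le> u0 a + L * \<delta>" using elim(3) \<sigma>(2) by (meson order_trans)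
          then show "U \<epsilon> j a \<le> \<mu> + L * \<delta>" using aj(1) by simp
        qed
        moreover have "dist y z \<le> 3 * \<delta>"
          using y'(2) z(2) dist_triangle[of y z y'] by (simp add: dist_norm norm_minus_commute)
        then have "L * dist y z \<le> L * (3 * \<delta>)" using L by (intro mult_left_mono) auto
        moreover have "U \<epsilon> (steps \<sigma> \<epsilon>) y \<le> U \<epsilon> (steps \<sigma> \<epsilon>) z + L * dist y z"
          using U_dist[OF \<epsilon>, of "steps \<sigma> \<epsilon>" y z] by linarith
        ultimately show "U \<epsilon> (steps \<sigma> \<epsilon>) y \<le> \<mu> + 4 * (L * \<delta>)" by linarith
      qed
    qed
  qed
qed

text \<open>
  If a game of \<open>k\<close> steps is worth less than \<open>\<mu>\<close>, then so, essentially, is a game that performs only \<open>i \<le> k\<close> of these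
  steps and then has the short time \<open>\<sigma>\<close> left. While the position is within distance \<open>D\<close> of \<open>x0\<close>, the minimiser copies an
  optimal strategy of the long game. All positions then have value below \<open>\<mu>\<close>, so by the lower bound off the fillable
  set every jump stays inside that set, and the position remains in the convex region \<open>\<Gamma>\<close> visible from \<open>x0\<close>. If it
  gets farther away than \<open>D\<close>, the minimiser stops copying and waits inside a long ellipse that is close
  to \<open>\<Gamma>\<close>. In both cases the position ends near a bounded part of \<open>\<Gamma>\<close>, which can be filled in time \<open>\<sigma>\<close>.
\<close>

lemma value_truncation:
  assumes \<delta>: "0 < \<delta>" and H: "0 < H"
  obtains \<sigma>0 where "0 < \<sigma>0" "\<And>\<sigma>. 0 < \<sigma> \<Longrightarrow> \<sigma> \<le> \<sigma>0 \<Longrightarrow> \<forall>\<^sub>F \<epsilon> in at_right 0. \<forall>i k.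
    i \<le> k \<longrightarrow> real i * \<epsilon>\<^sup>2 \<le> H \<longrightarrow> U \<epsilon> k x0 < \<mu> - L * \<delta> \<longrightarrow> U \<epsilon> (i + steps \<sigma> \<epsilon>) x0 \<le> \<mu> + 4 * (L * \<delta>)"
proof (cases "x0 \<in> fillable \<mu>")
  case False
  have "\<forall>\<^sub>F \<epsilon> in at_right 0. \<forall>i k. i \<le> k \<longrightarrow> real i * \<epsilon>\<^sup>2 \<le> H \<longrightarrow> U \<epsilon> k x0 < \<mu> - L * \<delta> \<longrightarrow>
      U \<epsilon> (i + steps \<sigma> \<epsilon>) x0 \<le> \<mu> + 4 * (L * \<delta>)" for \<sigma>
    using max_jump_small[OF \<delta>] eps_small[OF zero_less_one]
  proof eventually_elim
    case (elim \<epsilon>)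
    have "x0 \<in> cball x0 (max_jump \<epsilon>)" using max_jump_nonneg by simp
    then have "\<not> cball x0 (max_jump \<epsilon>) \<subseteq> fillable \<mu>" using False by blast
    then have "\<mu> - L * max_jump \<epsilon> \<le> U \<epsilon> k x0" for k using U_ge_off_fillable elim by blast
    moreover have "L * max_jump \<epsilon> \<le> L * \<delta>" using elim L by simp
    ultimately have "\<not> U \<epsilon> k x0 < \<mu> - L * \<delta>" for k by (smt (verit))
    then show ?case by blast
  qed
  then show thesis using that[OF zero_less_one] by blast
next
  case True
  define \<Gamma> where "\<Gamma> = star_of (fillable \<mu>) x0"
  have conv: "convex \<Gamma>" unfolding \<Gamma>_def by (rule convex_star_of[OF open_fillable ball_closed_fillable])
  have x0: "x0 \<in> \<Gamma>" using True by (simp add: \<Gamma>_def star_of_def)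
  have \<Gamma>G: "\<Gamma> \<subseteq> fillable \<mu>" by (auto simp: \<Gamma>_def star_of_def)
  obtain A where A: "0 < A" "A \<le> 1"
    "\<forall>\<^sub>F \<epsilon> in at_right 0. \<forall>x e m c k. norm e = 1 \<longrightarrow> (\<forall>z. ell A e z \<le> \<delta>\<^sup>2 \<longrightarrow> U \<epsilon> m (x + z) \<le> c) \<longrightarrow>
       real k * \<epsilon>\<^sup>2 \<le> H \<longrightarrow> U \<epsilon> (k + m) x \<le> c"
    using ellipse_survival[OF \<delta> H] by blast
  \<comment> \<open>the long semi-axis of the ellipse\<close>
  define M where "M = \<delta> / sqrt A"
  have M: "0 < M" "A * M\<^sup>2 = \<delta>\<^sup>2" using A \<delta> by (simp_all add: M_def power_divide)
  obtain D where D: "0 < D" "\<And>x. x \<in> \<Gamma> \<Longrightarrow> D \<le> norm (x - x0) \<Longrightarrow>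
    \<exists>e. norm e = 1 \<and> (\<forall>t. \<bar>t\<bar> \<le> M \<longrightarrow> (\<exists>y\<in>\<Gamma>. norm (x + t *\<^sub>R e - y) \<le> \<delta>))"
    using convex_far_direction[OF conv x0 \<delta> M(1)] by blast
  define B where "B = \<Gamma> \<inter> cball x0 (D + 1 + M + \<delta>)"
  have "bounded B" "B \<subseteq> fillable \<mu>" using \<Gamma>G by (auto simp: B_def bounded_Int)
  then obtain \<sigma>0 where \<sigma>0: "0 < \<sigma>0" "\<And>\<sigma>. 0 < \<sigma> \<Longrightarrow> \<sigma> \<le> \<sigma>0 \<Longrightarrow> \<forall>\<^sub>F \<epsilon> in at_right 0.
    \<forall>y. (\<exists>y'\<in>B. norm (y - y') \<le> 2 * \<delta>) \<longrightarrow> U \<epsilon> (steps \<sigma> \<epsilon>) y \<le> \<mu> + 4 * (L * \<delta>)"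
    using fill_bounded[OF _ _ \<delta>] by blast
  show thesis
  proof (rule that[OF \<sigma>0(1)])
    fix \<sigma> :: real assume \<sigma>: "0 < \<sigma>" "\<sigma> \<le> \<sigma>0"
    have "\<forall>\<^sub>F \<epsilon> in at_right 0. max_jump \<epsilon> < min 1 \<delta>" by (rule max_jump_small) (use \<delta> in simp)
    moreover have "\<forall>\<^sub>F \<epsilon> in at_right (0::real). 0 < \<epsilon> \<and> \<epsilon> < 1" by (rule eps_small) simp
    ultimately show "\<forall>\<^sub>F \<epsilon> in at_right 0. \<forall>i k. i \<le> k \<longrightarrow> real i * \<epsilon>\<^sup>2 \<le> H \<longrightarrow> U \<epsilon> k x0 < \<mu> - L * \<delta> \<longrightarrow>
      U \<epsilon> (i + steps \<sigma> \<epsilon>) x0 \<le> \<mu> + 4 * (L * \<delta>)"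
      using \<sigma>0(2)[OF \<sigma>] A(3)
    proof eventually_elim
      case (elim \<epsilon>)
      have \<epsilon>: "0 < \<epsilon>" "\<epsilon> < 1" using elim by auto
      let ?m = "steps \<sigma> \<epsilon>" and ?c = "\<mu> + 4 * (L * \<delta>)"
      have "L * max_jump \<epsilon> \<le> L * \<delta>" using elim(1) L by simp
      then have inside: "cball q (max_jump \<epsilon>) \<subseteq> fillable \<mu>" if "U \<epsilon> j q < \<mu> - L * \<delta>" for j q
        using U_ge_off_fillable[OF \<epsilon>, of q \<mu> j] that by (smt (verit))
      have stay: "U \<epsilon> (i + ?m) q \<le> ?c"
        if "i \<le> j" "real i * \<epsilon>\<^sup>2 \<le> H" "U \<epsilon> j q < \<mu> - L * \<delta>" "q \<in> \<Gamma>" "norm (q - x0) \<le> D + 1" for i j q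
        using that
      proof (induction i arbitrary: j q)
        case 0
        then have "q \<in> B" using M(1) \<delta> by (simp add: B_def dist_norm norm_minus_commute)
        then have "\<exists>y'\<in>B. norm (q - y') \<le> 2 * \<delta>" using \<delta> by (intro bexI[of _ q]) auto
        then show ?case using elim(3) by simp
      next
        case (Suc i)
        show ?case
        proof (cases "D \<le> norm (q - x0)")
          case True
          from D(2)[OF Suc.prems(4) True] obtain e where e: "norm e = 1"
            "\<And>t. \<bar>t\<bar> \<le> M \<Longrightarrow> \<exists>y\<in>\<Gamma>. norm (q + t *\<^sub>R e - y) \<le> \<delta>" by blast
          have "U \<epsilon> ?m (q + z) \<le> ?c" if z: "ell A e z \<le> \<delta>\<^sup>2" for z
          proof -
            have "0 \<le> A * (e \<bullet> z)\<^sup>2" "0 \<le> (perp e \<bullet> z)\<^sup>2" using A by auto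
            then have "A * (e \<bullet> z)\<^sup>2 \<le> A * M\<^sup>2" "(perp e \<bullet> z)\<^sup>2 \<le> \<delta>\<^sup>2"
              using z M(2) unfolding ell_def by linarith+
            then have ez: "\<bar>e \<bullet> z\<bar> \<le> M" "\<bar>perp e \<bullet> z\<bar> \<le> \<delta>"
              using A M(1) \<delta> abs_le_square_iff[of "e \<bullet> z" M] abs_le_square_iff[of "perp e \<bullet> z" \<delta>] by auto
            obtain y where y: "y \<in> \<Gamma>" "norm (q + (e \<bullet> z) *\<^sub>R e - y) \<le> \<delta>" using e(2)[OF ez(1)] by blast
            have ze: "q + z = (q + (e \<bullet> z) *\<^sub>R e) + (perp e \<bullet> z) *\<^sub>R perp e"
              unfolding add.assoc by (rule arg_cong[OF orthonormal_expansion[OF e(1), of z]])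
            have "norm ((perp e \<bullet> z) *\<^sub>R perp e) \<le> \<delta>" using ez(2) e(1) by simp
            moreover have "(q + z) - y = (q + (e \<bullet> z) *\<^sub>R e - y) + (perp e \<bullet> z) *\<^sub>R perp e"
              unfolding ze by (simp only: add_diff_eq diff_add_eq)
            ultimately have near: "norm ((q + z) - y) \<le> 2 * \<delta>"
              using y(2) norm_triangle_ineq[of "q + (e \<bullet> z) *\<^sub>R e - y" "(perp e \<bullet> z) *\<^sub>R perp e"] by (simp only:)
            have "y - x0 = (q - x0) + ((e \<bullet> z) *\<^sub>R e - (q + (e \<bullet> z) *\<^sub>R e - y))" by simp
            then have "norm (y - x0) \<le> norm (q - x0) + norm ((e \<bullet> z) *\<^sub>R e - (q + (e \<bullet> z) *\<^sub>R e - y))"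
              by (metis norm_triangle_ineq)
            also have "\<dots> \<le> norm (q - x0) + (norm ((e \<bullet> z) *\<^sub>R e) + norm (q + (e \<bullet> z) *\<^sub>R e - y))"
              using norm_triangle_ineq4[of "(e \<bullet> z) *\<^sub>R e" "q + (e \<bullet> z) *\<^sub>R e - y"] by (rule add_left_mono)
            also have "\<dots> \<le> (D + 1) + (M + \<delta>)"
              using Suc.prems(5) ez(1) e(1) y(2) by (intro add_mono) simp_all
            finally have "y \<in> B" using y(1) by (simp add: B_def dist_norm norm_minus_commute)
            then show ?thesis using near elim(3) by blast
          qed
          then show ?thesis using elim(4) e(1) Suc.prems(2) by blast
        next
          case False
          obtain j' where j: "j = Suc j'" using Suc.prems(1) by (cases j) auto
          obtain v s where vs: "admissible \<epsilon> v s" "\<And>b \<beta>. b \<in> {-1, 1} \<Longrightarrow> \<beta> \<in> {-1, 1} \<Longrightarrow>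
              U \<epsilon> j' (q + jump \<epsilon> v s b \<beta>) \<le> U \<epsilon> (Suc j') q"
            using U_Suc_attained[OF \<epsilon>] by blast
          show ?thesis unfolding add_Suc
          proof (rule U_Suc_le[OF \<epsilon> vs(1)])
            fix b \<beta> :: real assume b: "b \<in> {-1, 1}" "\<beta> \<in> {-1, 1}"
            let ?q = "q + jump \<epsilon> v s b \<beta>"
            have jm: "norm (jump \<epsilon> v s b \<beta>) \<le> max_jump \<epsilon>" by (rule norm_jump_le[OF \<epsilon>(1) vs(1) b])
            show "U \<epsilon> (i + ?m) ?q \<le> ?c"
            proof (rule Suc.IH[of j'])
              show "i \<le> j'" using Suc.prems(1) j by simp
              have "real i * \<epsilon>\<^sup>2 \<le> real (Suc i) * \<epsilon>\<^sup>2" by (intro mult_right_mono) auto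
              then show "real i * \<epsilon>\<^sup>2 \<le> H" using Suc.prems(2) by linarith
              show "U \<epsilon> j' ?q < \<mu> - L * \<delta>" using vs(2)[OF b] Suc.prems(3) j by simp
              have "q \<in> cball q (max_jump \<epsilon>)" "?q \<in> cball q (max_jump \<epsilon>)"
                using jm max_jump_nonneg by (simp_all add: dist_norm)
              then have "closed_segment q ?q \<subseteq> cball q (max_jump \<epsilon>)"
                by (intro closed_segment_subset convex_cball)
              then have "closed_segment q ?q \<subseteq> fillable \<mu>" using inside[OF Suc.prems(3)] by blast
              then show "?q \<in> \<Gamma>" using Suc.prems(4) unfolding \<Gamma>_def star_of_def
                using ball_closed_segment_trans[OF open_fillable ball_closed_fillable, of x0 q \<mu> ?q] by blast
              have "norm (?q - x0) \<le> norm (q - x0) + norm (jump \<epsilon> v s b \<beta>)"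
                using norm_triangle_ineq[of "q - x0" "jump \<epsilon> v s b \<beta>"] by (simp add: algebra_simps)
              then show "norm (?q - x0) \<le> D + 1" using jm elim(1) False by linarith
            qed
          qed
        qed
      qed
      show ?case using stay[of _ _ x0] x0 D(1) by auto
    qed
  qed
qed

end

section \<open>The lower half-relaxed limit and its monotonicity in time\<close>

lemma eventually_half_relaxed_iff:
  "eventually P (half_relaxed_filter T (x, t)) \<longleftrightarrow>
    (\<exists>\<eta>>0. \<forall>\<epsilon> y s. 0 < \<epsilon> \<longrightarrow> \<epsilon> < \<eta> \<longrightarrow> dist y x < \<eta> \<longrightarrow> \<bar>s - t\<bar> < \<eta> \<longrightarrow> s \<in> time_grid T \<epsilon> \<longrightarrow> P ((y, s), \<epsilon>))"
  (is "?L \<longleftrightarrow> ?R")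
proof
  assume ?L
  then have "eventually (\<lambda>p. p \<in> {((y, s), \<epsilon>). s \<in> time_grid T \<epsilon>} \<longrightarrow> P p) ((nhds x \<times>\<^sub>F nhds t) \<times>\<^sub>F at_right 0)"
    by (simp add: half_relaxed_filter_def eventually_inf_principal nhds_prod)
  then obtain Q R where Q: "eventually Q (nhds x \<times>\<^sub>F nhds t)" and R: "eventually R (at_right (0::real))"
    and QR: "\<And>X \<epsilon>. Q X \<Longrightarrow> R \<epsilon> \<Longrightarrow> (X, \<epsilon>) \<in> {((y, s), \<epsilon>). s \<in> time_grid T \<epsilon>} \<longrightarrow> P (X, \<epsilon>)"
    unfolding eventually_prod_filter by blast
  obtain Q1 Q2 where "eventually Q1 (nhds x)" "eventually Q2 (nhds t)"
    and Q12: "\<And>y s. Q1 y \<Longrightarrow> Q2 s \<Longrightarrow> Q (y, s)"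
    using Q unfolding eventually_prod_filter by blast
  then obtain d1 d2 where d: "0 < d1" "\<And>y. dist y x < d1 \<Longrightarrow> Q1 y" "0 < d2" "\<And>s. dist s t < d2 \<Longrightarrow> Q2 s"
    unfolding eventually_nhds_metric by blast
  obtain d3 where d3: "0 < d3" "\<And>\<epsilon>. 0 < \<epsilon> \<Longrightarrow> \<epsilon> < d3 \<Longrightarrow> R \<epsilon>"
    using R unfolding eventually_at_right_field by blast
  show ?R
  proof (intro exI[of _ "min d1 (min d2 d3)"] conjI allI impI)
    fix \<epsilon> y s
    assume "0 < \<epsilon>" "\<epsilon> < min d1 (min d2 d3)" "dist y x < min d1 (min d2 d3)"
      "\<bar>s - t\<bar> < min d1 (min d2 d3)" "s \<in> time_grid T \<epsilon>"
    then show "P ((y, s), \<epsilon>)" using QR[OF Q12[OF d(2) d(4)] d3(2), of y s \<epsilon>] by (simp add: dist_real_def)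
  qed (use d d3 in auto)
next
  assume ?R
  then obtain \<eta> where \<eta>: "0 < \<eta>" "\<And>\<epsilon> y s. 0 < \<epsilon> \<Longrightarrow> \<epsilon> < \<eta> \<Longrightarrow> dist y x < \<eta> \<Longrightarrow> \<bar>s - t\<bar> < \<eta> \<Longrightarrow>
    s \<in> time_grid T \<epsilon> \<Longrightarrow> P ((y, s), \<epsilon>)" by blast
  have 1: "eventually (\<lambda>y. dist y x < \<eta>) (nhds x)" "eventually (\<lambda>s. \<bar>s - t\<bar> < \<eta>) (nhds t)"
    using \<eta>(1) by (auto simp: eventually_nhds_metric dist_real_def)
  have 2: "eventually (\<lambda>\<epsilon>. 0 < \<epsilon> \<and> \<epsilon> < \<eta>) (at_right (0::real))"
    using \<eta>(1) unfolding eventually_at_right_field by auto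
  have "eventually (\<lambda>X. dist (fst X) x < \<eta> \<and> \<bar>snd X - t\<bar> < \<eta>) (nhds x \<times>\<^sub>F nhds t)"
    unfolding eventually_prod_filter using 1 by fastforce
  then have "eventually (\<lambda>p. (dist (fst (fst p)) x < \<eta> \<and> \<bar>snd (fst p) - t\<bar> < \<eta>) \<and> 0 < snd p \<and> snd p < \<eta>)
      ((nhds x \<times>\<^sub>F nhds t) \<times>\<^sub>F at_right 0)"
    unfolding eventually_prod_filter[of _ "nhds x \<times>\<^sub>F nhds t"] using 2 by fastforce
  then have "eventually (\<lambda>p. p \<in> {((y, s), \<epsilon>). s \<in> time_grid T \<epsilon>} \<longrightarrow> P p) ((nhds x \<times>\<^sub>F nhds t) \<times>\<^sub>F at_right 0)"
    by eventually_elim (use \<eta>(2) in auto)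
  then show ?L by (simp add: half_relaxed_filter_def eventually_inf_principal nhds_prod)
qed

locale terminal_value_game = curvature_game +
  fixes T :: real
  assumes T: "0 < T" and bnd: "\<And>x. \<bar>u0 x\<bar> \<le> 1"
begin

abbreviation low :: "(real^2) \<times> real \<Rightarrow> real" where
  "low \<equiv> lower_half_relaxed \<gamma> \<alpha>1 \<alpha>2 T u0"

lemma low_Liminf:
  assumes "0 < t" "t < T"
  shows "ereal (low (x, t)) =
     Liminf (half_relaxed_filter T (x, t)) (\<lambda>((y, s), \<epsilon>). ereal (value_fn \<gamma> \<alpha>1 \<alpha>2 T u0 \<epsilon> y s))"
  by (rule lower_half_relaxed_finite[OF lip \<alpha>1(1) \<alpha>2(1) bnd assms])

lemma less_lowD:
  assumes t: "0 < t" "t < T" and a: "a < low (x, t)"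
  obtains \<eta> where "0 < \<eta>" "\<And>\<epsilon> y k. 0 < \<epsilon> \<Longrightarrow> \<epsilon> < \<eta> \<Longrightarrow> dist y x < \<eta> \<Longrightarrow>
    \<bar>T - real k * \<epsilon>\<^sup>2 - t\<bar> < \<eta> \<Longrightarrow> 0 \<le> T - real k * \<epsilon>\<^sup>2 \<Longrightarrow> a < U \<epsilon> k y"
proof -
  have "ereal a < Liminf (half_relaxed_filter T (x, t)) (\<lambda>((y, s), \<epsilon>). ereal (value_fn \<gamma> \<alpha>1 \<alpha>2 T u0 \<epsilon> y s))"
    unfolding low_Liminf[OF t, symmetric] using a by simp
  then have "\<forall>\<^sub>F p in half_relaxed_filter T (x, t). ereal a < (\<lambda>((y, s), \<epsilon>). ereal (value_fn \<gamma> \<alpha>1 \<alpha>2 T u0 \<epsilon> y s)) p"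
    by (rule less_LiminfD)
  then obtain \<eta> where \<eta>: "0 < \<eta>" "\<And>\<epsilon> y s. 0 < \<epsilon> \<Longrightarrow> \<epsilon> < \<eta> \<Longrightarrow> dist y x < \<eta> \<Longrightarrow> \<bar>s - t\<bar> < \<eta> \<Longrightarrow>
    s \<in> time_grid T \<epsilon> \<Longrightarrow> a < value_fn \<gamma> \<alpha>1 \<alpha>2 T u0 \<epsilon> y s"
    unfolding eventually_half_relaxed_iff by auto
  show thesis
  proof (rule that[OF \<eta>(1)])
    fix \<epsilon> y k
    assume H: "0 < \<epsilon>" "\<epsilon> < \<eta>" "dist y x < \<eta>" "\<bar>T - real k * \<epsilon>\<^sup>2 - t\<bar> < \<eta>" "0 \<le> T - real k * \<epsilon>\<^sup>2"
    have "T - real k * \<epsilon>\<^sup>2 \<in> time_grid T \<epsilon>" using H(5) by (auto simp: time_grid_def)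
    from \<eta>(2)[OF H(1-4) this] show "a < U \<epsilon> k y" using H(1) by (simp add: value_fn_grid)
  qed
qed

lemma le_lowI:
  assumes t: "0 < t" "t < T" and \<eta>: "0 < \<eta>" and ge: "\<And>\<epsilon> y k. 0 < \<epsilon> \<Longrightarrow> \<epsilon> < \<eta> \<Longrightarrow> dist y x < \<eta> \<Longrightarrow>
    \<bar>T - real k * \<epsilon>\<^sup>2 - t\<bar> < \<eta> \<Longrightarrow> 0 \<le> T - real k * \<epsilon>\<^sup>2 \<Longrightarrow> a \<le> U \<epsilon> k y"
  shows "a \<le> low (x, t)"
proof -
  have "\<forall>\<^sub>F p in half_relaxed_filter T (x, t). ereal a \<le> (\<lambda>((y, s), \<epsilon>). ereal (value_fn \<gamma> \<alpha>1 \<alpha>2 T u0 \<epsilon> y s)) p"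
    unfolding eventually_half_relaxed_iff
  proof (intro exI[of _ \<eta>] conjI allI impI \<eta>)
    fix \<epsilon> y s
    assume H: "0 < \<epsilon>" "\<epsilon> < \<eta>" "dist y x < \<eta>" "\<bar>s - t\<bar> < \<eta>" "s \<in> time_grid T \<epsilon>"
    then obtain k where k: "s = T - real k * \<epsilon>\<^sup>2" "0 \<le> s" by (auto simp: time_grid_def)
    have "a \<le> U \<epsilon> k y" using ge[of \<epsilon> y k] H k by simp
    then show "ereal a \<le> (\<lambda>((y, s), \<epsilon>). ereal (value_fn \<gamma> \<alpha>1 \<alpha>2 T u0 \<epsilon> y s)) ((y, s), \<epsilon>)"
      using H(1) by (simp add: k(1) value_fn_grid)
  qed
  then have "ereal a \<le> Liminf (half_relaxed_filter T (x, t)) (\<lambda>((y, s), \<epsilon>). ereal (value_fn \<gamma> \<alpha>1 \<alpha>2 T u0 \<epsilon> y s))"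
    by (rule Liminf_bounded)
  then show ?thesis unfolding low_Liminf[OF t, symmetric] by simp
qed

lemma low_semicontinuous: "lower_semicontinuous_on (UNIV \<times> {0<..<T}) low"
  unfolding lower_semicontinuous_on_def
proof (intro ballI allI impI)
  fix X :: "(real^2) \<times> real" and a assume X: "X \<in> UNIV \<times> {0<..<T}" and a: "a < low X"
  obtain x t where xt: "X = (x, t)" "0 < t" "t < T" using X by auto
  obtain a' where a': "a < a'" "a' < low (x, t)" using a xt(1) dense by auto
  obtain \<eta> where \<eta>: "0 < \<eta>" "\<And>\<epsilon> y k. 0 < \<epsilon> \<Longrightarrow> \<epsilon> < \<eta> \<Longrightarrow> dist y x < \<eta> \<Longrightarrow>
    \<bar>T - real k * \<epsilon>\<^sup>2 - t\<bar> < \<eta> \<Longrightarrow> 0 \<le> T - real k * \<epsilon>\<^sup>2 \<Longrightarrow> a' < U \<epsilon> k y"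
    using less_lowD[OF xt(2,3) a'(2)] by blast
  show "\<forall>\<^sub>F Y in at X within UNIV \<times> {0<..<T}. a < low Y"
    unfolding eventually_at
  proof (intro exI[of _ "\<eta> / 2"] conjI ballI impI)
    fix Y :: "(real^2) \<times> real" assume Y: "Y \<in> UNIV \<times> {0<..<T}" "Y \<noteq> X \<and> dist Y X < \<eta> / 2"
    obtain y s where ys: "Y = (y, s)" "0 < s" "s < T" using Y by auto
    have d: "dist y x < \<eta> / 2" "\<bar>s - t\<bar> < \<eta> / 2"
      using Y(2) dist_fst_le[of Y X] dist_snd_le[of Y X] by (auto simp: ys xt dist_real_def)
    have "a' \<le> low (y, s)"
    proof (rule le_lowI[OF ys(2,3), of "\<eta> / 2"])
      fix \<epsilon> y' k
      assume H: "0 < \<epsilon>" "\<epsilon> < \<eta> / 2" "dist y' y < \<eta> / 2" "\<bar>T - real k * \<epsilon>\<^sup>2 - s\<bar> < \<eta> / 2"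
        "0 \<le> T - real k * \<epsilon>\<^sup>2"
      have "\<epsilon> < \<eta>" "dist y' x < \<eta>" "\<bar>T - real k * \<epsilon>\<^sup>2 - t\<bar> < \<eta>"
        using H d dist_triangle[of y' x y] \<eta>(1) by linarith+
      from \<eta>(2)[OF H(1) this H(5)] show "a' \<le> U \<epsilon> k y'" by simp
    qed (use \<eta> in simp)
    then show "a < low Y" using a' ys by simp
  qed (use \<eta> in simp)
qed

text \<open>
  A value below \<open>\<nu>\<close> near \<open>(x0, t)\<close> comes from a game with \<open>k\<close> steps. The game started at time \<open>t' > t\<close> has only \<open>n \<le> k\<close>
  steps; truncating after \<open>n - steps \<sigma> \<epsilon>\<close> steps leaves exactly the time needed for filling.
\<close>

lemma low_antimono:
  assumes t: "0 < t" "t < t'" "t' < T"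
  shows "low (x0, t') \<le> low (x0, t)"
proof (rule dense_ge)
  fix \<nu> assume \<nu>: "low (x0, t) < \<nu>"
  show "low (x0, t') \<le> \<nu>"
  proof (rule dense_ge)
    fix c assume c: "\<nu> < c"
    define \<delta> where "\<delta> = (c - \<nu>) / (8 * L)"
    have \<delta>: "0 < \<delta>" "8 * (L * \<delta>) = c - \<nu>" using c L by (simp_all add: \<delta>_def)
    define \<mu> where "\<mu> = \<nu> + 2 * (L * \<delta>)"
    have L\<delta>: "0 < L * \<delta>" using L \<delta> by simp
    obtain \<sigma>0 where \<sigma>0: "0 < \<sigma>0" "\<And>\<sigma>. 0 < \<sigma> \<Longrightarrow> \<sigma> \<le> \<sigma>0 \<Longrightarrow> \<forall>\<^sub>F \<epsilon> in at_right 0. \<forall>i k.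
      i \<le> k \<longrightarrow> real i * \<epsilon>\<^sup>2 \<le> T \<longrightarrow> U \<epsilon> k x0 < \<mu> - L * \<delta> \<longrightarrow> U \<epsilon> (i + steps \<sigma> \<epsilon>) x0 \<le> \<mu> + 4 * (L * \<delta>)"
      using value_truncation[OF \<delta>(1) T, of x0 \<mu>] by blast
    define \<sigma> where "\<sigma> = min \<sigma>0 ((T - t') / 2)"
    have \<sigma>: "0 < \<sigma>" "\<sigma> \<le> \<sigma>0" "2 * \<sigma> \<le> T - t'"
    proof -
      have "\<sigma> \<le> (T - t') / 2" unfolding \<sigma>_def by (rule min.cobounded2)
      then show "2 * \<sigma> \<le> T - t'" by simp
    qed (use \<sigma>0(1) t in \<open>simp_all add: \<sigma>_def\<close>)
    obtain \<eta>1 where \<eta>1: "0 < \<eta>1" "\<And>\<epsilon> i k. 0 < \<epsilon> \<Longrightarrow> \<epsilon> < \<eta>1 \<Longrightarrow>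
      i \<le> k \<Longrightarrow> real i * \<epsilon>\<^sup>2 \<le> T \<Longrightarrow> U \<epsilon> k x0 < \<mu> - L * \<delta> \<Longrightarrow> U \<epsilon> (i + steps \<sigma> \<epsilon>) x0 \<le> \<mu> + 4 * (L * \<delta>)"
      using \<sigma>0(2)[OF \<sigma>(1,2)] unfolding eventually_at_right_field by blast
    show "low (x0, t') \<le> c"
    proof (rule ccontr)
      assume "\<not> low (x0, t') \<le> c"
      then have "c < low (x0, t')" by simp
      then obtain \<eta>2 where \<eta>2: "0 < \<eta>2" "\<And>\<epsilon> y k. 0 < \<epsilon> \<Longrightarrow> \<epsilon> < \<eta>2 \<Longrightarrow> dist y x0 < \<eta>2 \<Longrightarrow>
          \<bar>T - real k * \<epsilon>\<^sup>2 - t'\<bar> < \<eta>2 \<Longrightarrow> 0 \<le> T - real k * \<epsilon>\<^sup>2 \<Longrightarrow> c < U \<epsilon> k y"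
        using less_lowD[OF less_trans[OF t(1,2)] t(3)] by blast
      define \<eta> where "\<eta> = Min {\<eta>1, \<eta>2, 1, \<delta>, t' - t}"
      have \<eta>: "0 < \<eta>" "\<eta> \<le> \<eta>1" "\<eta> \<le> \<eta>2" "\<eta> \<le> 1" "\<eta> \<le> \<delta>" "\<eta> \<le> t' - t"
        using \<eta>1(1) \<eta>2(1) \<delta>(1) t by (simp_all add: \<eta>_def)
      have "\<exists>\<epsilon> y k. 0 < \<epsilon> \<and> \<epsilon> < \<eta> \<and> dist y x0 < \<eta> \<and> \<bar>T - real k * \<epsilon>\<^sup>2 - t\<bar> < \<eta> \<and>
          0 \<le> T - real k * \<epsilon>\<^sup>2 \<and> U \<epsilon> k y < \<nu>"
      proof (rule ccontr)
        assume no: "\<not> ?thesis"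
        have "\<nu> \<le> low (x0, t)"
        proof (rule le_lowI[OF t(1) _ \<eta>(1)])
          show "t < T" using t by simp
          fix \<epsilon> y k assume "0 < \<epsilon>" "\<epsilon> < \<eta>" "dist y x0 < \<eta>" "\<bar>T - real k * \<epsilon>\<^sup>2 - t\<bar> < \<eta>" "0 \<le> T - real k * \<epsilon>\<^sup>2"
          then have "\<not> U \<epsilon> k y < \<nu>" using no by blast
          then show "\<nu> \<le> U \<epsilon> k y" by simp
        qed
        then show False using \<nu> by simp
      qed
      then obtain \<epsilon> y k where H: "0 < \<epsilon>" "\<epsilon> < \<eta>" "dist y x0 < \<eta>" "\<bar>T - real k * \<epsilon>\<^sup>2 - t\<bar> < \<eta>"
        "0 \<le> T - real k * \<epsilon>\<^sup>2" "U \<epsilon> k y < \<nu>" by blast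
      have \<epsilon>1: "\<epsilon> < 1" using H \<eta> by linarith
      have \<epsilon>2: "\<epsilon>\<^sup>2 \<le> \<epsilon>" "0 < \<epsilon>\<^sup>2" using H(1) \<epsilon>1 by (simp_all add: power2_eq_square mult_le_cancel_left1)
      have "L * dist x0 y \<le> L * \<delta>" using H(3) \<eta>(5) L by (simp add: dist_commute)
      then have Ux0: "U \<epsilon> k x0 < \<mu> - L * \<delta>"
        using U_dist[OF H(1) \<epsilon>1, of k x0 y] H(6) by (simp add: \<mu>_def)
      define n where "n = steps (T - t') \<epsilon>"
      have n: "real n * \<epsilon>\<^sup>2 \<le> T - t'" "T - t' < real n * \<epsilon>\<^sup>2 + \<epsilon>\<^sup>2"
        unfolding n_def using steps_le[OF H(1), of "T - t'"] steps_gt[OF H(1), of "T - t'"] t(3)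
        by (simp_all only: distrib_right mult_1 diff_ge_0_iff_ge less_imp_le)
      have m: "real (steps \<sigma> \<epsilon>) * \<epsilon>\<^sup>2 \<le> \<sigma>" using steps_le[OF H(1), of \<sigma>] \<sigma> by simp
      have mn: "steps \<sigma> \<epsilon> \<le> n"
      proof -
        have "real (steps \<sigma> \<epsilon>) * \<epsilon>\<^sup>2 \<le> T - t'" using m \<sigma>(1,3) by linarith
        then show ?thesis unfolding n_def using le_steps_iff[OF H(1), of "T - t'"] t by simp
      qed
      have nk: "n \<le> k"
      proof -
        have "real n * \<epsilon>\<^sup>2 \<le> real k * \<epsilon>\<^sup>2" using n(1) H(4) \<eta>(6) by linarith
        then show ?thesis using \<epsilon>2(2) by simp
      qed
      have "\<epsilon> < \<eta>1" using H \<eta> by linarith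
      moreover have "n - steps \<sigma> \<epsilon> \<le> k" using nk by simp
      moreover have "real (n - steps \<sigma> \<epsilon>) * \<epsilon>\<^sup>2 \<le> T"
      proof -
        have "real (n - steps \<sigma> \<epsilon>) * \<epsilon>\<^sup>2 \<le> real n * \<epsilon>\<^sup>2" by (intro mult_right_mono) auto
        then show ?thesis using n(1) t by linarith
      qed
      ultimately have "U \<epsilon> ((n - steps \<sigma> \<epsilon>) + steps \<sigma> \<epsilon>) x0 \<le> \<mu> + 4 * (L * \<delta>)"
        by (rule \<eta>1(2)[OF H(1) _ _ _ Ux0])
      then have "U \<epsilon> n x0 \<le> \<mu> + 4 * (L * \<delta>)" using mn by simp
      moreover have "c < U \<epsilon> n x0"
      proof -
        have "\<epsilon> < \<eta>2" using H \<eta> by linarith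
        moreover have "dist x0 x0 < \<eta>2" using \<eta>2(1) by simp
        moreover have "\<bar>T - real n * \<epsilon>\<^sup>2 - t'\<bar> < \<eta>2" using n \<epsilon>2 H(2) \<eta>(3) by linarith
        moreover have "0 \<le> T - real n * \<epsilon>\<^sup>2" using n(1) t by linarith
        ultimately show ?thesis by (rule \<eta>2(2)[OF H(1)])
      qed
      ultimately show False using \<delta>(2) L\<delta> unfolding \<mu>_def by linarith
    qed
  qed
qed

end

section \<open>Quadratic test functions\<close>

text \<open>
  The inequality \<open>a powr (1 - \<gamma>) * b powr \<gamma> \<le> (1 - \<gamma>) a + \<gamma> b\<close>, applied to multiples of the two terms on the right-hand
  side. The exponent of \<open>s\<close> in \<open>game_f\<close> makes the powers of \<open>s\<close> cancel, and \<open>game_c\<close> is the constant for which the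
  minimum over \<open>s\<close> of the right-hand side is the left-hand side.
\<close>

lemma game_f_Young:
  assumes \<gamma>: "0 < \<gamma>" "\<gamma> < 1" and s: "0 < s" and P: "0 < P" and k: "0 < k"
  shows "P powr (1 - \<gamma>) * k powr \<gamma> \<le> P * game_f \<gamma> s + s\<^sup>2 * k / 2"
proof -
  define a where "a = P * game_f \<gamma> s / (1 - \<gamma>)"
  define b where "b = s\<^sup>2 * k / (2 * \<gamma>)"
  have f: "game_f \<gamma> s / (1 - \<gamma>) = (2 * \<gamma>) powr (\<gamma> / (1 - \<gamma>)) * s powr (2 * \<gamma> / (\<gamma> - 1))"
    using \<gamma> by (simp add: game_f_def game_c_def)
  have a: "0 < a" using \<gamma> s P game_c_pos[OF \<gamma>] by (simp add: a_def game_f_def)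
  have b: "0 < b" using \<gamma> s k by (simp add: b_def)
  have "a powr (1 - \<gamma>) * b powr \<gamma> \<le> (1 - \<gamma>) * a + \<gamma> * b"
    using Youngs_inequality_0[of "1 - \<gamma>" \<gamma> a b] \<gamma> a b by simp
  also have "\<dots> = P * game_f \<gamma> s + s\<^sup>2 * k / 2"
    using \<gamma> by (simp add: a_def b_def)
  finally have le: "a powr (1 - \<gamma>) * b powr \<gamma> \<le> P * game_f \<gamma> s + s\<^sup>2 * k / 2" .
  have av: "a powr (1 - \<gamma>) = P powr (1 - \<gamma>) * ((2 * \<gamma>) powr \<gamma> * s powr (- (2 * \<gamma>)))"
  proof -
    have "2 * \<gamma> / (\<gamma> - 1) * (1 - \<gamma>) = - (2 * \<gamma> / (\<gamma> - 1) * (\<gamma> - 1))"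
      by (simp only: mult_minus_right[symmetric] minus_diff_eq)
    also have "\<dots> = - (2 * \<gamma>)" using \<gamma> by simp
    finally have 2: "2 * \<gamma> / (\<gamma> - 1) * (1 - \<gamma>) = - (2 * \<gamma>)" .
    have 1: "\<gamma> / (1 - \<gamma>) * (1 - \<gamma>) = \<gamma>" using \<gamma> by simp
    have "a = P * (game_f \<gamma> s / (1 - \<gamma>))" by (simp add: a_def)
    then have a': "a = P * ((2 * \<gamma>) powr (\<gamma> / (1 - \<gamma>)) * s powr (2 * \<gamma> / (\<gamma> - 1)))"
      unfolding f .
    have "a powr (1 - \<gamma>) = P powr (1 - \<gamma>) *
        (((2 * \<gamma>) powr (\<gamma> / (1 - \<gamma>))) powr (1 - \<gamma>) * (s powr (2 * \<gamma> / (\<gamma> - 1))) powr (1 - \<gamma>))"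
      unfolding a' by (simp only: powr_mult)
    then show ?thesis unfolding powr_powr 1 2 .
  qed
  have bv: "b powr \<gamma> = s powr (2 * \<gamma>) * k powr \<gamma> * (2 * \<gamma>) powr (- \<gamma>)"
  proof -
    have "s\<^sup>2 powr \<gamma> = s powr (2 * \<gamma>)" using s powr_powr[of s 2 \<gamma>] by simp
    moreover have "b = (s\<^sup>2 * k) * inverse (2 * \<gamma>)" unfolding b_def by (rule divide_inverse)
    moreover have "inverse (2 * \<gamma>) powr \<gamma> = (2 * \<gamma>) powr (- \<gamma>)"
      by (simp only: powr_minus inverse_powr)
    ultimately show ?thesis by (simp only: powr_mult)
  qed
  have one: "(2 * \<gamma>) powr \<gamma> * (2 * \<gamma>) powr (- \<gamma>) = 1" "s powr (- (2 * \<gamma>)) * s powr (2 * \<gamma>) = 1"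
    unfolding powr_add[symmetric] using \<gamma> s by simp_all
  have rearrange: "p * (A * B) * (D * E * C) = p * E * (A * C) * (B * D)" for p A B C D E :: real
    by (simp add: algebra_simps)
  have "a powr (1 - \<gamma>) * b powr \<gamma> = P powr (1 - \<gamma>) * ((2 * \<gamma>) powr \<gamma> * s powr (- (2 * \<gamma>))) *
      (s powr (2 * \<gamma>) * k powr \<gamma> * (2 * \<gamma>) powr (- \<gamma>))"
    by (rule arg_cong2[where f = "(*)", OF av bv])
  also have "\<dots> = P powr (1 - \<gamma>) * k powr \<gamma> * ((2 * \<gamma>) powr \<gamma> * (2 * \<gamma>) powr (- \<gamma>)) *
      (s powr (- (2 * \<gamma>)) * s powr (2 * \<gamma>))"
    by (rule rearrange)
  also have "\<dots> = P powr (1 - \<gamma>) * k powr \<gamma>"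
    by (simp only: one mult_1_right)
  finally show ?thesis using le by (simp only:)
qed

lemma game_f_unbounded:
  assumes \<gamma>: "0 < \<gamma>" "\<gamma> < 1"
  obtains s where "0 < s" "s \<le> 1" "K \<le> game_f \<gamma> s"
proof -
  define K' where "K' = max (K / game_c \<gamma>) 1"
  define q where "q = (\<gamma> - 1) / (2 * \<gamma>)"
  have q: "q < 0" using \<gamma> by (simp add: q_def divide_neg_pos)
  have K'1: "1 \<le> K'" by (simp add: K'_def)
  have q1: "q * (2 * \<gamma> / (\<gamma> - 1)) = 1" using \<gamma> by (simp add: q_def)
  have "game_f \<gamma> (K' powr q) = game_c \<gamma> * K'"
    unfolding game_f_def powr_powr q1 using K'1 by simp
  moreover have "K \<le> game_c \<gamma> * K'"
  proof -
    have "K / game_c \<gamma> \<le> K'" by (simp add: K'_def)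
    then show ?thesis using game_c_pos[OF \<gamma>] by (simp add: field_simps)
  qed
  moreover have "K' powr q \<le> 1"
    using powr_mono[of q 0 K'] q K'1 by simp
  moreover have "0 < K' powr q" using K'1 by simp
  ultimately show thesis using that[of "K' powr q"] by simp
qed

context curvature_game begin

text \<open>
  The step estimate in the orthonormal frame given by the gradient and the tangent: \<open>P\<close> is the length of the gradient,
  \<open>(x, y)\<close> are the components of the direction \<open>v\<close> along the gradient and the tangent, and \<open>b11\<close>, \<open>b12\<close>, \<open>b22\<close> are the
  entries of the Hessian, so that \<open>b22\<close> is its value on the tangent. The maximiser chooses \<open>\<beta>\<close> so that the normal
  displacement \<open>F = \<epsilon>\<^sup>2 f\<close> goes uphill, and then \<open>b\<close> so that all terms linear in \<open>b\<close> together are nonnegative. If \<open>\<bar>x\<bar>\<close> is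
  large, the first order term \<open>P \<epsilon> s \<bar>x\<bar>\<close> dominates everything, because \<open>s \<ge> \<epsilon> powr \<alpha>1\<close> and \<open>\<alpha>1 < 1\<close> make it much
  larger than \<open>\<epsilon>\<^sup>2\<close>. If \<open>\<bar>x\<bar>\<close> is at most one half and \<open>s\<close> is small, then \<open>f s\<close> is huge and wins. In the remaining case the
  errors caused by \<open>x \<noteq> 0\<close> are proportional to \<open>\<bar>x\<bar>\<close> and absorbed by the first order term; what is left is Young's
  inequality. A small fraction \<open>\<zeta>\<close> of the term in \<open>f\<close> is set aside to pay for the Hessian term in \<open>F\<^sup>2\<close>.
\<close>

lemma quadratic_game_frame:
  assumes P0: "0 < P0" and k0: "0 < k0" and C: "0 < C"
    and pos: "0 < a + P0 powr (1 - \<gamma>) * k0 powr \<gamma>"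
  shows "\<forall>\<^sub>F \<epsilon> in at_right 0. \<forall>P x y s b11 b12 b22. P0 \<le> P \<longrightarrow> x\<^sup>2 + y\<^sup>2 = 1 \<longrightarrow> s \<in> step_range \<alpha>1 \<alpha>2 \<epsilon> \<longrightarrow>
    \<bar>b11\<bar> \<le> C \<longrightarrow> \<bar>b12\<bar> \<le> C \<longrightarrow> \<bar>b22\<bar> \<le> C \<longrightarrow> k0 \<le> b22 \<longrightarrow>
    (\<exists>b\<in>{-1, 1}. \<exists>\<beta>\<in>{-1, 1}.
      0 < P * (b * (\<epsilon> * s) * x - \<beta> * (\<epsilon>\<^sup>2 * game_f \<gamma> s) * y)
        + ((\<epsilon> * s)\<^sup>2 * (x\<^sup>2 * b11 + 2 * (x * y) * b12 + y\<^sup>2 * b22)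
          + 2 * (b * (\<epsilon> * s)) * (\<beta> * (\<epsilon>\<^sup>2 * game_f \<gamma> s)) * (x * y * (b22 - b11) + (x\<^sup>2 - y\<^sup>2) * b12)
          + (\<epsilon>\<^sup>2 * game_f \<gamma> s)\<^sup>2 * (y\<^sup>2 * b11 - 2 * (x * y) * b12 + x\<^sup>2 * b22)) / 2
        + a * \<epsilon>\<^sup>2)"
proof -
  define m where "m = P0 powr (1 - \<gamma>) * k0 powr \<gamma>"
  have m: "0 < m" using P0 k0 by (simp add: m_def)
  define d where "d = a + m"
  have d: "0 < d" using pos by (simp add: d_def m_def)
  define \<zeta> where "\<zeta> = min (1/2) (d / (4 * m))"
  have \<zeta>: "0 < \<zeta>" "\<zeta> \<le> 1/2" "4 * (\<zeta> * m) \<le> d"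
  proof -
    have "\<zeta> \<le> d / (4 * m)" by (simp add: \<zeta>_def)
    then show "4 * (\<zeta> * m) \<le> d" using m by (simp add: field_simps)
  qed (use d m in \<open>auto simp: \<zeta>_def\<close>)
  define C' where "C' = k0 + 3 * C"
  have C': "0 < C'" using k0 C by (simp add: C'_def)
  obtain s1 where s1: "0 < s1" "s1 \<le> 1" "4 * (C + \<bar>a\<bar> + 1) / P0 \<le> game_f \<gamma> s1"
    using game_f_unbounded[OF \<gamma>] by blast
  define f1 where "f1 = game_f \<gamma> s1"
  have f1: "0 < f1" "4 * (C + \<bar>a\<bar> + 1) \<le> P0 * f1"
  proof -
    have "0 < 4 * (C + \<bar>a\<bar> + 1) / P0" using C P0 by (intro divide_pos_pos) auto
    then show "0 < f1" using s1(3) by (simp add: f1_def)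
    show "4 * (C + \<bar>a\<bar> + 1) \<le> P0 * f1" using s1(3) P0 by (simp add: f1_def field_simps)
  qed
  define h where "h = Min {\<zeta> * P0 / (2 * C), P0 / (8 * C), P0 / C', d / (8 * C * f1)}"
  have h: "0 < h" "2 * (C * h) \<le> \<zeta> * P0" "8 * (C * h) \<le> P0" "C' * h \<le> P0" "8 * (C * f1 * h) \<le> d"
  proof -
    show "0 < h" using \<zeta> P0 C C' d f1 by (simp add: h_def)
    have "h \<le> \<zeta> * P0 / (2 * C)" "h \<le> P0 / (8 * C)" "h \<le> P0 / C'" "h \<le> d / (8 * C * f1)"
      unfolding h_def by (auto intro!: Min_le)
    then show "2 * (C * h) \<le> \<zeta> * P0" "8 * (C * h) \<le> P0" "C' * h \<le> P0" "8 * (C * f1 * h) \<le> d"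
      using C C' f1 by (simp_all add: pos_le_divide_eq mult.commute mult.left_commute)
  qed
  have "((\<lambda>\<epsilon>. \<epsilon> powr (1 - \<alpha>1)) \<longlongrightarrow> 0) (at_right 0)" using \<alpha>1 by (intro powr_tendsto_0_at_right) simp
  then have "\<forall>\<^sub>F \<epsilon> in at_right 0. \<epsilon> powr (1 - \<alpha>1) < P0 / (8 * (\<bar>a\<bar> + 1))"
    using P0 by (intro order_tendstoD(2)) auto
  moreover have "\<forall>\<^sub>F \<epsilon> in at_right 0. max_jump \<epsilon> < h" by (rule max_jump_small[OF h(1)])
  moreover have "\<forall>\<^sub>F \<epsilon> in at_right 0. 0 < \<epsilon> \<and> \<epsilon> < min 1 (s1 / (2 * f1))" by (rule eps_small) (use s1 f1 in simp)
  ultimately show ?thesis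
  proof eventually_elim
    case (elim \<epsilon>)
    have \<epsilon>: "0 < \<epsilon>" "\<epsilon> < 1" "2 * (\<epsilon> * f1) \<le> s1" using elim(3) f1 by (simp_all add: field_simps)
    show ?case
    proof (intro allI impI)
      fix P x y s b11 b12 b22 :: real
      assume P: "P0 \<le> P" and xy: "x\<^sup>2 + y\<^sup>2 = 1" and s: "s \<in> step_range \<alpha>1 \<alpha>2 \<epsilon>"
        and b: "\<bar>b11\<bar> \<le> C" "\<bar>b12\<bar> \<le> C" "\<bar>b22\<bar> \<le> C" "k0 \<le> b22"
      define f where "f = game_f \<gamma> s"
      define E where "E = \<epsilon> * s"
      define F where "F = \<epsilon>\<^sup>2 * f"
      note sb = step_bounds[OF \<epsilon>(1) s]
      have s0: "0 < s" by (rule sb(1))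
      have f0: "0 \<le> f" unfolding f_def by (rule game_f_nonneg[OF \<gamma>])
      have cf: "0 \<le> game_c \<gamma> * \<epsilon> powr (2 - \<alpha>1 * (2 * \<gamma> / (1 - \<gamma>)))" using game_c_pos[OF \<gamma>] by simp
      have E: "0 < E" "E \<le> h" using \<epsilon> s0 sb(2) elim(2) cf unfolding E_def max_jump_def by simp_all
      have F: "0 \<le> F" "F \<le> h"
      proof -
        show "0 \<le> F" using f0 by (simp add: F_def)
        show "F \<le> h"
          using sb(3) elim(2) powr_ge_zero[of \<epsilon> "1 - \<alpha>2"] unfolding F_def f_def max_jump_def by linarith
      qed
      define X where "X = \<bar>x\<bar>"
      define Y where "Y = \<bar>y\<bar>"
      have XY: "0 \<le> X" "0 \<le> Y" "X\<^sup>2 + Y\<^sup>2 = 1" using xy by (simp_all add: X_def Y_def)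
      have XY1: "X \<le> 1" "Y \<le> 1"
      proof -
        have "X\<^sup>2 \<le> 1\<^sup>2" "Y\<^sup>2 \<le> 1\<^sup>2"
          using XY(3) zero_le_power2[of X] zero_le_power2[of Y] unfolding one_power2 by linarith+
        then show "X \<le> 1" "Y \<le> 1" by (auto intro: power2_le_imp_le)
      qed
      have sqle: "X\<^sup>2 \<le> X" "Y\<^sup>2 \<le> Y"
        using XY XY1 by (simp_all add: power2_eq_square mult_left_le)
      have xyb: "\<bar>x * y\<bar> = X * Y" "X * Y \<le> X" "X * Y \<le> Y" "2 * (X * Y) \<le> 1"
        using XY XY1 zero_le_power2[of "X - Y"]
        by (simp_all add: X_def Y_def abs_mult mult_left_le mult_left_le_one_le power2_diff)
      have x2: "x\<^sup>2 = X\<^sup>2" "y\<^sup>2 = Y\<^sup>2" by (simp_all add: X_def Y_def)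
      define Bvv where "Bvv = x\<^sup>2 * b11 + 2 * (x * y) * b12 + y\<^sup>2 * b22"
      define Bvw where "Bvw = x * y * (b22 - b11) + (x\<^sup>2 - y\<^sup>2) * b12"
      define Bww where "Bww = y\<^sup>2 * b11 - 2 * (x * y) * b12 + x\<^sup>2 * b22"
      have C0: "0 \<le> C" using C by simp
      have pr: "- (u * C) \<le> w * z" "w * z \<le> u * C" if "\<bar>w\<bar> \<le> u" "\<bar>z\<bar> \<le> C" for u w z :: real
      proof -
        have "\<bar>w * z\<bar> \<le> u * C" unfolding abs_mult using that by (intro mult_mono) auto
        then show "- (u * C) \<le> w * z" "w * z \<le> u * C" by (simp_all add: abs_le_iff)
      qed
      have Bww: "- (3 * C * Y) \<le> Bww"
      proof -
        have "- (Y * C) \<le> y\<^sup>2 * b11" using pr(1)[of "y\<^sup>2" Y b11] sqle b by (simp add: x2)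
        moreover have "2 * (x * y) * b12 \<le> 2 * Y * C"
          using pr(2)[of "2 * (x * y)" "2 * Y" b12] xyb b by (simp add: abs_mult)
        moreover have "0 \<le> x\<^sup>2 * b22" using b(4) k0 by simp
        ultimately show ?thesis unfolding Bww_def using mult.commute[of Y C] by linarith
      qed
      have Bvw: "\<bar>Bvw\<bar> \<le> 2 * C"
      proof -
        have "\<bar>x * y\<bar> \<le> 1/2" using xyb by linarith
        moreover have "\<bar>b22 - b11\<bar> \<le> 2 * C" using b by linarith
        ultimately have "\<bar>x * y\<bar> * \<bar>b22 - b11\<bar> \<le> 1/2 * (2 * C)" by (intro mult_mono) auto
        moreover have "\<bar>x\<^sup>2 - y\<^sup>2\<bar> \<le> 1" using xy zero_le_power2[of x] zero_le_power2[of y] by linarith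
        then have "\<bar>x\<^sup>2 - y\<^sup>2\<bar> * \<bar>b12\<bar> \<le> 1 * C" using b by (intro mult_mono) auto
        ultimately have "\<bar>x * y * (b22 - b11)\<bar> + \<bar>(x\<^sup>2 - y\<^sup>2) * b12\<bar> \<le> 2 * C" unfolding abs_mult by simp
        then show ?thesis unfolding Bvw_def by (rule order_trans[OF abs_triangle_ineq])
      qed
      have Bvv1: "k0 - C' * X \<le> Bvv"
      proof -
        have "- (X * C) \<le> x\<^sup>2 * b11" using pr(1)[of "x\<^sup>2" X b11] sqle b by (simp add: x2)
        moreover have "- (2 * X * C) \<le> 2 * (x * y) * b12"
          using pr(1)[of "2 * (x * y)" "2 * X" b12] xyb b by (simp add: abs_mult)
        moreover have "(1 - X) * k0 \<le> y\<^sup>2 * b22"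
          using XY sqle b(4) k0 by (intro mult_mono) (auto simp: x2)
        ultimately show ?thesis unfolding Bvv_def C'_def by (simp add: algebra_simps)
      qed
      have Bvv2: "- (2 * C) \<le> Bvv"
      proof -
        have "- (x\<^sup>2 * C) \<le> x\<^sup>2 * b11" "- (2 * (X * Y) * C) \<le> 2 * (x * y) * b12"
          using pr(1)[of "x\<^sup>2" "x\<^sup>2" b11] pr(1)[of "2 * (x * y)" "2 * (X * Y)" b12] xyb b by (simp_all add: abs_mult)
        moreover have "0 \<le> y\<^sup>2 * b22" using b(4) k0 by simp
        moreover have "x\<^sup>2 \<le> 1" using xy zero_le_power2[of y] by linarith
        then have "x\<^sup>2 * C \<le> 1 * C" by (rule mult_right_mono[OF _ C0])
        moreover have "2 * (X * Y) * C \<le> 1 * C" by (rule mult_right_mono[OF xyb(4) C0])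
        ultimately show ?thesis unfolding Bvv_def by linarith
      qed
      define \<beta> :: real where "\<beta> = (if y \<le> 0 then 1 else -1)"
      have \<beta>: "\<beta> \<in> {-1, 1}" "\<beta> * y = - Y" "\<bar>\<beta>\<bar> = 1" by (auto simp: \<beta>_def Y_def)
      define b where "b = (if 0 \<le> P * x + \<beta> * F * Bvw then 1 else (-1::real))"
      have b': "b \<in> {-1, 1}" "b * (P * x + \<beta> * F * Bvw) = \<bar>P * x + \<beta> * F * Bvw\<bar>" by (auto simp: b_def)
      define N where "N = \<bar>P * x + \<beta> * F * Bvw\<bar>"
      have N0: "0 \<le> N" by (simp add: N_def)
      have N: "P * X - 2 * C * F \<le> N"
      proof -
        have "\<bar>P * x\<bar> = P * X" using P P0 by (simp add: abs_mult X_def)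
        moreover have "\<bar>\<beta> * F * Bvw\<bar> \<le> F * (2 * C)"
          using Bvw F(1) \<beta>(3) by (simp add: abs_mult mult_left_mono)
        ultimately show ?thesis unfolding N_def by (simp add: mult.commute)
      qed
      have split: "P * (b * E * x - \<beta> * F * y) + (E\<^sup>2 * Bvv + 2 * (b * E) * (\<beta> * F) * Bvw + F\<^sup>2 * Bww) / 2 + a * \<epsilon>\<^sup>2
        = E * N + P * F * Y + E\<^sup>2 * Bvv / 2 + F\<^sup>2 * Bww / 2 + a * \<epsilon>\<^sup>2"
      proof -
        have "E * N = b * E * P * x + b * E * (\<beta> * F) * Bvw"
          unfolding N_def b'(2)[symmetric] by (simp add: algebra_simps)
        moreover have "P * (\<beta> * F * y) = - (P * F * Y)"
        proof -
          have "P * (\<beta> * F * y) = P * F * (\<beta> * y)" by (simp only: mult.assoc mult.commute mult.left_commute)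
          then show ?thesis by (simp add: \<beta>(2))
        qed
        ultimately show ?thesis by (simp add: algebra_simps add_divide_distrib)
      qed
      have PF: "(1 - \<zeta>) * (P0 * F * Y) \<le> P * F * Y + F\<^sup>2 * Bww / 2"
      proof -
        have "F\<^sup>2 * (- (3 * C * Y)) \<le> F\<^sup>2 * Bww" using Bww by (intro mult_left_mono) auto
        moreover have "2 * (C * F) * (F * Y) \<le> \<zeta> * P0 * (F * Y)"
        proof (rule mult_right_mono)
          have "C * F \<le> C * h" using F C0 by (intro mult_left_mono) auto
          then show "2 * (C * F) \<le> \<zeta> * P0" using h(2) by linarith
        qed (use F XY in simp)
        moreover have "0 \<le> C * (F * F * Y)" using C0 F XY by simp
        moreover have "P0 * (F * Y) \<le> P * (F * Y)" using P F XY by (intro mult_right_mono) auto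
        ultimately show ?thesis by (simp add: power2_eq_square algebra_simps)
      qed
      have "0 < E * N + (1 - \<zeta>) * (P0 * F * Y) + E\<^sup>2 * Bvv / 2 + a * \<epsilon>\<^sup>2"
      proof -
        have \<epsilon>2: "0 < \<epsilon>\<^sup>2" using \<epsilon> by simp
        have scale: "E * N + (1 - \<zeta>) * (P0 * F * Y) + E\<^sup>2 * Bvv / 2 + a * \<epsilon>\<^sup>2 =
          \<epsilon>\<^sup>2 * (s / \<epsilon> * N + (1 - \<zeta>) * (P0 * f * Y) + s\<^sup>2 * Bvv / 2 + a)"
          using \<epsilon>(1) by (simp add: E_def F_def power2_eq_square field_simps)
        have "0 < s / \<epsilon> * N + (1 - \<zeta>) * (P0 * f * Y) + s\<^sup>2 * Bvv / 2 + a"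
        \<comment> \<open>the first order term dominates unless \<open>v\<close> is close to tangential\<close>
        proof (cases "1/2 < X")
          case True
          have "2 * (C * F) \<le> 2 * (C * h)" using F C0 by (simp add: mult_left_mono)
          moreover have "P0 * X \<le> P * X" using P XY by (intro mult_right_mono) auto
          moreover have "P0 * (1/2) \<le> P0 * X" using True P0 by (intro mult_left_mono) auto
          ultimately have "P0 \<le> 4 * N" using N h(3) by (simp add: mult.assoc)
          define t where "t = s / \<epsilon>"
          have t0: "0 < t" using s0 \<epsilon> by (simp add: t_def)
          have "t * P0 \<le> t * (4 * N)" using \<open>P0 \<le> 4 * N\<close> t0 by (intro mult_left_mono) auto
          then have 1: "t * P0 \<le> 4 * (t * N)" by (simp only: mult.left_commute)
          have "s\<^sup>2 * (- (2 * C)) \<le> s\<^sup>2 * Bvv" using Bvv2 by (intro mult_left_mono) auto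
          moreover have "8 * (s\<^sup>2 * C) \<le> t * P0"
          proof -
            have "C * E \<le> C * h" using E C0 by (intro mult_left_mono) auto
            then have "8 * (C * E) \<le> P0" using h(3) by linarith
            then have "t * (8 * (C * E)) \<le> t * P0" using t0 by (intro mult_left_mono) auto
            moreover have "t * (8 * (C * E)) = 8 * (s\<^sup>2 * C)" using \<epsilon>(1) by (simp add: E_def t_def power2_eq_square)
            ultimately show ?thesis by simp
          qed
          ultimately have "- (t * P0) \<le> 4 * (s\<^sup>2 * Bvv)" by linarith
          moreover define hB where "hB = s\<^sup>2 * Bvv / 2"
          then have "s\<^sup>2 * Bvv = 2 * hB" by simp
          ultimately have 2: "- (t * P0) \<le> 8 * hB" by simp
          define W where "W = (1 - \<zeta>) * (P0 * f * Y)"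
          have "8 * (\<bar>a\<bar> + 1) \<le> t * P0"
          proof -
            have "\<epsilon> powr (1 - \<alpha>1) * \<epsilon> powr \<alpha>1 = \<epsilon>" using \<epsilon>(1) by (simp flip: powr_add)
            moreover have "\<epsilon> powr (1 - \<alpha>1) * \<epsilon> powr \<alpha>1 \<le> P0 / (8 * (\<bar>a\<bar> + 1)) * s"
              using elim(1) s P0 by (intro mult_mono) (auto simp: step_range_def)
            ultimately have "\<epsilon> \<le> P0 / (8 * (\<bar>a\<bar> + 1)) * s" by simp
            moreover have "0 < 8 * (\<bar>a\<bar> + 1)" by (simp add: add_nonneg_pos)
            ultimately have "\<epsilon> * (8 * (\<bar>a\<bar> + 1)) \<le> P0 * s" by (simp add: pos_le_divide_eq)
            then have "8 * (\<bar>a\<bar> + 1) \<le> P0 * s / \<epsilon>" using \<epsilon>(1) by (simp add: pos_le_divide_eq mult.commute)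
            then show ?thesis by (simp add: t_def mult.commute)
          qed
          moreover have "0 \<le> W" unfolding W_def using \<zeta> P0 f0 XY by simp
          ultimately have "0 < t * N + W + hB + a"
            using 1 2 abs_ge_minus_self[of a] by argo
          then show ?thesis unfolding t_def W_def hB_def .
        next
          case False
          show ?thesis
          \<comment> \<open>below \<open>s1\<close> the normal displacement alone beats all bounded terms\<close>
          proof (cases "s \<le> s1")
            case True
            have "f1 \<le> f" unfolding f1_def f_def by (rule game_f_antimono[OF \<gamma> s0 True])
            moreover have "1/2 \<le> Y" using False XY sqle by linarith
            ultimately have "f1 * (1/2) \<le> f * Y" using f1 f0 by (intro mult_mono) auto
            then have "P0 * (f1 * (1/2)) \<le> P0 * (f * Y)" using P0 by (intro mult_left_mono) auto
            moreover have "1/2 * (P0 * (f * Y)) \<le> (1 - \<zeta>) * (P0 * (f * Y))"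
              using \<zeta> P0 f0 XY by (intro mult_right_mono) auto
            ultimately have 1: "C + \<bar>a\<bar> + 1 \<le> (1 - \<zeta>) * (P0 * f * Y)" using f1(2) by (simp add: mult.assoc)
            have "s\<^sup>2 \<le> 1" using True s1(2) s0 by (simp add: power_le_one)
            then have "s\<^sup>2 * C \<le> 1 * C" using C0 by (intro mult_right_mono) auto
            moreover have "s\<^sup>2 * (- (2 * C)) \<le> s\<^sup>2 * Bvv" using Bvv2 by (intro mult_left_mono) auto
            ultimately have "- C \<le> s\<^sup>2 * Bvv / 2" by simp
            moreover have "0 \<le> s / \<epsilon> * N" using s0 \<epsilon> N0 by simp
            ultimately show ?thesis using 1 by linarith
          next
            case False
            have ff1: "f \<le> f1" unfolding f1_def f_def using game_f_antimono[OF \<gamma> s1(1), of s] False by simp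
            have Y1: "1 - X \<le> Y" using XY sqle by linarith
            have "s / \<epsilon> * (P * X - 2 * C * F) \<le> s / \<epsilon> * N" using N s0 \<epsilon> by (intro mult_left_mono) auto
            moreover have "s / \<epsilon> * (P * X - 2 * C * F) = s / \<epsilon> * P * X - 2 * (C * f * E)"
              using \<epsilon>(1) by (simp add: E_def F_def power2_eq_square algebra_simps)
            moreover have "C * f * E \<le> C * f1 * h" using ff1 C0 E f0 f1 by (intro mult_mono) auto
            ultimately have 1: "s / \<epsilon> * P * X - d / 4 \<le> s / \<epsilon> * N" using h(5) by simp
            have "P0 * f1 + s\<^sup>2 * C' / 2 \<le> s / \<epsilon> * P"
            proof -
              have "P0 * f1 \<le> P0 * (s / \<epsilon> / 2)"
                using P0 \<epsilon> False by (intro mult_left_mono) (auto simp: field_simps)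
              moreover have "s\<^sup>2 * C' \<le> s / \<epsilon> * P0"
              proof -
                have "C' * E \<le> C' * h" using E C' by (intro mult_left_mono) auto
                then have "s / \<epsilon> * (C' * E) \<le> s / \<epsilon> * P0" using h(4) s0 \<epsilon> by (intro mult_left_mono) auto
                moreover have "s / \<epsilon> * (C' * E) = s\<^sup>2 * C'" using \<epsilon>(1) by (simp add: E_def power2_eq_square)
                ultimately show ?thesis by simp
              qed
              moreover have "s / \<epsilon> * P0 \<le> s / \<epsilon> * P" using P s0 \<epsilon> by (intro mult_left_mono) auto
              ultimately show ?thesis by (simp add: mult.commute)
            qed
            from mult_right_mono[OF this XY(1)]
            have 2: "P0 * f1 * X + s\<^sup>2 * C' / 2 * X \<le> s / \<epsilon> * P * X" unfolding distrib_right .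
            have "s\<^sup>2 * (k0 - C' * X) \<le> s\<^sup>2 * Bvv" using Bvv1 by (intro mult_left_mono) auto
            then have 3: "s\<^sup>2 * k0 / 2 - s\<^sup>2 * C' / 2 * X \<le> s\<^sup>2 * Bvv / 2" by (simp add: algebra_simps)
            have "(1 - \<zeta>) * (P0 * f * (1 - X)) \<le> (1 - \<zeta>) * (P0 * f * Y)"
              using Y1 \<zeta> P0 f0 by (intro mult_left_mono) auto
            moreover have "(1 - \<zeta>) * (P0 * f * X) \<le> 1 * (P0 * f1 * X)"
              using \<zeta> P0 f0 ff1 XY(1) by (intro mult_mono) auto
            moreover have "(1 - \<zeta>) * (P0 * f * (1 - X)) = (1 - \<zeta>) * (P0 * f) - (1 - \<zeta>) * (P0 * f * X)"
              by (simp add: algebra_simps)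
            ultimately have 4: "(1 - \<zeta>) * (P0 * f) - P0 * f1 * X \<le> (1 - \<zeta>) * (P0 * f * Y)" by simp
            define k2 where "k2 = s\<^sup>2 * k0 / 2"
            have "m \<le> P0 * f + k2"
              unfolding m_def f_def k2_def by (rule game_f_Young[OF \<gamma> s0 P0 k0])
            then have "(1 - \<zeta>) * m \<le> (1 - \<zeta>) * (P0 * f + k2)" using \<zeta> by (intro mult_left_mono) auto
            moreover have "0 \<le> \<zeta> * k2" using \<zeta> k0 by (simp add: k2_def)
            moreover have "(1 - \<zeta>) * (P0 * f + k2) = (1 - \<zeta>) * (P0 * f) + k2 - \<zeta> * k2"
              by (simp add: algebra_simps)
            moreover have "(1 - \<zeta>) * m = m - \<zeta> * m" by (simp add: algebra_simps)
            ultimately have 5: "m - \<zeta> * m \<le> (1 - \<zeta>) * (P0 * f) + k2" by linarith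
            have "m - \<zeta> * m - d / 4 + a \<le> s / \<epsilon> * N + (1 - \<zeta>) * (P0 * f * Y) + s\<^sup>2 * Bvv / 2 + a"
              using 1 2 3 4 5 unfolding k2_def by linarith
            moreover have "m + a = d" by (simp add: d_def)
            then have "0 < m - \<zeta> * m - d / 4 + a" using \<zeta>(3) d by linarith
            ultimately show ?thesis by linarith
          qed
        qed
        then show ?thesis unfolding scale using \<epsilon>2 by (rule mult_pos_pos[rotated])
      qed
      then have "0 < P * (b * E * x - \<beta> * F * y) + (E\<^sup>2 * Bvv + 2 * (b * E) * (\<beta> * F) * Bvw + F\<^sup>2 * Bww) / 2 + a * \<epsilon>\<^sup>2"
        unfolding split using PF by linarith
      then have fin: "0 < P * (b * (\<epsilon> * s) * x - \<beta> * (\<epsilon>\<^sup>2 * game_f \<gamma> s) * y)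
          + ((\<epsilon> * s)\<^sup>2 * (x\<^sup>2 * b11 + 2 * (x * y) * b12 + y\<^sup>2 * b22)
            + 2 * (b * (\<epsilon> * s)) * (\<beta> * (\<epsilon>\<^sup>2 * game_f \<gamma> s)) * (x * y * (b22 - b11) + (x\<^sup>2 - y\<^sup>2) * b12)
            + (\<epsilon>\<^sup>2 * game_f \<gamma> s)\<^sup>2 * (y\<^sup>2 * b11 - 2 * (x * y) * b12 + x\<^sup>2 * b22)) / 2
          + a * \<epsilon>\<^sup>2"
        unfolding E_def F_def f_def Bvv_def Bvw_def Bww_def .
      show "\<exists>b\<in>{-1, 1}. \<exists>\<beta>\<in>{-1, 1}.
        0 < P * (b * (\<epsilon> * s) * x - \<beta> * (\<epsilon>\<^sup>2 * game_f \<gamma> s) * y)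
          + ((\<epsilon> * s)\<^sup>2 * (x\<^sup>2 * b11 + 2 * (x * y) * b12 + y\<^sup>2 * b22)
            + 2 * (b * (\<epsilon> * s)) * (\<beta> * (\<epsilon>\<^sup>2 * game_f \<gamma> s)) * (x * y * (b22 - b11) + (x\<^sup>2 - y\<^sup>2) * b12)
            + (\<epsilon>\<^sup>2 * game_f \<gamma> s)\<^sup>2 * (y\<^sup>2 * b11 - 2 * (x * y) * b12 + x\<^sup>2 * b22)) / 2
          + a * \<epsilon>\<^sup>2"
        by (rule bexI[OF bexI[OF _ \<beta>(1)] b'(1)]) (rule fin)
    qed
  qed
qed

end

lemma perp_linear: "linear perp"
  by (rule linearI) (simp_all add: perp_def vec_eq_iff forall_2)

lemma perp_scaleR: "perp (c *\<^sub>R v) = c *\<^sub>R perp v"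
  by (rule linear_cmul[OF perp_linear])

context curvature_game begin

lemma quadratic_game_step:
  assumes P0: "0 < P0" and k0: "0 < k0" and C: "0 < C"
    and pos: "0 < a + P0 powr (1 - \<gamma>) * k0 powr \<gamma>"
    and B: "bilinear B" "\<And>h k. B h k = B k h" "\<And>h k. \<bar>B h k\<bar> \<le> C * norm h * norm k"
  shows "\<forall>\<^sub>F \<epsilon> in at_right 0. \<forall>p v s. P0 \<le> norm p \<longrightarrow> k0 * (norm p)\<^sup>2 \<le> B (perp p) (perp p) \<longrightarrow>
    admissible \<epsilon> v s \<longrightarrow>
    (\<exists>b\<in>{-1, 1}. \<exists>\<beta>\<in>{-1, 1}.
      0 < p \<bullet> jump \<epsilon> v s b \<beta> + B (jump \<epsilon> v s b \<beta>) (jump \<epsilon> v s b \<beta>) / 2 + a * \<epsilon>\<^sup>2)"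
  using quadratic_game_frame[OF P0 k0 C pos]
proof eventually_elim
  case (elim \<epsilon>)
  show ?case
  proof (intro allI impI)
    fix p v :: "real^2" and s :: real
    assume p: "P0 \<le> norm p" and k: "k0 * (norm p)\<^sup>2 \<le> B (perp p) (perp p)" and adm: "admissible \<epsilon> v s"
    have np: "0 < norm p" using p P0 by linarith
    define n where "n = p /\<^sub>R norm p"
    define w where "w = perp n"
    have n: "norm n = 1" "p = norm p *\<^sub>R n" using np by (simp_all add: n_def)
    have w: "norm w = 1" "n \<bullet> w = 0" "w \<bullet> n = 0" "perp w = - n" using n(1) by (simp_all add: w_def)
    have nn: "n \<bullet> n = 1" "w \<bullet> w = 1" using n(1) w(1) by (simp_all flip: power2_norm_eq_inner)
    define x where "x = n \<bullet> v"
    define y where "y = w \<bullet> v"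
    have v: "v = x *\<^sub>R n + y *\<^sub>R w"
      unfolding x_def y_def w_def by (rule orthonormal_expansion[OF n(1)])
    have pv: "perp v = x *\<^sub>R w - y *\<^sub>R n"
    proof -
      have "perp v = perp (x *\<^sub>R n) + perp (y *\<^sub>R w)"
        unfolding v by (rule linear_add[OF perp_linear])
      then show ?thesis by (simp add: perp_scaleR w_def)
    qed
    have xy: "x\<^sup>2 + y\<^sup>2 = 1"
      using norm_square_expansion[OF n(1), of v] adm by (simp add: x_def y_def w_def admissible_def)
    have s: "s \<in> step_range \<alpha>1 \<alpha>2 \<epsilon>" using adm by (simp add: admissible_def)
    define b11 b12 b22 where "b11 = B n n" and "b12 = B n w" and "b22 = B w w"
    have b: "\<bar>b11\<bar> \<le> C" "\<bar>b12\<bar> \<le> C" "\<bar>b22\<bar> \<le> C"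
      using B(3)[of n n] B(3)[of n w] B(3)[of w w] n(1) w(1) by (simp_all add: b11_def b12_def b22_def)
    have bk: "k0 \<le> b22"
    proof -
      have "perp p = norm p *\<^sub>R w" unfolding w_def perp_scaleR[symmetric] n(2)[symmetric] by (rule refl)
      then have "B (perp p) (perp p) = norm p * (norm p * b22)"
        by (simp only: bilinear_lmul[OF B(1)] bilinear_rmul[OF B(1)] b22_def real_scaleR_def)
      then have "k0 * (norm p)\<^sup>2 \<le> b22 * (norm p)\<^sup>2"
        using k unfolding power2_eq_square by (simp only: mult.assoc mult.commute[of b22])
      moreover have "0 < (norm p)\<^sup>2" using np by simp
      ultimately show ?thesis by (rule mult_right_le_imp_le)
    qed
    from elim[THEN spec[where x = "norm p"], THEN spec[where x = x], THEN spec[where x = y],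
        THEN spec[where x = s], THEN spec[where x = b11], THEN spec[where x = b12], THEN spec[where x = b22],
        THEN mp, OF p, THEN mp, OF xy, THEN mp, OF s, THEN mp, OF b(1), THEN mp, OF b(2), THEN mp, OF b(3),
        THEN mp, OF bk]
    obtain b' \<beta> where b': "b' \<in> {-1, 1}" "\<beta> \<in> {-1, 1::real}"
      and gt: "0 < norm p * (b' * (\<epsilon> * s) * x - \<beta> * (\<epsilon>\<^sup>2 * game_f \<gamma> s) * y)
        + ((\<epsilon> * s)\<^sup>2 * (x\<^sup>2 * b11 + 2 * (x * y) * b12 + y\<^sup>2 * b22)
          + 2 * (b' * (\<epsilon> * s)) * (\<beta> * (\<epsilon>\<^sup>2 * game_f \<gamma> s)) * (x * y * (b22 - b11) + (x\<^sup>2 - y\<^sup>2) * b12)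
          + (\<epsilon>\<^sup>2 * game_f \<gamma> s)\<^sup>2 * (y\<^sup>2 * b11 - 2 * (x * y) * b12 + x\<^sup>2 * b22)) / 2
        + a * \<epsilon>\<^sup>2" by (elim bexE)
    define X where "X = b' * (\<epsilon> * s)"
    define Y where "Y = \<beta> * (\<epsilon>\<^sup>2 * game_f \<gamma> s)"
    have sq: "b'\<^sup>2 = 1" "\<beta>\<^sup>2 = 1" using b' by auto
    have X2: "(\<epsilon> * s)\<^sup>2 = X\<^sup>2" and Y2: "(\<epsilon>\<^sup>2 * game_f \<gamma> s)\<^sup>2 = Y\<^sup>2"
      unfolding X_def Y_def power_mult_distrib[of b'] power_mult_distrib[of \<beta>] sq mult_1 by (rule refl)+
    have d: "jump \<epsilon> v s b' \<beta> = X *\<^sub>R v + Y *\<^sub>R perp v"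
      by (simp add: jump_def X_def Y_def mult.assoc)
    define g1 where "g1 = X * x - Y * y"
    define g2 where "g2 = X * y + Y * x"
    have d': "jump \<epsilon> v s b' \<beta> = g1 *\<^sub>R n + g2 *\<^sub>R w"
    proof -
      have "X *\<^sub>R v + Y *\<^sub>R perp v = X *\<^sub>R (x *\<^sub>R n + y *\<^sub>R w) + Y *\<^sub>R (x *\<^sub>R w - y *\<^sub>R n)"
        by (rule arg_cong2[where f = "\<lambda>v1 v2. X *\<^sub>R v1 + Y *\<^sub>R v2", OF v pv])
      then show ?thesis unfolding d by (simp add: g1_def g2_def algebra_simps)
    qed
    have "p \<bullet> jump \<epsilon> v s b' \<beta> = (norm p *\<^sub>R n) \<bullet> (g1 *\<^sub>R n + g2 *\<^sub>R w)"
      by (rule arg_cong2[where f = "(\<bullet>)", OF n(2) d'])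
    then have pd: "p \<bullet> jump \<epsilon> v s b' \<beta> = norm p * g1"
      by (simp add: inner_add_right nn w)
    have "B w n = b12" using B(2)[of w n] by (simp add: b12_def)
    then have "B (g1 *\<^sub>R n + g2 *\<^sub>R w) (g1 *\<^sub>R n + g2 *\<^sub>R w) = g1\<^sup>2 * b11 + 2 * (g1 * g2) * b12 + g2\<^sup>2 * b22"
      unfolding bilinear_ladd[OF B(1)] bilinear_radd[OF B(1)] bilinear_lmul[OF B(1)] bilinear_rmul[OF B(1)]
      by (simp add: b11_def[symmetric] b12_def[symmetric] b22_def[symmetric] power2_eq_square algebra_simps)
    also have "\<dots> = X\<^sup>2 * (x\<^sup>2 * b11 + 2 * (x * y) * b12 + y\<^sup>2 * b22)
          + 2 * X * Y * (x * y * (b22 - b11) + (x\<^sup>2 - y\<^sup>2) * b12)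
          + Y\<^sup>2 * (y\<^sup>2 * b11 - 2 * (x * y) * b12 + x\<^sup>2 * b22)"
      by (simp add: g1_def g2_def power2_eq_square algebra_simps)
    finally have Bd: "B (jump \<epsilon> v s b' \<beta>) (jump \<epsilon> v s b' \<beta>) = \<dots>" unfolding d' .
    have "0 < p \<bullet> jump \<epsilon> v s b' \<beta> + B (jump \<epsilon> v s b' \<beta>) (jump \<epsilon> v s b' \<beta>) / 2 + a * \<epsilon>\<^sup>2"
      using gt[unfolded X2 Y2, folded X_def Y_def] unfolding pd Bd g1_def .
    then show "\<exists>b\<in>{-1, 1}. \<exists>\<beta>\<in>{-1, 1}.
      0 < p \<bullet> jump \<epsilon> v s b \<beta> + B (jump \<epsilon> v s b \<beta>) (jump \<epsilon> v s b \<beta>) / 2 + a * \<epsilon>\<^sup>2"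
      using b' by blast
  qed
qed

end

context terminal_value_game begin

text \<open>
  Subtract the quadratic \<open>\<psi>\<close> from the discrete value functions and take an exact minimum over the part of the time grid
  and the disc near \<open>(x0, t0)\<close>. The strictness of the contact, \<open>\<eta> (\<bar>z\<bar>\<^sup>2 + \<bar>\<tau>\<bar>)\<close>, places the minimum point in
  the interior for small \<open>\<epsilon>\<close>. There, an optimal control and the minimum property imply that no jump increases \<open>\<psi>\<close>,
  against the step estimate, applied with the gradient \<open>q z\<close> of \<open>\<psi>\<close> at the minimum point. The term \<open>- 2 \<eta> \<bar>\<tau>\<bar>\<close> changes
  by at most \<open>2 \<eta> \<epsilon>\<^sup>2\<close> in one step, which is why \<open>a - 2 \<eta>\<close> replaces \<open>a\<close> in the last hypothesis.
\<close>

lemma no_quadratic_contact: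
  fixes B :: "real^2 \<Rightarrow> real^2 \<Rightarrow> real"
  assumes t0: "0 < t0" "t0 < T" and B: "bilinear B" "\<And>h k. B h k = B k h"
    and \<eta>: "0 < \<eta>" and r: "0 < r" "r < t0" "r < T - t0"
    and touch: "\<And>z \<tau>. norm z \<le> r \<Longrightarrow> \<bar>\<tau>\<bar> \<le> r \<Longrightarrow>
      low (x0, t0) + (p \<bullet> z + B z z / 2 + a * \<tau> - 2 * \<eta> * \<bar>\<tau>\<bar>) + \<eta> * ((norm z)\<^sup>2 + \<bar>\<tau>\<bar>)
        \<le> low (x0 + z, t0 + \<tau>)"
    and P0: "0 < P0" "P0 < norm p" and k0: "0 < k0" "k0 * (norm p)\<^sup>2 < B (perp p) (perp p)"
    and pos: "0 < (a - 2 * \<eta>) + P0 powr (1 - \<gamma>) * k0 powr \<gamma>"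
  shows False
proof -
  define m0 where "m0 = low (x0, t0)"
  define \<psi> where "\<psi> X = p \<bullet> fst X + B (fst X) (fst X) / 2 + a * snd X - 2 * \<eta> * \<bar>snd X\<bar>" for X :: "(real^2) \<times> real"
  obtain C where C: "0 < C" "\<And>h k. \<bar>B h k\<bar> \<le> C * norm h * norm k"
    using bilinear_bounded_pos[OF B(1)] by auto
  have bb: "bounded_bilinear B" using B(1) by (simp add: bilinear_conv_bounded_bilinear)
  have cont\<psi>: "continuous_on UNIV \<psi>"
    unfolding \<psi>_def[abs_def] by (intro continuous_intros bounded_bilinear.continuous_on[OF bb]) auto
  \<comment> \<open>the spatial gradient of \<open>\<psi>\<close> at \<open>z\<close>\<close>
  define q where "q z = p + (\<chi> i. B z (axis i 1))" for z
  have q: "q z \<bullet> d = p \<bullet> d + B z d" for z d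
  proof -
    have lin: "linear (B z)" using B(1) by (simp add: bilinear_def)
    have "d = (d $ 1) *\<^sub>R axis 1 1 + (d $ 2) *\<^sub>R axis 2 1"
      by (simp add: vec_eq_iff forall_2 axis_def)
    then have "B z d = B z ((d $ 1) *\<^sub>R axis 1 1 + (d $ 2) *\<^sub>R axis 2 1)" by (rule arg_cong)
    then have "B z d = d $ 1 * B z (axis 1 1) + d $ 2 * B z (axis 2 1)"
      by (simp only: linear_add[OF lin] linear_cmul[OF lin] real_scaleR_def)
    moreover have "(\<chi> i. B z (axis i 1)) \<bullet> d = d $ 1 * B z (axis 1 1) + d $ 2 * B z (axis 2 1)"
      by (simp add: inner_vec_def sum_2 mult.commute)
    ultimately show ?thesis by (simp add: q_def inner_add_left)
  qed
  have q0: "q 0 = p"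
    by (simp add: q_def vec_eq_iff bilinear_lzero[OF B(1)])
  have contq: "continuous_on UNIV q"
    unfolding q_def[abs_def] by (intro continuous_intros bounded_bilinear.continuous_on[OF bb])
  have contperp: "continuous_on UNIV perp" using perp_linear linear_continuous_on linear_conv_bounded_linear by blast
  have at0: "(f \<longlongrightarrow> f 0) (nhds 0)" if "continuous_on UNIV f" for f :: "real^2 \<Rightarrow> real"
    unfolding tendsto_at_iff_tendsto_nhds[symmetric]
    using that by (simp add: continuous_on_eq_continuous_at isCont_def)
  have "continuous_on UNIV (\<lambda>z. norm (q z))" by (intro continuous_on_norm contq)
  then have "((\<lambda>z. norm (q z)) \<longlongrightarrow> norm p) (nhds 0)" using at0 q0 by fastforce
  then have 1: "\<forall>\<^sub>F z in nhds 0. P0 < norm (q z)" by (rule order_tendstoD(1)) (rule P0(2))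
  have cpq: "continuous_on UNIV (\<lambda>z. perp (q z))"
    by (rule continuous_on_compose2[OF contperp contq]) simp
  have "continuous_on UNIV (\<lambda>z. B (perp (q z)) (perp (q z)) - k0 * (norm (q z))\<^sup>2)"
    by (intro continuous_intros bounded_bilinear.continuous_on[OF bb] contq cpq)
  then have "((\<lambda>z. B (perp (q z)) (perp (q z)) - k0 * (norm (q z))\<^sup>2) \<longlongrightarrow>
      B (perp p) (perp p) - k0 * (norm p)\<^sup>2) (nhds 0)" using at0 q0 by fastforce
  then have 2: "\<forall>\<^sub>F z in nhds 0. 0 < B (perp (q z)) (perp (q z)) - k0 * (norm (q z))\<^sup>2"
    by (rule order_tendstoD(1)) (use k0(2) in simp)
  from 1 2 have "\<forall>\<^sub>F z in nhds 0. P0 < norm (q z) \<and> 0 < B (perp (q z)) (perp (q z)) - k0 * (norm (q z))\<^sup>2"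
    by (rule eventually_conj)
  then obtain \<rho>0 where \<rho>0: "0 < \<rho>0" "\<And>z. norm z < \<rho>0 \<Longrightarrow> P0 < norm (q z)"
    "\<And>z. norm z < \<rho>0 \<Longrightarrow> k0 * (norm (q z))\<^sup>2 < B (perp (q z)) (perp (q z))"
    unfolding eventually_nhds_metric by auto
  define \<rho> where "\<rho> = min \<rho>0 r / 2"
  have \<rho>: "0 < \<rho>" "\<rho> < \<rho>0" "2 * \<rho> \<le> r" using \<rho>0(1) r(1) by (auto simp: \<rho>_def)
  define \<theta> where "\<theta> = \<eta> * min (\<rho>\<^sup>2) \<rho>"
  have \<theta>: "0 < \<theta>" using \<eta> \<rho> by (simp add: \<theta>_def)
  have \<theta>4: "0 < \<theta> / 4" using \<theta> by simp
  have \<psi>_near: thesis if "\<And>e. 0 < e \<Longrightarrow> (\<And>X. dist X Z < e \<Longrightarrow> dist (\<psi> X) (\<psi> Z) < \<theta> / 4) \<Longrightarrow> thesis" for Z thesis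
    using cont\<psi>[unfolded continuous_on_iff, THEN bspec[where x = Z], OF UNIV_I, THEN spec, THEN mp, OF \<theta>4] that by blast
  \<comment> \<open>here the contact is strict, with margin at least \<open>\<theta>\<close>\<close>
  define A where "A = cball (0::real^2) r \<times> {- r..r} - ball 0 \<rho> \<times> {- \<rho><..<\<rho>}"
  have compA: "compact A" unfolding A_def
    by (intro compact_diff compact_Times compact_cball open_Times) auto
  have ge: "m0 + \<psi> Z + \<theta> \<le> low (x0 + fst Z, t0 + snd Z)" if Z: "Z \<in> A" for Z
  proof -
    have 1: "norm (fst Z) \<le> r" "\<bar>snd Z\<bar> \<le> r" and 2: "\<rho> \<le> norm (fst Z) \<or> \<rho> \<le> \<bar>snd Z\<bar>"
      using Z by (auto simp: A_def mem_Times_iff abs_le_iff)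
    have "min (\<rho>\<^sup>2) \<rho> \<le> (norm (fst Z))\<^sup>2 + \<bar>snd Z\<bar>"
      using 2
    proof
      assume "\<rho> \<le> norm (fst Z)"
      then have "\<rho>\<^sup>2 \<le> (norm (fst Z))\<^sup>2" using \<rho> by (intro power_mono) auto
      then show ?thesis by linarith
    next
      assume "\<rho> \<le> \<bar>snd Z\<bar>"
      then show ?thesis using zero_le_power2[of "norm (fst Z)"] by linarith
    qed
    then have "\<theta> \<le> \<eta> * ((norm (fst Z))\<^sup>2 + \<bar>snd Z\<bar>)" unfolding \<theta>_def using \<eta> by (intro mult_left_mono) auto
    then show ?thesis using touch[OF 1] unfolding m0_def \<psi>_def by linarith
  qed
  define near where "near Z e \<longleftrightarrow> (\<forall>\<epsilon> y k. 0 < \<epsilon> \<longrightarrow> \<epsilon> < e \<longrightarrow> 0 \<le> T - real k * \<epsilon>\<^sup>2 \<longrightarrow>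
      (y - x0, T - real k * \<epsilon>\<^sup>2 - t0) \<in> ball Z e \<longrightarrow> m0 + \<psi> (y - x0, T - real k * \<epsilon>\<^sup>2 - t0) + \<theta> / 2 < U \<epsilon> k y)" for Z e
  have "\<forall>Z\<in>A. \<exists>e. 0 < e \<and> near Z e"
  proof
    fix Z assume Z: "Z \<in> A"
    have "\<bar>snd Z\<bar> \<le> r" using Z by (auto simp: A_def mem_Times_iff abs_le_iff)
    then have t: "0 < t0 + snd Z" "t0 + snd Z < T" using r by (auto simp: abs_le_iff)
    define c where "c = m0 + \<psi> Z + 3 * (\<theta> / 4)"
    have "c < low (x0 + fst Z, t0 + snd Z)" using ge[OF Z] \<theta> unfolding c_def by simp
    then obtain e1 where e1: "0 < e1" "\<And>\<epsilon> y k. 0 < \<epsilon> \<Longrightarrow> \<epsilon> < e1 \<Longrightarrow> dist y (x0 + fst Z) < e1 \<Longrightarrow>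
      \<bar>T - real k * \<epsilon>\<^sup>2 - (t0 + snd Z)\<bar> < e1 \<Longrightarrow> 0 \<le> T - real k * \<epsilon>\<^sup>2 \<Longrightarrow> c < U \<epsilon> k y"
      using less_lowD[OF t] by blast
    obtain e2 where e2: "0 < e2" "\<And>X. dist X Z < e2 \<Longrightarrow> dist (\<psi> X) (\<psi> Z) < \<theta> / 4"
      by (rule \<psi>_near) blast
    show "\<exists>e. 0 < e \<and> near Z e"
      unfolding near_def
    proof (intro exI[of _ "min e1 e2"] conjI allI impI)
      fix \<epsilon> y k
      assume H: "0 < \<epsilon>" "\<epsilon> < min e1 e2" "0 \<le> T - real k * \<epsilon>\<^sup>2"
        "(y - x0, T - real k * \<epsilon>\<^sup>2 - t0) \<in> ball Z (min e1 e2)"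
      let ?X = "(y - x0, T - real k * \<epsilon>\<^sup>2 - t0)"
      have dX: "dist ?X Z < e1" "dist ?X Z < e2" using H(4) by (simp_all add: dist_commute)
      have "dist (y - x0) (fst Z) < e1" "dist (T - real k * \<epsilon>\<^sup>2 - t0) (snd Z) < e1"
        using dX(1) dist_fst_le[of ?X Z] dist_snd_le[of ?X Z] by simp_all
      then have "dist y (x0 + fst Z) < e1" "\<bar>T - real k * \<epsilon>\<^sup>2 - (t0 + snd Z)\<bar> < e1"
      proof -
        assume d: "dist (y - x0) (fst Z) < e1" "dist (T - real k * \<epsilon>\<^sup>2 - t0) (snd Z) < e1"
        have eq: "y - (x0 + fst Z) = y - x0 - fst Z" "T - real k * \<epsilon>\<^sup>2 - (t0 + snd Z) = T - real k * \<epsilon>\<^sup>2 - t0 - snd Z"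
          by simp_all
        show "dist y (x0 + fst Z) < e1" using d(1) unfolding dist_norm eq .
        show "\<bar>T - real k * \<epsilon>\<^sup>2 - (t0 + snd Z)\<bar> < e1" using d(2) unfolding dist_real_def eq .
      qed
      then have "c < U \<epsilon> k y" using e1(2) H by simp
      moreover have "\<psi> ?X < \<psi> Z + \<theta> / 4" using e2(2)[OF dX(2)] unfolding dist_real_def by linarith
      ultimately show "m0 + \<psi> ?X + \<theta> / 2 < U \<epsilon> k y" unfolding c_def by simp
    qed (use e1(1) e2(1) in simp)
  qed
  from bchoice[OF this] obtain e where e': "\<forall>Z\<in>A. 0 < e Z \<and> near Z (e Z)" by blast
  then have e: "\<And>Z. Z \<in> A \<Longrightarrow> 0 < e Z" "\<And>Z. Z \<in> A \<Longrightarrow> near Z (e Z)" by blast+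
  obtain D where D: "D \<subseteq> A" "finite D" "A \<subseteq> (\<Union>Z\<in>D. ball Z (e Z))"
  proof -
    have "A \<subseteq> (\<Union>Z\<in>A. ball Z (e Z))"
    proof
      fix Z assume "Z \<in> A"
      then show "Z \<in> (\<Union>Z\<in>A. ball Z (e Z))" using e(1) by (intro UN_I[of Z]) simp_all
    qed
    then show thesis by (rule compactE_image[OF compA open_ball _ that])
  qed
  define \<eta>1 where "\<eta>1 = Min (insert 1 (e ` D))"
  have \<eta>1: "0 < \<eta>1" "\<And>Z. Z \<in> D \<Longrightarrow> \<eta>1 \<le> e Z"
  proof -
    show "0 < \<eta>1" unfolding \<eta>1_def using D(2) e(1) subsetD[OF D(1)] by (subst Min_gr_iff) simp_all
    show "\<eta>1 \<le> e Z" if "Z \<in> D" for Z unfolding \<eta>1_def using D(2) that by (intro Min_le) simp_all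
  qed
  have away: "m0 + \<psi> (y - x0, T - real k * \<epsilon>\<^sup>2 - t0) + \<theta> / 2 < U \<epsilon> k y"
    if H: "0 < \<epsilon>" "\<epsilon> < \<eta>1" "0 \<le> T - real k * \<epsilon>\<^sup>2" "(y - x0, T - real k * \<epsilon>\<^sup>2 - t0) \<in> A" for \<epsilon> y k
  proof -
    obtain Z where Z: "Z \<in> D" "(y - x0, T - real k * \<epsilon>\<^sup>2 - t0) \<in> ball Z (e Z)" using D(3) H(4) by blast
    have "near Z (e Z)" by (rule e(2)[OF subsetD[OF D(1) Z(1)]])
    moreover have "\<epsilon> < e Z" by (rule less_le_trans[OF H(2) \<eta>1(2)[OF Z(1)]])
    ultimately show ?thesis using H(1,3) Z(2) unfolding near_def by blast
  qed
  have ev1: "\<forall>\<^sub>F \<epsilon> in at_right 0. max_jump \<epsilon> < \<rho>" by (rule max_jump_small[OF \<rho>(1)])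
  have ev2: "\<forall>\<^sub>F \<epsilon> in at_right (0::real). 0 < \<epsilon> \<and> \<epsilon> < min \<eta>1 (min 1 \<rho>)" by (rule eps_small) (use \<eta>1 \<rho> in simp)
  define wins where "wins \<epsilon> \<longleftrightarrow>
    (\<forall>p v s. P0 \<le> norm p \<longrightarrow> k0 * (norm p)\<^sup>2 \<le> B (perp p) (perp p) \<longrightarrow> admissible \<epsilon> v s \<longrightarrow>
    (\<exists>b\<in>{-1, 1}. \<exists>\<beta>\<in>{-1, 1}.
      0 < p \<bullet> jump \<epsilon> v s b \<beta> + B (jump \<epsilon> v s b \<beta>) (jump \<epsilon> v s b \<beta>) / 2 + (a - 2 * \<eta>) * \<epsilon>\<^sup>2))" for \<epsilon>
  have ev3: "\<forall>\<^sub>F \<epsilon> in at_right 0. wins \<epsilon>"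
    unfolding wins_def by (rule quadratic_game_step[OF P0(1) k0(1) C(1) pos B C(2)])
  have "\<forall>\<^sub>F \<epsilon> in at_right 0. max_jump \<epsilon> < \<rho> \<and> (0 < \<epsilon> \<and> \<epsilon> < min \<eta>1 (min 1 \<rho>)) \<and> wins \<epsilon>"
    by (rule eventually_conj[OF ev1 eventually_conj[OF ev2 ev3]])
  from this[unfolded eventually_at_right_field]
  obtain \<eta>2 where "0 < \<eta>2" and \<eta>2': "\<forall>\<epsilon>>0. \<epsilon> < \<eta>2 \<longrightarrow>
      max_jump \<epsilon> < \<rho> \<and> (0 < \<epsilon> \<and> \<epsilon> < min \<eta>1 (min 1 \<rho>)) \<and> wins \<epsilon>"
    by (elim exE conjE)
  have \<eta>2: "0 < \<eta>2" "0 < \<epsilon> \<Longrightarrow> \<epsilon> < \<eta>2 \<Longrightarrow>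
      max_jump \<epsilon> < \<rho> \<and> (0 < \<epsilon> \<and> \<epsilon> < min \<eta>1 (min 1 \<rho>)) \<and> wins \<epsilon>" for \<epsilon>
    using \<open>0 < \<eta>2\<close> \<eta>2'[rule_format] by this+
  have \<psi>0: "\<psi> (0, 0) = 0" by (simp add: \<psi>_def bilinear_lzero[OF B(1)])
  obtain e3 where e3: "0 < e3" "\<And>X. dist X (0, 0) < e3 \<Longrightarrow> dist (\<psi> X) (\<psi> (0, 0)) < \<theta> / 4"
    by (rule \<psi>_near) blast
  define \<eta>3 where "\<eta>3 = min \<eta>2 (min (e3 / 2) r)"
  have \<eta>3: "0 < \<eta>3" "\<eta>3 \<le> \<eta>2" "2 * \<eta>3 \<le> e3" "\<eta>3 \<le> r"
  proof -
    have "\<eta>3 \<le> e3 / 2" by (simp add: \<eta>3_def)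
    then show "2 * \<eta>3 \<le> e3" by simp
  qed (use \<eta>2(1) e3(1) r(1) in \<open>simp_all add: \<eta>3_def\<close>)
  define touching where "touching \<epsilon> y k \<longleftrightarrow> 0 < \<epsilon> \<and> \<epsilon> < \<eta>3 \<and> dist y x0 < \<eta>3 \<and> \<bar>T - real k * \<epsilon>\<^sup>2 - t0\<bar> < \<eta>3 \<and>
      U \<epsilon> k y \<le> m0 + \<psi> (y - x0, T - real k * \<epsilon>\<^sup>2 - t0) + \<theta> / 2" for \<epsilon> y k
  have "\<exists>\<epsilon> y k. touching \<epsilon> y k"
  proof (rule ccontr)
    assume no: "\<not> ?thesis"
    have "m0 + \<theta> / 4 \<le> low (x0, t0)"
    proof (rule le_lowI[OF t0 \<eta>3(1)])
      fix \<epsilon> y k assume H: "0 < \<epsilon>" "\<epsilon> < \<eta>3" "dist y x0 < \<eta>3" "\<bar>T - real k * \<epsilon>\<^sup>2 - t0\<bar> < \<eta>3" "0 \<le> T - real k * \<epsilon>\<^sup>2"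
      let ?X = "(y - x0, T - real k * \<epsilon>\<^sup>2 - t0)"
      have "\<not> U \<epsilon> k y \<le> m0 + \<psi> ?X + \<theta> / 2"
      proof
        assume "U \<epsilon> k y \<le> m0 + \<psi> ?X + \<theta> / 2"
        with H(1-4) have "touching \<epsilon> y k" unfolding touching_def by (intro conjI)
        with no show False by (elim notE) (intro exI)
      qed
      moreover have "dist ?X (0, 0) < e3"
      proof -
        have "dist ?X (0, 0) \<le> dist (y - x0) 0 + dist (T - real k * \<epsilon>\<^sup>2 - t0) 0"
          unfolding dist_Pair_Pair by (rule sqrt_sum_squares_le_sum) auto
        also have "\<dots> < \<eta>3 + \<eta>3" using H(3,4) by (intro add_strict_mono) (simp_all add: dist_norm)
        finally show ?thesis using \<eta>3(3) by linarith
      qed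
      then have "- (\<theta> / 4) < \<psi> ?X" using e3(2)[of ?X] unfolding \<psi>0 dist_real_def by linarith
      ultimately show "m0 + \<theta> / 4 \<le> U \<epsilon> k y" by linarith
    qed
    then show False using \<theta> by (simp add: m0_def)
  qed
  then obtain \<epsilon> y1 k1 where "touching \<epsilon> y1 k1" by (elim exE)
  then have H: "0 < \<epsilon>" "\<epsilon> < \<eta>3" "dist y1 x0 < \<eta>3" "\<bar>T - real k1 * \<epsilon>\<^sup>2 - t0\<bar> < \<eta>3"
    "U \<epsilon> k1 y1 \<le> m0 + \<psi> (y1 - x0, T - real k1 * \<epsilon>\<^sup>2 - t0) + \<theta> / 2"
    unfolding touching_def by blast+
  have \<epsilon>\<eta>2: "\<epsilon> < \<eta>2" using H(2) \<eta>3(2) by linarith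
  have \<epsilon>: "\<epsilon> < 1" "\<epsilon> < \<rho>" "\<epsilon> < \<eta>1" "max_jump \<epsilon> < \<rho>" using \<eta>2(2)[OF H(1) \<epsilon>\<eta>2] by auto
  have \<epsilon>2: "0 < \<epsilon>\<^sup>2" "\<epsilon>\<^sup>2 < \<rho>"
  proof -
    have "\<epsilon>\<^sup>2 \<le> \<epsilon>" using H(1) \<epsilon>(1) by (simp add: power2_eq_square mult_le_cancel_left1)
    then show "\<epsilon>\<^sup>2 < \<rho>" using \<epsilon>(2) by linarith
  qed (use H(1) in simp)
  define val where "val k y = U \<epsilon> k y - \<psi> (y - x0, T - real k * \<epsilon>\<^sup>2 - t0)" for k y
  define K where "K = {k. \<bar>T - real k * \<epsilon>\<^sup>2 - t0\<bar> \<le> r}"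
  have "K \<subseteq> {..steps (T - t0 + r) \<epsilon>}"
  proof
    fix k assume "k \<in> K"
    then have "real k * \<epsilon>\<^sup>2 \<le> T - t0 + r" by (simp add: K_def abs_le_iff)
    then show "k \<in> {..steps (T - t0 + r) \<epsilon>}"
      using le_steps_iff[OF H(1), of "T - t0 + r" k] t0 r by simp
  qed
  then have finK: "finite K" by (rule finite_subset) simp
  have k1K: "k1 \<in> K" using H(4) \<eta>3(4) by (simp add: K_def)
  have "\<exists>y\<in>cball x0 r. \<forall>y'\<in>cball x0 r. val k y \<le> val k y'" for k
  proof (rule continuous_attains_inf[OF compact_cball])
    show "cball x0 r \<noteq> {}" using r by simp
    have "continuous_on UNIV (\<lambda>y. \<psi> (y - x0, T - real k * \<epsilon>\<^sup>2 - t0))"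
      by (rule continuous_on_compose2[OF cont\<psi>]) (auto intro!: continuous_intros)
    then have "continuous_on UNIV (val k)" unfolding val_def[abs_def]
      using U_continuous[OF H(1) \<epsilon>(1)] by (intro continuous_on_diff) auto
    then show "continuous_on (cball x0 r) (val k)" by (rule continuous_on_subset) simp
  qed
  then have "\<forall>k. \<exists>y. y \<in> cball x0 r \<and> (\<forall>y'\<in>cball x0 r. val k y \<le> val k y')" by blast
  from choice[OF this] obtain Y where Y': "\<forall>k. Y k \<in> cball x0 r \<and> (\<forall>y'\<in>cball x0 r. val k (Y k) \<le> val k y')"
    by (elim exE)
  have Y: "Y k \<in> cball x0 r" "y' \<in> cball x0 r \<Longrightarrow> val k (Y k) \<le> val k y'" for k y' using Y' by blast+
  define k where "k = arg_min_on (\<lambda>k. val k (Y k)) K"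
  have Kne: "K \<noteq> {}" using k1K by blast
  note argmin = arg_min_if_finite[OF finK Kne, of "\<lambda>k. val k (Y k)", folded k_def]
  have kK: "k \<in> K" by (rule argmin(1))
  have kmin: "val k (Y k) \<le> val k' (Y k')" if "k' \<in> K" for k'
  proof (rule ccontr)
    assume "\<not> val k (Y k) \<le> val k' (Y k')"
    then have "\<exists>x\<in>K. val x (Y x) < val k (Y k)" using that by (intro bexI[of _ k']) simp_all
    then show False using argmin(2) by contradiction
  qed
  have least: "val k (Y k) \<le> val k' y'" if "k' \<in> K" "y' \<in> cball x0 r" for k' y'
    using kmin[OF that(1)] Y(2)[OF that(2), of k'] by linarith
  define z where "z = Y k - x0"
  define \<tau> where "\<tau> = T - real k * \<epsilon>\<^sup>2 - t0"
  have zr: "norm z \<le> r" using Y(1)[of k] by (simp add: z_def dist_norm norm_minus_commute)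
  have \<tau>r: "\<bar>\<tau>\<bar> \<le> r" using kK by (simp add: K_def \<tau>_def)
  have "val k (Y k) \<le> val k1 y1" using least[OF k1K, of y1] H(3) \<eta>3(4) by (simp add: dist_commute)
  also have "\<dots> \<le> m0 + \<theta> / 2" using H(5) by (simp add: val_def)
  finally have "\<not> m0 + \<psi> (z, \<tau>) + \<theta> / 2 < U \<epsilon> k (Y k)" by (simp add: val_def z_def \<tau>_def)
  moreover have "0 \<le> T - real k * \<epsilon>\<^sup>2" using \<tau>r r by (simp add: \<tau>_def abs_le_iff)
  ultimately have "(z, \<tau>) \<notin> A" using away[OF H(1) \<epsilon>(3), of k "Y k"] by (auto simp: z_def \<tau>_def)
  then have zt: "norm z < \<rho>" "\<bar>\<tau>\<bar> < \<rho>" using zr \<tau>r by (auto simp: A_def abs_le_iff abs_less_iff)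
  have "k \<noteq> 0"
  proof
    assume "k = 0"
    then have "T - t0 < \<rho>" using zt(2) by (simp add: \<tau>_def abs_less_iff)
    then show False using \<rho>(1,3) r(3) by linarith
  qed
  then obtain k' where kk: "k = Suc k'" by (cases k) auto
  have \<tau>': "T - real k' * \<epsilon>\<^sup>2 - t0 = \<tau> + \<epsilon>\<^sup>2" by (simp add: \<tau>_def kk algebra_simps)
  have k'K: "k' \<in> K" unfolding K_def mem_Collect_eq \<tau>' using zt(2) \<epsilon>2 \<rho>(1,3) by linarith
  obtain v s where vs: "admissible \<epsilon> v s" "\<And>b \<beta>. b \<in> {-1, 1} \<Longrightarrow> \<beta> \<in> {-1, 1} \<Longrightarrow>
      U \<epsilon> k' (Y k + jump \<epsilon> v s b \<beta>) \<le> U \<epsilon> (Suc k') (Y k)"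
    by (rule U_Suc_attained[OF H(1) \<epsilon>(1) that])
  have z\<rho>0: "norm z < \<rho>0" using zt(1) \<rho>(2) by linarith
  have "wins \<epsilon>" using \<eta>2(2)[OF H(1) \<epsilon>\<eta>2] by blast
  from this[unfolded wins_def, THEN spec[where x = "q z"], THEN spec[where x = v], THEN spec[where x = s],
      THEN mp, OF less_imp_le[OF \<rho>0(2)[OF z\<rho>0]], THEN mp, OF less_imp_le[OF \<rho>0(3)[OF z\<rho>0]], THEN mp, OF vs(1)]
  obtain b \<beta> where b: "b \<in> {-1, 1}" "\<beta> \<in> {-1, 1}"
    "0 < q z \<bullet> jump \<epsilon> v s b \<beta> + B (jump \<epsilon> v s b \<beta>) (jump \<epsilon> v s b \<beta>) / 2 + (a - 2 * \<eta>) * \<epsilon>\<^sup>2" by (elim bexE)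
  define d where "d = jump \<epsilon> v s b \<beta>"
  have "norm d \<le> max_jump \<epsilon>" unfolding d_def by (rule norm_jump_le[OF H(1) vs(1) b(1,2)])
  moreover have "norm (z + d) \<le> norm z + norm d" by (rule norm_triangle_ineq)
  ultimately have zd: "norm (z + d) \<le> r" using zt(1) \<epsilon>(4) \<rho>(3) by linarith
  have "Y k + d - x0 = z + d" by (simp add: z_def)
  then have "norm (Y k + d - x0) \<le> r" using zd by (simp only:)
  then have "Y k + d \<in> cball x0 r" unfolding mem_cball dist_norm norm_minus_commute[of x0] .
  from least[OF k'K this] have "U \<epsilon> k (Y k) - \<psi> (z, \<tau>) \<le> U \<epsilon> k' (Y k + d) - \<psi> (z + d, \<tau> + \<epsilon>\<^sup>2)"
    unfolding val_def \<tau>' \<open>Y k + d - x0 = z + d\<close> by (simp only: z_def[symmetric] \<tau>_def[symmetric])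
  moreover have "U \<epsilon> k' (Y k + d) \<le> U \<epsilon> k (Y k)" using vs(2)[OF b(1,2)] by (simp only: kk d_def)
  ultimately have "\<psi> (z + d, \<tau> + \<epsilon>\<^sup>2) \<le> \<psi> (z, \<tau>)" by linarith
  moreover have "\<psi> (z + d, \<tau> + \<epsilon>\<^sup>2) = \<psi> (z, \<tau>) + (q z \<bullet> d + B d d / 2) + a * \<epsilon>\<^sup>2 - 2 * \<eta> * (\<bar>\<tau> + \<epsilon>\<^sup>2\<bar> - \<bar>\<tau>\<bar>)"
  proof -
    have "B (z + d) (z + d) = B z z + 2 * B z d + B d d"
      unfolding bilinear_ladd[OF B(1)] bilinear_radd[OF B(1)] using B(2)[of d z] by simp
    then show ?thesis unfolding \<psi>_def q fst_conv snd_conv inner_add_right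
      by (simp add: algebra_simps add_divide_distrib)
  qed
  moreover have "2 * \<eta> * (\<bar>\<tau> + \<epsilon>\<^sup>2\<bar> - \<bar>\<tau>\<bar>) \<le> 2 * \<eta> * \<epsilon>\<^sup>2"
    using \<eta> \<epsilon>2(1) by (intro mult_left_mono) linarith+
  moreover have "(a - 2 * \<eta>) * \<epsilon>\<^sup>2 = a * \<epsilon>\<^sup>2 - 2 * \<eta> * \<epsilon>\<^sup>2" by (simp add: algebra_simps)
  ultimately show False using b(3) unfolding d_def by linarith
qed

end

section \<open>Second derivatives, Taylor expansion and curvature\<close>

definition second_derivative :: "('a::real_normed_vector \<Rightarrow> real) \<Rightarrow> 'a \<Rightarrow> 'a \<Rightarrow> 'a \<Rightarrow> real" where
  "second_derivative f X h k = frechet_derivative (\<lambda>Y. frechet_derivative f (at Y) h) (at X) k"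

text \<open>
  The second derivative, symmetrised by hand: this gives a symmetric bilinear form without an appeal to the theorem on
  mixed partial derivatives, and the Taylor expansion only sees the diagonal.
\<close>

definition hessian_form :: "('a::euclidean_space \<Rightarrow> real) \<Rightarrow> 'a \<Rightarrow> 'a \<Rightarrow> 'a \<Rightarrow> real" where
  "hessian_form f X V W = (\<Sum>i\<in>Basis. \<Sum>j\<in>Basis. (V \<bullet> i) * (W \<bullet> j) *
     ((second_derivative f X i j + second_derivative f X j i) / 2))"

lemma bilinear_hessian_form: "bilinear (hessian_form f X)"
proof -
  have "bilinear (\<lambda>V W. \<Sum>i\<in>Basis. \<Sum>j\<in>Basis. (V \<bullet> i) * (W \<bullet> j) * m i j)" for m :: "'a \<Rightarrow> 'a \<Rightarrow> real"
    unfolding bilinear_def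
    by (intro conjI allI linearI) (simp_all add: inner_add_left distrib_left distrib_right
        sum.distrib sum_distrib_left mult.assoc mult.left_commute)
  then show ?thesis unfolding hessian_form_def[abs_def] .
qed

lemma hessian_form_commute: "hessian_form f X V W = hessian_form f X W V"
  unfolding hessian_form_def
  by (subst sum.swap) (simp add: mult.commute add.commute)

lemma hessian_form_same:
  "hessian_form f X W W = (\<Sum>i\<in>Basis. \<Sum>j\<in>Basis. (W \<bullet> i) * (W \<bullet> j) * second_derivative f X i j)"
proof -
  let ?S = "\<Sum>i\<in>Basis. \<Sum>j\<in>Basis. (W \<bullet> i) * (W \<bullet> j) * second_derivative f X i j"
  have "(\<Sum>i\<in>Basis. \<Sum>j\<in>Basis. (W \<bullet> i) * (W \<bullet> j) * second_derivative f X j i) = ?S"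
    by (subst sum.swap) (simp add: mult.commute)
  moreover have "hessian_form f X W W = (?S + (\<Sum>i\<in>Basis. \<Sum>j\<in>Basis. (W \<bullet> i) * (W \<bullet> j) * second_derivative f X j i)) / 2"
    unfolding hessian_form_def by (simp add: sum.distrib[symmetric] sum_divide_distrib distrib_left add_divide_distrib)
  ultimately show ?thesis by simp
qed

lemma Ck_on_2D:
  assumes "Ck_on (Suc (Suc 0)) S f" "X \<in> S"
  shows "(f has_derivative frechet_derivative f (at X)) (at X)"
    "((\<lambda>Y. frechet_derivative f (at Y) h) has_derivative second_derivative f X h) (at X)"
    "continuous_on S (\<lambda>Y. second_derivative f Y h k)"
proof -
  show "(f has_derivative frechet_derivative f (at X)) (at X)"
    using assms unfolding frechet_derivative_works[symmetric] by simp
  have "(\<lambda>Y. frechet_derivative f (at Y) h) differentiable (at X)" using assms by simp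
  then show "((\<lambda>Y. frechet_derivative f (at Y) h) has_derivative second_derivative f X h) (at X)"
    unfolding frechet_derivative_works second_derivative_def[abs_def] .
  show "continuous_on S (\<lambda>Y. second_derivative f Y h k)"
    using assms unfolding second_derivative_def by simp
qed

text \<open>
  The expansion along each ray from \<open>X0\<close>, with the remainder in Lagrange form; uniformity in the direction comes from the
  continuity of the finitely many second partial derivatives at \<open>X0\<close>.
\<close>

lemma second_order_Taylor:
  fixes f :: "'a::euclidean_space \<Rightarrow> real"
  assumes S: "open S" "X0 \<in> S" and f: "Ck_on (Suc (Suc 0)) S f" and e: "0 < e"
  obtains r where "0 < r" "\<And>W. norm W < r \<Longrightarrow> X0 + W \<in> S \<and>
    \<bar>f (X0 + W) - f X0 - frechet_derivative f (at X0) W - hessian_form f X0 W W / 2\<bar> \<le> e * (norm W)\<^sup>2"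
proof -
  let ?D = "\<lambda>X h. frechet_derivative f (at X) h"
  let ?n = "real (card (Basis::'a set))"
  have n: "0 < ?n" by (simp add: DIM_positive)
  define e' where "e' = 2 * e / ?n\<^sup>2"
  have e': "0 < e'" "?n * (?n * e') = 2 * e" using e n by (simp_all add: e'_def power2_eq_square)
  have at_nhds: "(h \<longlongrightarrow> h X0) (nhds X0)" if "isCont h X0" for h :: "'a \<Rightarrow> real"
    unfolding tendsto_at_iff_tendsto_nhds[symmetric] using that by (simp add: isCont_def)
  have ev: "\<forall>\<^sub>F X in nhds X0. dist (second_derivative f X i j) (second_derivative f X0 i j) < e'" for i j
  proof -
    have "isCont (\<lambda>X. second_derivative f X i j) X0"
      using Ck_on_2D(3)[OF f S(2), of i j] S by (simp add: continuous_on_eq_continuous_at)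
    then have "((\<lambda>X. second_derivative f X i j) \<longlongrightarrow> second_derivative f X0 i j) (nhds X0)"
      by (rule at_nhds)
    then show ?thesis by (rule tendstoD[OF _ e'(1)])
  qed
  have "\<forall>\<^sub>F X in nhds X0. \<forall>i\<in>Basis. \<forall>j\<in>Basis. dist (second_derivative f X i j) (second_derivative f X0 i j) < e'"
    by (intro eventually_ball_finite finite_Basis ballI ev)
  moreover have "\<forall>\<^sub>F X in nhds X0. X \<in> S" by (rule eventually_nhds_in_open[OF S])
  ultimately have "\<forall>\<^sub>F X in nhds X0. X \<in> S \<and>
      (\<forall>i\<in>Basis. \<forall>j\<in>Basis. dist (second_derivative f X i j) (second_derivative f X0 i j) < e')"
    by eventually_elim simp
  then obtain r where r: "0 < r" "\<And>X. dist X X0 < r \<Longrightarrow> X \<in> S"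
    "\<And>X i j. dist X X0 < r \<Longrightarrow> i \<in> Basis \<Longrightarrow> j \<in> Basis \<Longrightarrow>
       dist (second_derivative f X i j) (second_derivative f X0 i j) < e'"
    unfolding eventually_nhds_metric by blast
  show thesis
  proof (rule that[OF r(1)], rule conjI)
    fix W :: 'a assume W: "norm W < r"
    have near: "dist (X0 + t *\<^sub>R W) X0 < r" if "0 \<le> t" "t \<le> 1" for t
    proof -
      have "\<bar>t\<bar> * norm W \<le> 1 * norm W" using that by (intro mult_right_mono) auto
      then show ?thesis using W by (simp add: dist_norm)
    qed
    show "X0 + W \<in> S" using r(2)[OF near[of 1]] by simp
    define q where "q X = (\<Sum>i\<in>Basis. \<Sum>j\<in>Basis. (W \<bullet> i) * (W \<bullet> j) * second_derivative f X i j)" for X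
    define g where "g m t = (if m = 0 then f (X0 + t *\<^sub>R W) else if m = 1 then ?D (X0 + t *\<^sub>R W) W else q (X0 + t *\<^sub>R W))"
      for m :: nat and t :: real
    have line: "((\<lambda>t. X0 + t *\<^sub>R W) has_derivative (\<lambda>s. s *\<^sub>R W)) (at t)" for t
      by (auto intro!: derivative_eq_intros)
    have lin1: "linear (?D X)" if "X \<in> S" for X
      using Ck_on_2D(1)[OF f that] has_derivative_linear by blast
    have lin2: "linear (second_derivative f X h)" if "X \<in> S" for X h
      using Ck_on_2D(2)[OF f that] has_derivative_linear by blast
    have basis: "l W = (\<Sum>i\<in>Basis. (W \<bullet> i) * l i)" if "linear l" for l :: "'a \<Rightarrow> real"
    proof -
      have "l W = l (\<Sum>i\<in>Basis. (W \<bullet> i) *\<^sub>R i)" by (simp add: euclidean_representation)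
      also have "\<dots> = (\<Sum>i\<in>Basis. (W \<bullet> i) * l i)"
        by (simp add: linear_sum[OF that] linear_cmul[OF that])
      finally show ?thesis .
    qed
    have d0: "DERIV (g 0) t :> g (Suc 0) t" if t: "0 \<le> t" "t \<le> 1" for t
    proof -
      have X: "X0 + t *\<^sub>R W \<in> S" using r(2)[OF near[OF t]] .
      have "((\<lambda>t. f (X0 + t *\<^sub>R W)) has_derivative (\<lambda>s. ?D (X0 + t *\<^sub>R W) (s *\<^sub>R W))) (at t)"
        by (rule has_derivative_compose[OF line Ck_on_2D(1)[OF f X]])
      then show ?thesis unfolding g_def has_field_derivative_def
        by (simp add: linear_cmul[OF lin1[OF X]] mult_commute_abs)
    qed
    have d1: "DERIV (g (Suc 0)) t :> g (Suc (Suc 0)) t" if t: "0 \<le> t" "t \<le> 1" for t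
    proof -
      have X: "X0 + t *\<^sub>R W \<in> S" using r(2)[OF near[OF t]] .
      have "((\<lambda>X. \<Sum>i\<in>Basis. (W \<bullet> i) * ?D X i) has_derivative
          (\<lambda>k. \<Sum>i\<in>Basis. (W \<bullet> i) * second_derivative f (X0 + t *\<^sub>R W) i k)) (at (X0 + t *\<^sub>R W))"
        by (intro has_derivative_sum has_derivative_mult_right Ck_on_2D(2)[OF f X])
      then have "((\<lambda>X. ?D X W) has_derivative
          (\<lambda>k. \<Sum>i\<in>Basis. (W \<bullet> i) * second_derivative f (X0 + t *\<^sub>R W) i k)) (at (X0 + t *\<^sub>R W))"
        by (rule has_derivative_transform_within_open[OF _ S(1) X]) (rule basis[OF lin1, symmetric])
      from has_derivative_compose[OF line this]
      have "((\<lambda>t. ?D (X0 + t *\<^sub>R W) W) has_derivative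
          (\<lambda>s. \<Sum>i\<in>Basis. (W \<bullet> i) * second_derivative f (X0 + t *\<^sub>R W) i (s *\<^sub>R W))) (at t)" .
      moreover have "(\<Sum>i\<in>Basis. (W \<bullet> i) * second_derivative f (X0 + t *\<^sub>R W) i (s *\<^sub>R W)) = q (X0 + t *\<^sub>R W) * s" for s
      proof -
        have "second_derivative f (X0 + t *\<^sub>R W) i (s *\<^sub>R W) =
            s * (\<Sum>j\<in>Basis. (W \<bullet> j) * second_derivative f (X0 + t *\<^sub>R W) i j)" for i
          unfolding linear_cmul[OF lin2[OF X]] real_scaleR_def by (simp only: basis[OF lin2[OF X]])
        then show ?thesis unfolding q_def
          by (simp add: sum_distrib_left sum_distrib_right mult.assoc mult.left_commute mult.commute[of _ s])
      qed
      ultimately show ?thesis unfolding g_def has_field_derivative_def by simp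
    qed
    have "\<forall>m t. m < 2 \<and> 0 \<le> t \<and> t \<le> 1 \<longrightarrow> DERIV (g m) t :> g (Suc m) t"
      using d0 d1 by (auto simp: less_2_cases_iff)
    then obtain t where t: "0 < t" "t < 1" "g 0 1 = (\<Sum>m<2. g m 0 / fact m * 1 ^ m) + g 2 t / fact 2 * 1 ^ 2"
      using Maclaurin[of 1 2 g "g 0"] by auto
    have "(\<Sum>m<2. g m 0 / fact m * 1 ^ m) = f X0 + ?D X0 W"
      by (simp add: numeral_2_eq_2 g_def)
    then have eq: "f (X0 + W) = f X0 + ?D X0 W + q (X0 + t *\<^sub>R W) / 2"
      using t(3) by (simp add: g_def)
    have close: "\<bar>second_derivative f (X0 + t *\<^sub>R W) i j - second_derivative f X0 i j\<bar> \<le> e'"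
      if "i \<in> Basis" "j \<in> Basis" for i j
      using r(3)[OF near that, of t] t by (simp add: dist_real_def)
    have "q (X0 + t *\<^sub>R W) - q X0 = (\<Sum>i\<in>Basis. \<Sum>j\<in>Basis. (W \<bullet> i) * (W \<bullet> j) *
        (second_derivative f (X0 + t *\<^sub>R W) i j - second_derivative f X0 i j))"
      unfolding q_def by (simp add: sum_subtractf right_diff_distrib)
    also have "\<bar>\<dots>\<bar> \<le> (\<Sum>i\<in>(Basis::'a set). \<Sum>j\<in>(Basis::'a set). (norm W)\<^sup>2 * e')"
    proof (intro order_trans[OF sum_abs] sum_mono)
      fix i j :: 'a assume ij: "i \<in> Basis" "j \<in> Basis"
      show "\<bar>W \<bullet> i * (W \<bullet> j) * (second_derivative f (X0 + t *\<^sub>R W) i j - second_derivative f X0 i j)\<bar> \<le> (norm W)\<^sup>2 * e'"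
        unfolding abs_mult power2_eq_square
        using close[OF ij] Basis_le_norm[OF ij(1), of W] Basis_le_norm[OF ij(2), of W] by (intro mult_mono) auto
    qed
    also have "\<dots> = (?n * (?n * e')) * (norm W)\<^sup>2" by simp
    also have "\<dots> = 2 * (e * (norm W)\<^sup>2)" unfolding e'(2) by simp
    finally have "\<bar>q (X0 + t *\<^sub>R W) - q X0\<bar> \<le> 2 * (e * (norm W)\<^sup>2)" .
    moreover have "q X0 = hessian_form f X0 W W" unfolding q_def hessian_form_same by (rule refl)
    ultimately show "\<bar>f (X0 + W) - f X0 - ?D X0 W - hessian_form f X0 W W / 2\<bar> \<le> e * (norm W)\<^sup>2"
      unfolding eq by (simp add: abs_le_iff)
  qed
qed

lemma sum_Basis_real2:
  fixes F :: "real^2 \<Rightarrow> real"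
  shows "(\<Sum>i\<in>(Basis::(real^2) set). F i) = F (axis 1 1) + F (axis 2 1)"
proof -
  have B: "(Basis::(real^2) set) = {axis 1 1, axis 2 1}" by (auto simp: Basis_vec_def UNIV_2)
  have "axis 1 1 \<notin> {axis 2 1 :: real^2}" by (simp add: axis_eq_axis)
  then show ?thesis unfolding B by (subst sum.insert) simp_all
qed

lemma sum_Basis_prod:
  fixes F :: "'a::euclidean_space \<times> 'b::euclidean_space \<Rightarrow> real"
  shows "(\<Sum>i\<in>Basis. F i) = (\<Sum>i\<in>Basis. F (i, 0)) + (\<Sum>i\<in>Basis. F (0, i))"
proof -
  have "inj_on (\<lambda>u. (u::'a, 0::'b)) Basis" "inj_on (\<lambda>u. (0::'a, u::'b)) Basis"
    by (auto intro!: inj_onI)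
  moreover have "(\<lambda>u. (u::'a, 0::'b)) ` Basis \<inter> (\<lambda>u. (0::'a, u::'b)) ` Basis = {}"
    by auto
  ultimately show ?thesis
    unfolding Basis_prod_def by (subst sum.union_disjoint) (simp_all add: sum.reindex)
qed

lemma hessian_form_space:
  fixes f :: "(real^2) \<times> real \<Rightarrow> real" and w :: "real^2"
  shows "hessian_form f X (w, 0) (w, 0) =
    w $ 1 * w $ 1 * second_derivative f X (axis 1 1, 0) (axis 1 1, 0)
    + w $ 1 * w $ 2 * second_derivative f X (axis 1 1, 0) (axis 2 1, 0)
    + w $ 2 * w $ 1 * second_derivative f X (axis 2 1, 0) (axis 1 1, 0)
    + w $ 2 * w $ 2 * second_derivative f X (axis 2 1, 0) (axis 2 1, 0)"
  unfolding hessian_form_same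
  by (simp add: sum_Basis_prod sum_Basis_real2 inner_axis)

context
  fixes \<phi> :: "(real^2) \<times> real \<Rightarrow> real" and T :: real and x0 :: "real^2" and t0 :: real
  assumes \<phi>: "Ck_on (Suc (Suc 0)) (UNIV \<times> {0<..<T}) \<phi>" and t0: "0 < t0" "t0 < T"
begin

lemma in_domain: "(y, t0) \<in> UNIV \<times> {0<..<T}"
  using t0 by simp

lemma has_derivative_Pair_const: "((\<lambda>y. (y, t0)) has_derivative (\<lambda>k. (k, 0))) (at y)"
  for y :: "real^2"
  by (auto intro!: derivative_eq_intros)

lemma has_derivative_const_Pair: "((\<lambda>s. (x0, s)) has_derivative (\<lambda>s. (0, s))) (at t0)"
  by (auto intro!: derivative_eq_intros)

lemma space_derivative:
  "((\<lambda>y. \<phi> (y, t0)) has_derivative (\<lambda>k. frechet_derivative \<phi> (at (y, t0)) (k, 0))) (at y)"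
  by (rule has_derivative_compose[OF has_derivative_Pair_const Ck_on_2D(1)[OF \<phi> in_domain]])

lemma space_grad_eq:
  "space_grad \<phi> (y, t0) = frechet_derivative \<phi> (at (y, t0)) (axis 1 1, 0) *\<^sub>R axis 1 1
     + frechet_derivative \<phi> (at (y, t0)) (axis 2 1, 0) *\<^sub>R axis 2 1"
  unfolding space_grad_def grad_def fst_conv snd_conv frechet_derivative_at[OF space_derivative, symmetric]
  by (simp add: vec_eq_iff forall_2 axis_def)

lemma frechet_derivative_split:
  "frechet_derivative \<phi> (at (x0, t0)) (z, \<tau>) = space_grad \<phi> (x0, t0) \<bullet> z + time_deriv \<phi> (x0, t0) * \<tau>"
proof -
  let ?D = "frechet_derivative \<phi> (at (x0, t0))"
  have lin: "linear ?D" using Ck_on_2D(1)[OF \<phi> in_domain] has_derivative_linear by blast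
  have "((\<lambda>s. \<phi> (x0, s)) has_derivative (\<lambda>s. ?D (0, s))) (at t0)"
    by (rule has_derivative_compose[OF has_derivative_const_Pair Ck_on_2D(1)[OF \<phi> in_domain]])
  moreover have "(\<lambda>s. ?D (0, s)) = (*) (?D (0, 1))"
  proof
    show "?D (0, s) = ?D (0, 1) * s" for s
      using linear_cmul[OF lin, of s "(0, 1)"] by (simp add: mult.commute)
  qed
  ultimately have "DERIV (\<lambda>s. \<phi> (x0, s)) t0 :> ?D (0, 1)"
    unfolding has_field_derivative_def by (simp only:)
  then have td: "time_deriv \<phi> (x0, t0) = ?D (0, 1)"
    unfolding time_deriv_def fst_conv snd_conv by (rule DERIV_imp_deriv)
  have "(z, \<tau>) = z $ 1 *\<^sub>R (axis 1 1, 0) + z $ 2 *\<^sub>R (axis 2 1, 0) + \<tau> *\<^sub>R (0, 1)"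
    by (simp add: vec_eq_iff forall_2 axis_def)
  then have "?D (z, \<tau>) = z $ 1 * ?D (axis 1 1, 0) + z $ 2 * ?D (axis 2 1, 0) + \<tau> * ?D (0, 1)"
    by (simp only: linear_add[OF lin] linear_cmul[OF lin] real_scaleR_def)
  then show ?thesis unfolding td space_grad_eq
    by (simp add: inner_add_left inner_axis' mult.commute)
qed

lemma time_derivative: "DERIV (\<lambda>s. \<phi> (x0, s)) t0 :> time_deriv \<phi> (x0, t0)"
proof -
  have "((\<lambda>s. \<phi> (x0, s)) has_derivative (\<lambda>s. frechet_derivative \<phi> (at (x0, t0)) (0, s))) (at t0)"
    by (rule has_derivative_compose[OF has_derivative_const_Pair Ck_on_2D(1)[OF \<phi> in_domain]])
  then show ?thesis unfolding frechet_derivative_split has_field_derivative_def by simp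
qed

text \<open>
  The divergence of \<open>\<nabla>\<phi> / \<bar>\<nabla>\<phi>\<bar>\<close>, written out, is the Hessian evaluated on the tangent \<open>perp p\<close> and divided by \<open>\<bar>p\<bar>\<^sup>3\<close>.
\<close>

lemma curv_hessian:
  assumes p: "space_grad \<phi> (x0, t0) = p" "p \<noteq> 0"
  shows "hessian_form \<phi> (x0, t0) (perp p, 0) (perp p, 0) = - curv \<phi> (x0, t0) * norm p ^ 3"
proof -
  define g1 where "g1 y = frechet_derivative \<phi> (at (y, t0)) (axis 1 1, 0)" for y
  define g2 where "g2 y = frechet_derivative \<phi> (at (y, t0)) (axis 2 1, 0)" for y
  define G1 where "G1 k = second_derivative \<phi> (x0, t0) (axis 1 1, 0) (k, 0)" for k
  define G2 where "G2 k = second_derivative \<phi> (x0, t0) (axis 2 1, 0) (k, 0)" for k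
  have dg: "(g1 has_derivative G1) (at x0)" "(g2 has_derivative G2) (at x0)"
    unfolding g1_def[abs_def] g2_def[abs_def] G1_def[abs_def] G2_def[abs_def]
    by (rule has_derivative_compose[OF has_derivative_Pair_const Ck_on_2D(2)[OF \<phi> in_domain]])+
  have sg: "space_grad \<phi> (y, t0) = g1 y *\<^sub>R axis 1 1 + g2 y *\<^sub>R axis 2 1" for y
    unfolding space_grad_eq g1_def g2_def by (rule refl)
  define p1 p2 where "p1 = p $ 1" and "p2 = p $ 2"
  have gp: "g1 x0 = p1" "g2 x0 = p2"
    using arg_cong[OF p(1)[unfolded sg], of "\<lambda>v. v $ 1"] arg_cong[OF p(1)[unfolded sg], of "\<lambda>v. v $ 2"]
    by (simp_all add: axis_def p1_def p2_def)
  define N where "N y = sqrt ((g1 y)\<^sup>2 + (g2 y)\<^sup>2)" for y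
  have normN: "norm (space_grad \<phi> (y, t0)) = N y" for y
    unfolding sg N_def by (simp add: norm_eq_sqrt_inner inner_vec_def sum_2 axis_def power2_eq_square)
  define r where "r = norm p"
  have "0 < r" using p(2) by (simp add: r_def)
  moreover have "N x0 = r" using normN[of x0, unfolded p(1)] unfolding r_def by (rule sym)
  ultimately have r: "0 < r" "N x0 = r" .
  have r2: "r * r = p1 * p1 + p2 * p2"
    unfolding r_def p1_def p2_def by (simp add: norm_eq_sqrt_inner inner_vec_def sum_2)
  have w0: "0 < (g1 x0)\<^sup>2 + (g2 x0)\<^sup>2"
    using r2 mult_pos_pos[OF r(1) r(1)] unfolding gp power2_eq_square by linarith
  have dsq: "((\<lambda>y. (g1 y)\<^sup>2 + (g2 y)\<^sup>2) has_derivative (\<lambda>k. 2 * (p1 * G1 k + p2 * G2 k))) (at x0)"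
  proof -
    have "((\<lambda>y. g1 y * g1 y + g2 y * g2 y) has_derivative
        (\<lambda>k. (g1 x0 * G1 k + G1 k * g1 x0) + (g2 x0 * G2 k + G2 k * g2 x0))) (at x0)"
      by (intro has_derivative_add has_derivative_mult dg)
    moreover have "(p1 * c + c * p1) + (p2 * d + d * p2) = 2 * (p1 * c + p2 * d)" for c d by algebra
    ultimately show ?thesis by (simp only: gp power2_eq_square)
  qed
  have dN: "(N has_derivative (\<lambda>k. (p1 * G1 k + p2 * G2 k) / r)) (at x0)"
  proof -
    have N: "sqrt ((g1 x0)\<^sup>2 + (g2 x0)\<^sup>2) = r" using r(2) unfolding N_def .
    have half: "2 * c * (inverse r / 2) = c / r" for c
    proof -
      have "2 * c * (inverse r / 2) = c * inverse r" by simp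
      then show ?thesis unfolding divide_inverse[of c r] .
    qed
    show ?thesis
      using has_derivative_real_sqrt[OF w0 dsq]
      unfolding N_def[abs_def, symmetric] N half .
  qed
  have N0: "N x0 \<noteq> 0" using r by simp
  have d1: "((\<lambda>y. g1 y / N y) has_derivative
      (\<lambda>k. - p1 * (inverse r * ((p1 * G1 k + p2 * G2 k) / r) * inverse r) + G1 k / r)) (at x0)"
    using has_derivative_divide[OF dg(1) dN N0] unfolding gp r(2) .
  have d2: "((\<lambda>y. g2 y / N y) has_derivative
      (\<lambda>k. - p2 * (inverse r * ((p1 * G1 k + p2 * G2 k) / r) * inverse r) + G2 k / r)) (at x0)"
    using has_derivative_divide[OF dg(2) dN N0] unfolding gp r(2) .
  define F where "F y = space_grad \<phi> (y, t0) /\<^sub>R norm (space_grad \<phi> (y, t0))" for y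
  have F: "F = (\<lambda>y. (g1 y / N y) *\<^sub>R axis 1 1 + (g2 y / N y) *\<^sub>R axis 2 1)"
    unfolding F_def[abs_def] normN unfolding sg by (simp only: scaleR_add_right scaleR_scaleR divide_inverse mult.commute)
  have "(F has_derivative (\<lambda>k. (- p1 * (inverse r * ((p1 * G1 k + p2 * G2 k) / r) * inverse r) + G1 k / r) *\<^sub>R axis 1 1
      + (- p2 * (inverse r * ((p1 * G1 k + p2 * G2 k) / r) * inverse r) + G2 k / r) *\<^sub>R axis 2 1)) (at x0)"
    unfolding F by (intro has_derivative_add has_derivative_scaleR_left d1 d2)
  from frechet_derivative_at[OF this, symmetric]
  have fF: "frechet_derivative F (at x0) k =
      (- p1 * (inverse r * ((p1 * G1 k + p2 * G2 k) / r) * inverse r) + G1 k / r) *\<^sub>R axis 1 1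
      + (- p2 * (inverse r * ((p1 * G1 k + p2 * G2 k) / r) * inverse r) + G2 k / r) *\<^sub>R axis 2 1" for k
    by simp
  define m11 m12 m21 m22 where "m11 = G1 (axis 1 1)" and "m12 = G1 (axis 2 1)"
    and "m21 = G2 (axis 1 1)" and "m22 = G2 (axis 2 1)"
  have "curv \<phi> (x0, t0) = - divergence F x0"
    unfolding curv_def F_def[abs_def] by simp
  also have "divergence F x0 =
      (- p1 * (inverse r * ((p1 * m11 + p2 * m21) / r) * inverse r) + m11 / r)
      + (- p2 * (inverse r * ((p1 * m12 + p2 * m22) / r) * inverse r) + m22 / r)"
    unfolding divergence_def sum_2 fF by (simp add: axis_def m11_def m12_def m21_def m22_def)
  finally have c: "- curv \<phi> (x0, t0) = \<dots>" by simp
  have "- curv \<phi> (x0, t0) * (r * r * r) =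
      - p1 * (p1 * m11 + p2 * m21) + (r * r) * m11 - p2 * (p1 * m12 + p2 * m22) + (r * r) * m22"
  proof -
    have "r * inverse r = 1" using r(1) by simp
    then show ?thesis unfolding c divide_inverse by algebra
  qed
  also have "\<dots> = p2 * p2 * m11 - p2 * p1 * m12 - p1 * p2 * m21 + p1 * p1 * m22"
    unfolding r2 by (simp add: algebra_simps)
  also have "\<dots> = hessian_form \<phi> (x0, t0) (perp p, 0) (perp p, 0)"
    unfolding hessian_form_space
    by (simp add: perp_def p1_def p2_def m11_def m12_def m21_def m22_def G1_def G2_def)
  finally show ?thesis by (simp add: r_def power3_eq_cube mult.assoc)
qed

end

section \<open>The supersolution property\<close>

context terminal_value_game begin

text \<open>
  Monotonicity in time yields \<open>a \<le> 0\<close>. If \<open>a + \<bar>p\<bar> \<bar>\<kappa>\<bar> powr \<gamma>\<close> were positive at a contact point with \<open>\<kappa> < 0\<close>, then lowering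
  the Hessian of the second order Taylor polynomial by \<open>8 \<eta>\<close> and its time slope by \<open>2 \<eta>\<close> on either side of \<open>t0\<close>
  would give a quadratic that touches \<open>low\<close> strictly from below and still satisfies the strict inequality.
\<close>

lemma low_supersolution: "viscosity_supersolution \<gamma> T low"
  unfolding viscosity_supersolution_def
proof (intro conjI allI ballI impI low_semicontinuous, elim conjE)
  fix \<phi> :: "(real^2) \<times> real \<Rightarrow> real" and X0 :: "(real^2) \<times> real"
  assume X0: "X0 \<in> UNIV \<times> {0<..<T}" and smooth: "smooth_on (UNIV \<times> {0<..<T}) \<phi>"
    and min: "\<forall>\<^sub>F X in nhds X0. low X0 - \<phi> X0 \<le> low X - \<phi> X"
  obtain x0 t0 where xt: "X0 = (x0, t0)" and t0: "0 < t0" "t0 < T" using X0 by auto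
  have \<phi>: "Ck_on (Suc (Suc 0)) (UNIV \<times> {0<..<T}) \<phi>" using smooth unfolding smooth_on_def by (rule spec)
  obtain d where d: "0 < d" "\<And>X. dist X (x0, t0) < d \<Longrightarrow> low (x0, t0) - \<phi> (x0, t0) \<le> low X - \<phi> X"
    using min unfolding xt eventually_nhds_metric by blast
  define p where "p = space_grad \<phi> (x0, t0)"
  define a where "a = time_deriv \<phi> (x0, t0)"
  have a0: "a \<le> 0"
  proof (rule ccontr)
    assume "\<not> a \<le> 0"
    then have "0 < a" by simp
    from DERIV_pos_inc_right[OF time_derivative[OF \<phi> t0, of x0, folded a_def] this]
    obtain d' where d': "0 < d'" "\<And>h. 0 < h \<Longrightarrow> h < d' \<Longrightarrow> \<phi> (x0, t0) < \<phi> (x0, t0 + h)" by blast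
    define h where "h = Min {d, d', T - t0} / 2"
    have "0 < Min {d, d', T - t0}" using d(1) d'(1) t0 by simp
    moreover have "Min {d, d', T - t0} \<le> d" "Min {d, d', T - t0} \<le> d'" "Min {d, d', T - t0} \<le> T - t0" by simp_all
    ultimately have h: "0 < h" "h < d" "h < d'" "h < T - t0" unfolding h_def by linarith+
    have "dist (x0, t0 + h) (x0, t0) < d" using h by (simp add: dist_Pair_Pair dist_real_def)
    from d(2)[OF this] d'(2)[OF h(1,3)] have "low (x0, t0) < low (x0, t0 + h)" by linarith
    moreover have "low (x0, t0 + h) \<le> low (x0, t0)" by (rule low_antimono) (use t0 h in auto)
    ultimately show False by simp
  qed
  have main: "a + norm p * \<bar>curv \<phi> (x0, t0)\<bar> powr \<gamma> \<le> 0" if p0: "p \<noteq> 0" and \<kappa>: "curv \<phi> (x0, t0) < 0"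
  proof (rule ccontr)
    assume nt: "\<not> a + norm p * \<bar>curv \<phi> (x0, t0)\<bar> powr \<gamma> \<le> 0"
    define k where "k = \<bar>curv \<phi> (x0, t0)\<bar> * norm p"
    have np: "0 < norm p" using p0 by simp
    have k: "0 < k" unfolding k_def using \<kappa> np by (intro mult_pos_pos) simp_all
    have kp: "hessian_form \<phi> (x0, t0) (perp p, 0) (perp p, 0) = k * (norm p)\<^sup>2"
      unfolding curv_hessian[OF \<phi> t0 p_def[symmetric] p0] k_def abs_of_neg[OF \<kappa>]
      by (simp only: power3_eq_cube power2_eq_square mult.assoc)
    have "norm p * \<bar>curv \<phi> (x0, t0)\<bar> powr \<gamma> = norm p powr (1 - \<gamma>) * k powr \<gamma>"
    proof -
      define A where "A = \<bar>curv \<phi> (x0, t0)\<bar> powr \<gamma>"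
      define N where "N = norm p powr (1 - \<gamma>)"
      define M where "M = norm p powr \<gamma>"
      have "k powr \<gamma> = A * M" unfolding k_def A_def M_def by (rule powr_mult)
      moreover have "N * M = norm p powr ((1 - \<gamma>) + \<gamma>)" unfolding N_def M_def by (rule powr_add[symmetric])
      then have "N * M = norm p" using np by simp
      moreover have "N * (A * M) = (N * M) * A" by simp
      ultimately show ?thesis unfolding A_def[symmetric] N_def[symmetric] by metis
    qed
    then have pos: "0 < a + norm p powr (1 - \<gamma>) * k powr \<gamma>" using nt by simp
    have "((\<lambda>e. (a - 2 * e) + (norm p - e) powr (1 - \<gamma>) * (k - e) powr \<gamma>) \<longlongrightarrow>
        (a - 2 * 0) + (norm p - 0) powr (1 - \<gamma>) * (k - 0) powr \<gamma>) (at_right 0)"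
      using np k by (intro tendsto_intros) auto
    then have "\<forall>\<^sub>F e in at_right 0. 0 < (a - 2 * e) + (norm p - e) powr (1 - \<gamma>) * (k - e) powr \<gamma>"
      by (rule order_tendstoD(1)) (use pos in simp)
    moreover have "\<forall>\<^sub>F e in at_right (0::real). 0 < e \<and> e < min (norm p) k" by (rule eps_small) (use np k in simp)
    ultimately have "\<forall>\<^sub>F e in at_right 0. 0 < (a - 2 * e) + (norm p - e) powr (1 - \<gamma>) * (k - e) powr \<gamma>
        \<and> (0 < e \<and> e < min (norm p) k)" by (rule eventually_conj)
    from eventually_happens'[OF trivial_limit_at_right_real this]
    obtain e where "0 < (a - 2 * e) + (norm p - e) powr (1 - \<gamma>) * (k - e) powr \<gamma>"
      "0 < e" "e < min (norm p) k" by (elim exE conjE)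
    then have e: "0 < (a - 2 * e) + (norm p - e) powr (1 - \<gamma>) * (k - e) powr \<gamma>"
      "0 < e" "e < norm p" "e < k" by simp_all
    \<comment> \<open>the Hessian will be lowered by \<open>8 \<eta>\<close>, so \<open>e\<close> bounds all losses\<close>
    define \<eta> where "\<eta> = e / 8"
    have \<eta>: "0 < \<eta>" "8 * \<eta> = e" using e(2) by (simp_all add: \<eta>_def)
    let ?Q = "hessian_form \<phi> (x0, t0)"
    obtain r1 where r1: "0 < r1" "\<And>W. norm W < r1 \<Longrightarrow> (x0, t0) + W \<in> UNIV \<times> {0<..<T} \<and>
      \<bar>\<phi> ((x0, t0) + W) - \<phi> (x0, t0) - frechet_derivative \<phi> (at (x0, t0)) W - ?Q W W / 2\<bar> \<le> \<eta> / 2 * (norm W)\<^sup>2"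
    proof -
      have o: "open (UNIV \<times> {0<..<T} :: ((real^2) \<times> real) set)" by (intro open_Times) simp_all
      have e2: "0 < \<eta> / 2" using \<eta>(1) by simp
      show thesis
        by (rule second_order_Taylor[where f = \<phi> and e = "\<eta> / 2" and ?X0.0 = "(x0, t0)", OF o in_domain[OF \<phi> t0, of x0] \<phi> e2])
          (rule that, assumption, assumption)
    qed
    note bil = bilinear_hessian_form[of \<phi> "(x0, t0)"]
    obtain C where C: "0 < C" "\<And>V W. \<bar>?Q V W\<bar> \<le> C * norm V * norm W"
      using bilinear_bounded_pos[OF bil] by auto
    \<comment> \<open>the last bound lets the mixed and the pure time terms of the Hessian be absorbed by \<open>\<eta> \<bar>\<tau>\<bar>\<close>\<close>
    define r where "r = Min {r1, d, t0, T - t0, \<eta> / (\<eta> + 2 * C)} / 3"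
    have rM: "3 * r = Min {r1, d, t0, T - t0, \<eta> / (\<eta> + 2 * C)}" by (simp add: r_def)
    have "0 < 3 * r" unfolding rM using r1(1) d(1) t0 \<eta>(1) C(1) by (simp add: add_pos_pos)
    moreover have "3 * r \<le> r1" "3 * r \<le> d" "3 * r \<le> t0" "3 * r \<le> T - t0" "3 * r \<le> \<eta> / (\<eta> + 2 * C)"
      unfolding rM by simp_all
    ultimately have r: "0 < r" "2 * r < r1" "2 * r < d" "r < t0" "r < T - t0" "r \<le> \<eta> / (\<eta> + 2 * C)" by linarith+
    have rC: "(\<eta> + 2 * C) * r \<le> \<eta>"
    proof -
      have "0 < \<eta> + 2 * C" using \<eta>(1) C(1) by simp
      then show ?thesis using r(6) by (simp add: pos_le_divide_eq mult.commute)
    qed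
    define B where "B h k = ?Q (h, 0) (k, 0) - 8 * \<eta> / 2 * (h \<bullet> k)" for h k :: "real^2"
    have pairs: "(h + h', 0::real) = (h, 0) + (h', 0)" "(c *\<^sub>R h, 0::real) = c *\<^sub>R (h, 0)" for h h' :: "real^2" and c
      by simp_all
    have Q_lin: "?Q (h + h', 0) (k, 0) = ?Q (h, 0) (k, 0) + ?Q (h', 0) (k, 0)"
      "?Q (k, 0) (h + h', 0) = ?Q (k, 0) (h, 0) + ?Q (k, 0) (h', 0)"
      "?Q (c *\<^sub>R h, 0) (k, 0) = c * ?Q (h, 0) (k, 0)" "?Q (k, 0) (c *\<^sub>R h, 0) = c * ?Q (k, 0) (h, 0)"
      for h h' k :: "real^2" and c
      by (simp_all only: pairs bilinear_ladd[OF bil] bilinear_radd[OF bil] bilinear_lmul[OF bil] bilinear_rmul[OF bil]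
          real_scaleR_def)
    have B: "bilinear B"
      unfolding bilinear_def B_def
      by (intro conjI allI linearI) (simp_all add: Q_lin inner_add_left inner_add_right algebra_simps)
    have Bsym: "B h k = B k h" for h k
      unfolding B_def by (simp add: hessian_form_commute[of _ _ "(h, 0)"] inner_commute[of h])
    have touch: "low (x0, t0) + (p \<bullet> z + B z z / 2 + a * \<tau> - 2 * \<eta> * \<bar>\<tau>\<bar>) + \<eta> * ((norm z)\<^sup>2 + \<bar>\<tau>\<bar>)
        \<le> low (x0 + z, t0 + \<tau>)" if z: "norm z \<le> r" "\<bar>\<tau>\<bar> \<le> r" for z \<tau>
    proof -
      have nW: "(norm (z, \<tau>))\<^sup>2 = (norm z)\<^sup>2 + \<tau>\<^sup>2" by (simp add: norm_Pair)
      have "norm (z, \<tau>) \<le> norm z + norm \<tau>" by (rule norm_Pair_le)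
      then have W: "norm (z, \<tau>) < r1" "norm (z, \<tau>) < d" using z r(2,3) by auto
      have "dist (x0 + z, t0 + \<tau>) (x0, t0) < d"
        using W(2) by (simp add: dist_norm)
      from d(2)[OF this] have 1: "low (x0, t0) + (\<phi> (x0 + z, t0 + \<tau>) - \<phi> (x0, t0)) \<le> low (x0 + z, t0 + \<tau>)" by simp
      have 2: "p \<bullet> z + a * \<tau> + ?Q (z, \<tau>) (z, \<tau>) / 2 - \<eta> / 2 * ((norm z)\<^sup>2 + \<tau>\<^sup>2) \<le> \<phi> (x0 + z, t0 + \<tau>) - \<phi> (x0, t0)"
        using abs_le_D2[OF conjunct2[OF r1(2)[OF W(1)]]]
        unfolding nW add_Pair frechet_derivative_split[OF \<phi> t0] p_def[symmetric] a_def[symmetric]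
        by linarith
      have split: "(z, \<tau>) = (z, 0) + (0, \<tau>)" by simp
      have "?Q (z, \<tau>) (z, \<tau>) = ?Q (z, 0) (z, 0) + 2 * ?Q (z, 0) (0, \<tau>) + ?Q (0, \<tau>) (0, \<tau>)"
        unfolding split bilinear_ladd[OF bil] bilinear_radd[OF bil]
        using hessian_form_commute[of \<phi> "(x0, t0)" "(0, \<tau>)" "(z, 0)"] by simp
      moreover have "\<bar>?Q (z, 0) (0, \<tau>)\<bar> \<le> C * norm z * \<bar>\<tau>\<bar>" "\<bar>?Q (0, \<tau>) (0, \<tau>)\<bar> \<le> C * \<bar>\<tau>\<bar> * \<bar>\<tau>\<bar>"
        using C(2)[of "(z, 0)" "(0, \<tau>)"] C(2)[of "(0, \<tau>)" "(0, \<tau>)"] by (simp_all add: norm_Pair)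
      moreover have "C * norm z * \<bar>\<tau>\<bar> \<le> C * r * \<bar>\<tau>\<bar>" "C * \<bar>\<tau>\<bar> * \<bar>\<tau>\<bar> \<le> C * r * \<bar>\<tau>\<bar>"
        by (rule mult_right_mono[OF mult_left_mono[OF _ less_imp_le[OF C(1)]] abs_ge_zero], rule z)+
      ultimately have 3: "?Q (z, 0) (z, 0) - 3 * (C * r * \<bar>\<tau>\<bar>) \<le> ?Q (z, \<tau>) (z, \<tau>)" by linarith
      have "\<eta> * \<tau>\<^sup>2 \<le> \<eta> * r * \<bar>\<tau>\<bar>"
      proof -
        have "\<tau>\<^sup>2 = \<bar>\<tau>\<bar> * \<bar>\<tau>\<bar>" by (simp add: power2_eq_square)
        also have "\<dots> \<le> r * \<bar>\<tau>\<bar>" using z(2) by (intro mult_right_mono) auto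
        finally show ?thesis using \<eta>(1) by (simp add: mult.assoc)
      qed
      moreover have "(\<eta> + 2 * C) * r * \<bar>\<tau>\<bar> \<le> \<eta> * \<bar>\<tau>\<bar>" using rC by (intro mult_right_mono) auto
      moreover have "(\<eta> + 2 * C) * r * \<bar>\<tau>\<bar> = \<eta> * r * \<bar>\<tau>\<bar> + 2 * (C * r * \<bar>\<tau>\<bar>)" by (simp add: algebra_simps)
      moreover have "0 \<le> C * r * \<bar>\<tau>\<bar>" "0 \<le> \<eta> * (norm z)\<^sup>2" "0 \<le> \<eta> * r * \<bar>\<tau>\<bar>" using C(1) r(1) \<eta>(1) by simp_all
      ultimately have 4: "\<eta> * \<tau>\<^sup>2 + 3 * (C * r * \<bar>\<tau>\<bar>) \<le> 2 * (\<eta> * \<bar>\<tau>\<bar>)" by linarith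
      have Bz: "B z z = ?Q (z, 0) (z, 0) - 4 * (\<eta> * (norm z)\<^sup>2)" by (simp add: B_def power2_norm_eq_inner)
      have sum: "l + (P + (H - 4 * N) / 2 + A - 2 * \<eta> * t) + \<eta> * (N' + t) \<le> l'"
        if "l + (f' - f) \<le> l'" "P + A + Q / 2 - \<eta> / 2 * (N' + t') \<le> f' - f" "H - 3 * c \<le> Q"
          "\<eta> * t' + 3 * c \<le> 2 * (\<eta> * t)" "N = \<eta> * N'" "0 \<le> N" for l l' f f' P A Q H N N' c t t' :: real
      proof -
        have e: "\<eta> * (N' + t) = N + \<eta> * t" "2 * \<eta> * t = 2 * (\<eta> * t)" "\<eta> / 2 * (N' + t') = (N + \<eta> * t') / 2"
          using that(5) by (simp_all add: distrib_left)
        have lin: "l + (P + (H - 4 * N) / 2 + A - 2 * q) + (N + q) \<le> l'"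
          if "l + (f' - f) \<le> l'" "P + A + Q / 2 - (N + q') / 2 \<le> f' - f" "H - 3 * c \<le> Q" "q' + 3 * c \<le> 2 * q"
            "0 \<le> N" for q q' using that by (simp add: field_simps)
        show ?thesis unfolding e(1,2) by (rule lin[OF that(1) that(2)[unfolded e(3)] that(3,4,6)])
      qed
      show ?thesis unfolding Bz by (rule sum[OF 1 2 3 4 refl \<open>0 \<le> \<eta> * (norm z)\<^sup>2\<close>])
    qed
    have P0: "0 < norm p - e" "norm p - e < norm p" and k0: "0 < k - e" using e by simp_all
    have kB: "(k - e) * (norm p)\<^sup>2 < B (perp p) (perp p)"
    proof -
      have "B (perp p) (perp p) = k * (norm p)\<^sup>2 - 4 * (\<eta> * (norm p)\<^sup>2)"
        unfolding B_def kp using norm_perp[of p] by (simp add: power2_norm_eq_inner[symmetric])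
      moreover have "(k - e) * (norm p)\<^sup>2 = k * (norm p)\<^sup>2 - 8 * (\<eta> * (norm p)\<^sup>2)"
        unfolding \<eta>(2)[symmetric] by (simp add: algebra_simps)
      moreover have "0 < \<eta> * (norm p)\<^sup>2" using \<eta>(1) np by simp
      ultimately show ?thesis by linarith
    qed
    have pos': "0 < (a - 2 * \<eta>) + (norm p - e) powr (1 - \<gamma>) * (k - e) powr \<gamma>"
      using e(1,2) \<eta>(2) by linarith
    show False
      by (rule no_quadratic_contact[where B = B and p = p and a = a and \<eta> = \<eta> and r = r and ?x0.0 = x0
            and ?t0.0 = t0 and ?P0.0 = "norm p - e" and ?k0.0 = "k - e",
            OF t0 B Bsym \<eta>(1) r(1,4,5) touch P0 k0 kB pos'])
  qed
  show "if space_grad \<phi> X0 \<noteq> 0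
      then time_deriv \<phi> X0 - norm (space_grad \<phi> X0) * speed \<gamma> (curv \<phi> X0) \<le> 0
      else time_deriv \<phi> X0 \<le> 0"
  proof (cases "p \<noteq> 0 \<and> curv \<phi> (x0, t0) < 0")
    case True
    then have "speed \<gamma> (curv \<phi> (x0, t0)) = - (\<bar>curv \<phi> (x0, t0)\<bar> powr \<gamma>)" by (simp add: speed_def)
    then show ?thesis using main True a0 unfolding xt p_def[symmetric] a_def[symmetric] by simp
  next
    case False
    then have "p = 0 \<or> speed \<gamma> (curv \<phi> (x0, t0)) = 0" by (auto simp: speed_def)
    then show ?thesis using a0 unfolding xt p_def[symmetric] a_def[symmetric] by auto
  qed
qed

end

theorem lemma3p3:
  fixes \<gamma> T \<alpha>1 \<alpha>2 :: real and \<Omega> :: "(real^2) set" and u0 :: "real^2 \<Rightarrow> real"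
  assumes "1/3 < \<gamma>" "\<gamma> < 1" "0 < T"
    and "smooth_bounded_domain \<Omega>"
    and "\<exists>L. L-lipschitz_on UNIV u0"
    and "\<forall>x\<in>\<Omega>. u0 x < 0"
    and "\<forall>x\<in>- closure \<Omega>. 0 \<le> u0 x"
    and "\<forall>x. \<bar>u0 x\<bar> \<le> 1"
    and "(1 - \<gamma>) / (2 * \<gamma>) < \<alpha>1" "\<alpha>1 < min 1 ((1 - \<gamma>) / \<gamma>)"
    and "0 < \<alpha>2" "\<alpha>2 < min (\<alpha>1 * (2 * \<gamma> / (1 - \<gamma>)) - 1) (1/3)"
  shows "viscosity_supersolution \<gamma> T (lower_half_relaxed \<gamma> \<alpha>1 \<alpha>2 T u0)"
proof -
  obtain L where L: "L-lipschitz_on UNIV u0" using assms(5) by blast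
  have \<gamma>: "0 < \<gamma>" using assms(1) by linarith
  note \<alpha>1_le = assms(10)[unfolded min_less_iff_conj, THEN conjunct1] assms(10)[unfolded min_less_iff_conj, THEN conjunct2]
  have \<alpha>2: "\<alpha>2 < 1 / 3" using assms(12) unfolding min_less_iff_conj by (rule conjunct2)
  have "0 < 1 - \<gamma>" "0 < 2 * \<gamma>" using \<gamma> assms(2) by linarith+
  then have "0 < (1 - \<gamma>) / (2 * \<gamma>)" by (rule divide_pos_pos)
  then have \<alpha>1: "0 < \<alpha>1" using assms(9) by (rule less_trans)
  have "\<alpha>1 * \<gamma> < 1 - \<gamma>" using \<alpha>1_le(2) unfolding pos_less_divide_eq[OF \<gamma>] .
  then have "\<alpha>1 * (2 * \<gamma>) < 2 * (1 - \<gamma>)" unfolding mult.left_commute[of \<alpha>1 2 \<gamma>] by (rule mult_strict_left_mono) (rule zero_less_numeral)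
  then have "\<alpha>1 * (2 * \<gamma>) / (1 - \<gamma>) < 2" unfolding pos_divide_less_eq[OF \<open>0 < 1 - \<gamma>\<close>] .
  then have \<alpha>1': "\<alpha>1 * (2 * \<gamma> / (1 - \<gamma>)) < 2" unfolding times_divide_eq_right .
  \<comment> \<open>a positive Lipschitz constant is convenient, also for constant \<open>u0\<close>\<close>
  have L': "(max L 1)-lipschitz_on UNIV u0" by (rule lipschitz_on_le[OF L]) (rule max.cobounded1)
  have bnd: "\<bar>u0 x\<bar> \<le> 1" for x using assms(8) by (rule spec)
  have \<alpha>2': "\<alpha>2 < 1" using \<alpha>2 by linarith
  have max: "0 < max L 1" by (simp add: less_max_iff_disj)
  interpret terminal_value_game \<gamma> \<alpha>1 \<alpha>2 "max L 1" u0 T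
    by (intro terminal_value_game.intro curvature_game.intro terminal_value_game_axioms.intro)
      (fact \<gamma> assms(2) \<alpha>1 \<alpha>1_le(1) \<alpha>1' assms(11) \<alpha>2' L' max assms(3) bnd)+
  show ?thesis by (rule low_supersolution)
qed

end
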